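(* Let $K$ be a field of characteristic zero and $R=K[X_1,\ldots,X_n]$ with its standard grading. Let $A_n(K)$ be the $n$-th Weyl algebra over $K$, graded by $\deg X_k=1$ and $\deg\partial_k=-1$. Let $I,J$ be homogeneous ideals of $R$, let $i,j\ge 0$, and set $M=H^i_I(R)$ and $N=H^j_J(R)$, regarded as graded left $A_n(K)$-modules. Fix $\nu\ge 0$. Then the graded $K$-vector space $\operatorname{Ext}^{\nu}_{A_n(K)}(M,N)$ is concentrated in degree zero, i.e. $\operatorname{Ext}^{\nu}_{A_n(K)}(M,N)_l=0$ for all $l\neq 0$.
   Context: $A_n(K)=K\langle X_1,\ldots,X_n,\partial_1,\ldots,\partial_n\rangle$ is the ring of $K$-linear differential operators on $R$, a $\mathbb{Z}$-graded ring. $H^i_I(R)$ denotes local cohomology with support in $I$; it is a graded left holonomic $A_n(K)$-module, with its natural structure (e.g. induced from the Čech complex on homogeneous generators of $I$). For a $\mathbb{Z}$-graded ring $S$ and graded left $S$-modules $M,N$, let $\operatorname{Hom}_l(M,N)$ be the group of $S$-linear maps $\phi$ with $\phi(M_k)\subseteq N_{k+l}$ for all $k$, and ${}^*\operatorname{Hom}_S(M,N)=\bigoplus_{l\in\mathbb{Z}}\operatorname{Hom}_l(M,N)$. ${}^*\operatorname{Ext}^{\nu}_S(M,-)$ is the $\nu$-th right derived functor of ${}^*\operatorname{Hom}_S(M,-)$ on the category of graded $S$-modules with degree-preserving maps. If $S$ is left and right Noetherian and $M$ is finitely generated (as is the case here), ${}^*\operatorname{Ext}^{\nu}_S(M,N)=\operatorname{Ext}^{\nu}_S(M,N)$,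 which gives the grading on $\operatorname{Ext}^{\nu}_{A_n(K)}(M,N)$. *)

theory Defs
  imports
    "HOL-Algebra.Generated_Rings"
    "HOL-Algebra.Module"
    "HOL-Library.Poly_Mapping"
    "HOL-Computational_Algebra.Fraction_Field"
begin

section \<open>Graded rings and graded left modules\<close>

text \<open>
  A \<open>\<int>\<close>-grading is the family of its homogeneous components: \<open>gcomp S d\<close> is \<open>S\<^sub>d\<close> for a ring,
  \<open>hcomp M k\<close> is \<open>M\<^sub>k\<close> for a module.  As in \<open>HOL-Algebra\<close>, the fields \<open>mult\<close> and \<open>one\<close> of a module
  record carry no meaning.
\<close>

record 'a graded_ring = "'a ring" +
  gcomp :: "int \<Rightarrow> 'a set"

record ('s, 'm) graded_module = "('s, 'm) module" +
  hcomp :: "int \<Rightarrow> 'm set"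

definition internal_direct_sum :: "('a, 'z) ring_scheme \<Rightarrow> (int \<Rightarrow> 'a set) \<Rightarrow> bool" where
  "internal_direct_sum G P \<longleftrightarrow>
     (\<forall>k. additive_subgroup (P k) G) \<and>
     (\<forall>x\<in>carrier G. \<exists>!c. (\<forall>k. c k \<in> P k) \<and> finite {k. c k \<noteq> \<zero>\<^bsub>G\<^esub>} \<and>
        x = finsum G c {k. c k \<noteq> \<zero>\<^bsub>G\<^esub>})"

locale Z_graded_ring = ring S for S :: "('s, 'z) graded_ring_scheme" (structure) +
  assumes direct_sum: "internal_direct_sum S (gcomp S)"
    and gcomp_mult: "\<lbrakk>a \<in> gcomp S d; b \<in> gcomp S e\<rbrakk> \<Longrightarrow> a \<otimes> b \<in> gcomp S (d + e)"

text \<open>The locale \<open>module\<close> of \<open>HOL-Algebra\<close> requires a commutative ring of scalars.\<close>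

locale left_module = R?: ring R + M?: abelian_group M
  for R :: "('s, 'z) ring_scheme" (structure) and M :: "('s, 'm, 'y) module_scheme" (structure) +
  assumes smult_closed:
      "\<lbrakk>a \<in> carrier R; x \<in> carrier M\<rbrakk> \<Longrightarrow> a \<odot>\<^bsub>M\<^esub> x \<in> carrier M"
    and smult_l_distr:
      "\<lbrakk>a \<in> carrier R; b \<in> carrier R; x \<in> carrier M\<rbrakk> \<Longrightarrow>
        (a \<oplus>\<^bsub>R\<^esub> b) \<odot>\<^bsub>M\<^esub> x = a \<odot>\<^bsub>M\<^esub> x \<oplus>\<^bsub>M\<^esub> b \<odot>\<^bsub>M\<^esub> x"
    and smult_r_distr:
      "\<lbrakk>a \<in> carrier R; x \<in> carrier M; y \<in> carrier M\<rbrakk> \<Longrightarrow>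
        a \<odot>\<^bsub>M\<^esub> (x \<oplus>\<^bsub>M\<^esub> y) = a \<odot>\<^bsub>M\<^esub> x \<oplus>\<^bsub>M\<^esub> a \<odot>\<^bsub>M\<^esub> y"
    and smult_assoc1:
      "\<lbrakk>a \<in> carrier R; b \<in> carrier R; x \<in> carrier M\<rbrakk> \<Longrightarrow>
        (a \<otimes>\<^bsub>R\<^esub> b) \<odot>\<^bsub>M\<^esub> x = a \<odot>\<^bsub>M\<^esub> (b \<odot>\<^bsub>M\<^esub> x)"
    and smult_one:
      "x \<in> carrier M \<Longrightarrow> \<one>\<^bsub>R\<^esub> \<odot>\<^bsub>M\<^esub> x = x"

locale graded_left_module = Z_graded_ring S + left_module S M
  for S :: "('s, 'z) graded_ring_scheme" and M :: "('s, 'm) graded_module" +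
  assumes hcomp_direct_sum: "internal_direct_sum M (hcomp M)"
    and hcomp_smult:
      "\<lbrakk>a \<in> gcomp S d; x \<in> hcomp M k\<rbrakk> \<Longrightarrow> a \<odot>\<^bsub>M\<^esub> x \<in> hcomp M (d + k)"

text \<open>Maps are extensional on the carrier, so that equality of maps is equality in \<open>HOL\<close>.\<close>

definition left_hom ::
    "('s, 'z) ring_scheme \<Rightarrow> ('s, 'm) graded_module \<Rightarrow> ('s, 'p) graded_module \<Rightarrow> ('m \<Rightarrow> 'p) set" where
  "left_hom S M N = {\<phi> \<in> carrier M \<rightarrow>\<^sub>E carrier N.
     (\<forall>x\<in>carrier M. \<forall>y\<in>carrier M. \<phi> (x \<oplus>\<^bsub>M\<^esub> y) = \<phi> x \<oplus>\<^bsub>N\<^esub> \<phi> y) \<and>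
     (\<forall>a\<in>carrier S. \<forall>x\<in>carrier M. \<phi> (a \<odot>\<^bsub>M\<^esub> x) = a \<odot>\<^bsub>N\<^esub> \<phi> x)}"

definition graded_hom ::
    "('s, 'z) ring_scheme \<Rightarrow> ('s, 'm) graded_module \<Rightarrow> ('s, 'p) graded_module \<Rightarrow> int \<Rightarrow> ('m \<Rightarrow> 'p) set"
  where
  "graded_hom S M N l = {\<phi> \<in> left_hom S M N. \<forall>k. \<phi> ` hcomp M k \<subseteq> hcomp N (k + l)}"

text \<open>
  \<open>*Hom\<^sub>S(M, N)\<close>, the sum of the groups \<open>Hom\<^sub>l(M, N)\<close> inside \<open>Hom\<^sub>S(M, N)\<close>.  The argument
  \<open>\<iota> :: 'k \<Rightarrow> 's\<close> is the structure map of \<open>S\<close> as an algebra over a field \<open>'k\<close>, through which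
  \<open>*Hom\<^sub>S(M, N)\<close> is a graded vector space.
\<close>

definition star_Hom ::
    "('s, 'z) ring_scheme \<Rightarrow> ('k \<Rightarrow> 's) \<Rightarrow> ('s, 'm) graded_module \<Rightarrow> ('s, 'p) graded_module
      \<Rightarrow> ('k, 'm \<Rightarrow> 'p) graded_module" where
  "star_Hom S \<iota> M N =
     \<lparr>carrier = {\<phi> \<in> left_hom S M N. \<exists>L \<psi>. finite L \<and> (\<forall>l\<in>L. \<psi> l \<in> graded_hom S M N l) \<and>
        (\<forall>x\<in>carrier M. \<phi> x = finsum N (\<lambda>l. \<psi> l x) L)},
      monoid.mult = undefined, monoid.one = undefined,
      ring.zero = (\<lambda>x\<in>carrier M. \<zero>\<^bsub>N\<^esub>),
      ring.add = (\<lambda>\<phi> \<psi>. \<lambda>x\<in>carrier M. \<phi> x \<oplus>\<^bsub>N\<^esub> \<psi> x),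
      smult = (\<lambda>c \<phi>. \<lambda>x\<in>carrier M. \<iota> c \<odot>\<^bsub>N\<^esub> \<phi> x),
      hcomp = graded_hom S M N\<rparr>"


section \<open>Cohomology of complexes of graded modules\<close>

definition quotient_module :: "('s, 'm) graded_module \<Rightarrow> 'm set \<Rightarrow> ('s, 'm set) graded_module" where
  "quotient_module M B =
     \<lparr>carrier = a_rcosets\<^bsub>M\<^esub> B,
      monoid.mult = undefined, monoid.one = undefined,
      ring.zero = B,
      ring.add = (<+>\<^bsub>M\<^esub>),
      smult = (\<lambda>a U. \<Union>u\<in>U. B +>\<^bsub>M\<^esub> (a \<odot>\<^bsub>M\<^esub> u)),
      hcomp = (\<lambda>k. (\<lambda>x. B +>\<^bsub>M\<^esub> x) ` hcomp M k)\<rparr>"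

definition cocycles ::
    "(nat \<Rightarrow> ('s, 'm) graded_module) \<Rightarrow> (nat \<Rightarrow> 'm \<Rightarrow> 'm) \<Rightarrow> nat \<Rightarrow> ('s, 'm) graded_module" where
  "cocycles C d i = (C i)
     \<lparr>carrier := {x \<in> carrier (C i). d i x = \<zero>\<^bsub>C (Suc i)\<^esub>},
      hcomp := (\<lambda>k. {x \<in> hcomp (C i) k. d i x = \<zero>\<^bsub>C (Suc i)\<^esub>})\<rparr>"

definition coboundaries ::
    "(nat \<Rightarrow> ('s, 'm) graded_module) \<Rightarrow> (nat \<Rightarrow> 'm \<Rightarrow> 'm) \<Rightarrow> nat \<Rightarrow> 'm set" where
  "coboundaries C d i = (case i of 0 \<Rightarrow> {\<zero>\<^bsub>C 0\<^esub>} | Suc j \<Rightarrow> d j ` carrier (C j))"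

text \<open>\<open>H\<^sup>i\<close> of the complex \<open>0 \<rightarrow> C 0 \<rightarrow> C 1 \<rightarrow> \<dots>\<close> with differentials \<open>d i : C i \<rightarrow> C (i + 1)\<close> of degree 0.\<close>

definition cohomology ::
    "(nat \<Rightarrow> ('s, 'm) graded_module) \<Rightarrow> (nat \<Rightarrow> 'm \<Rightarrow> 'm) \<Rightarrow> nat \<Rightarrow> ('s, 'm set) graded_module" where
  "cohomology C d i = quotient_module (cocycles C d i) (coboundaries C d i)"


section \<open>Graded injective resolutions and \<open>*Ext\<close>\<close>

text \<open>
  Injectivity in the category of graded left \<open>S\<close>-modules and degree-preserving maps.  HOL cannot
  quantify over types in a formula, so the test modules \<open>A\<close>, \<open>B\<close> have their carriers in the same
  type as \<open>Q\<close>.  Every injective object satisfies this; conversely, if \<open>S\<close> has no more elements than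
  that type, all graded left ideals of \<open>S\<close> and their shifts occur among the \<open>A\<close> and \<open>B\<close>, and Baer's
  criterion gives injectivity.  For the Weyl algebra over an infinite field this is automatic
  unless \<open>Q = 0\<close>, since a nonzero module has at least as many elements as the field.
\<close>

definition graded_injective ::
    "('s, 'z) graded_ring_scheme \<Rightarrow> ('s, 'm) graded_module \<Rightarrow> bool" where
  "graded_injective S Q \<longleftrightarrow> graded_left_module S Q \<and>
     (\<forall>(A :: ('s, 'm) graded_module) (B :: ('s, 'm) graded_module) f g.
        graded_left_module S A \<and> graded_left_module S B \<and>
        f \<in> graded_hom S A B 0 \<and> inj_on f (carrier A) \<and> g \<in> graded_hom S A Q 0
        \<longrightarrow> (\<exists>h\<in>graded_hom S B Q 0. \<forall>x\<in>carrier A. h (f x) = g x))"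

text \<open>\<open>0 \<rightarrow> N \<rightarrow> E 0 \<rightarrow> E 1 \<rightarrow> \<dots>\<close> is exact, with augmentation \<open>\<epsilon>\<close> and differentials \<open>\<delta> i\<close>.\<close>

definition graded_injective_resolution ::
    "('s, 'z) graded_ring_scheme \<Rightarrow> ('s, 'p) graded_module \<Rightarrow> (nat \<Rightarrow> ('s, 'e) graded_module)
      \<Rightarrow> ('p \<Rightarrow> 'e) \<Rightarrow> (nat \<Rightarrow> 'e \<Rightarrow> 'e) \<Rightarrow> bool" where
  "graded_injective_resolution S N E \<epsilon> \<delta> \<longleftrightarrow>
     (\<forall>i. graded_injective S (E i)) \<and>
     \<epsilon> \<in> graded_hom S N (E 0) 0 \<and> inj_on \<epsilon> (carrier N) \<and>
     (\<forall>i. \<delta> i \<in> graded_hom S (E i) (E (Suc i)) 0) \<and>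
     \<epsilon> ` carrier N = {x \<in> carrier (E 0). \<delta> 0 x = \<zero>\<^bsub>E 1\<^esub>} \<and>
     (\<forall>i. \<delta> i ` carrier (E i) = {x \<in> carrier (E (Suc i)). \<delta> (Suc i) x = \<zero>\<^bsub>E (Suc (Suc i))\<^esub>})"

text \<open>
  \<open>*Ext\<^sup>\<nu>\<^sub>S(M, N)\<close> as the \<open>\<nu>\<close>-th right derived functor of \<open>*Hom\<^sub>S(M, -)\<close>, computed from a graded
  injective resolution \<open>(E, \<delta>)\<close> of \<open>N\<close>.
\<close>

definition star_Ext ::
    "('s, 'z) ring_scheme \<Rightarrow> ('k \<Rightarrow> 's) \<Rightarrow> ('s, 'm) graded_module \<Rightarrow> (nat \<Rightarrow> ('s, 'e) graded_module)
      \<Rightarrow> (nat \<Rightarrow> 'e \<Rightarrow> 'e) \<Rightarrow> nat \<Rightarrow> ('k, ('m \<Rightarrow> 'e) set) graded_module" where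
  "star_Ext S \<iota> M E \<delta> \<nu> =
     cohomology (\<lambda>i. star_Hom S \<iota> M (E i)) (\<lambda>i \<phi>. \<lambda>x\<in>carrier M. \<delta> i (\<phi> x)) \<nu>"


section \<open>Polynomials and rational functions\<close>

text \<open>
  Polynomials in countably many variables \<open>X\<^sub>0, X\<^sub>1, \<dots>\<close>; \<open>K[X\<^sub>1, \<dots>, X\<^sub>n]\<close> is the subring \<open>polys n\<close> of
  those involving only \<open>X\<^sub>0, \<dots>, X\<^bsub>n-1\<^esub>\<close>.
\<close>

type_synonym 'k mpoly = "(nat \<Rightarrow>\<^sub>0 nat) \<Rightarrow>\<^sub>0 'k"

definition polys :: "nat \<Rightarrow> 'k::field mpoly set" where
  "polys n = {p. \<forall>m\<in>Poly_Mapping.keys p. Poly_Mapping.keys m \<subseteq> {..<n}}"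

definition poly_ring :: "nat \<Rightarrow> 'k::field mpoly ring" where
  "poly_ring n = \<lparr>carrier = polys n, monoid.mult = (*), monoid.one = 1, ring.zero = 0, ring.add = (+)\<rparr>"

definition Const :: "'k::field \<Rightarrow> 'k mpoly" where
  "Const c = Poly_Mapping.single 0 c"

definition Var :: "nat \<Rightarrow> 'k::field mpoly" where
  "Var i = Poly_Mapping.single (Poly_Mapping.single i 1) 1"

definition pderivative :: "nat \<Rightarrow> 'k::field mpoly \<Rightarrow> 'k mpoly" where
  "pderivative i p = (\<Sum>m\<in>Poly_Mapping.keys p.
     Poly_Mapping.single (m - Poly_Mapping.single i 1)
       (of_nat (Poly_Mapping.lookup m i) * Poly_Mapping.lookup p m))"

text \<open>The degree is an integer, so that \<open>R\<^sub>d = 0\<close> for \<open>d < 0\<close>.\<close>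

definition homogeneous :: "int \<Rightarrow> 'k::field mpoly \<Rightarrow> bool" where
  "homogeneous d p \<longleftrightarrow>
     (\<forall>m\<in>Poly_Mapping.keys p. int (\<Sum>i\<in>Poly_Mapping.keys m. Poly_Mapping.lookup m i) = d)"

definition homogeneous_ideal :: "nat \<Rightarrow> 'k::field mpoly set \<Rightarrow> bool" where
  "homogeneous_ideal n I \<longleftrightarrow> ideal I (poly_ring n) \<and>
     (\<exists>H \<subseteq> polys n. (\<forall>h\<in>H. \<exists>d. homogeneous d h) \<and> I = Idl\<^bsub>poly_ring n\<^esub> H)"

text \<open>The generators are nonzero, so that all localizations lie in the field of fractions.\<close>

definition homogeneous_generators :: "nat \<Rightarrow> 'k::field mpoly set \<Rightarrow> 'k mpoly list \<Rightarrow> bool" where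
  "homogeneous_generators n I fs \<longleftrightarrow>
     (\<forall>f\<in>set fs. f \<in> polys n \<and> f \<noteq> 0 \<and> (\<exists>d. homogeneous d f)) \<and> I = Idl\<^bsub>poly_ring n\<^esub> (set fs)"

definition fracs :: "nat \<Rightarrow> 'k::field mpoly fract set" where
  "fracs n = {Fract a b | a b. a \<in> polys n \<and> b \<in> polys n \<and> b \<noteq> 0}"

abbreviation (input) to_frac :: "'k::field mpoly \<Rightarrow> 'k mpoly fract" where
  "to_frac p \<equiv> Fract p 1"

definition frac_derivative :: "nat \<Rightarrow> 'k::field mpoly fract \<Rightarrow> 'k mpoly fract" where
  "frac_derivative i x = (THE y. \<exists>a b. b \<noteq> 0 \<and> x = Fract a b \<and>
     y = Fract (pderivative i a * b - a * pderivative i b) (b * b))"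


section \<open>The Weyl algebra\<close>

text \<open>
  \<open>V\<close> is a \<open>K\<close>-space on which polynomials act by multiplication via \<open>j\<close>: below, either \<open>polys n\<close>
  itself or \<open>fracs n\<close>.
\<close>

definition lin_End ::
    "'v::comm_ring_1 set \<Rightarrow> ('k::field mpoly \<Rightarrow> 'v) \<Rightarrow> ('v \<Rightarrow> 'v) ring" where
  "lin_End V j =
     \<lparr>carrier = {D \<in> V \<rightarrow>\<^sub>E V. (\<forall>v\<in>V. \<forall>w\<in>V. D (v + w) = D v + D w) \<and>
        (\<forall>c. \<forall>v\<in>V. D (j (Const c) * v) = j (Const c) * D v)},
      monoid.mult = (\<lambda>D D'. \<lambda>v\<in>V. D (D' v)),
      monoid.one = (\<lambda>v\<in>V. v),
      ring.zero = (\<lambda>v\<in>V. 0),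
      ring.add = (\<lambda>D D'. \<lambda>v\<in>V. D v + D' v)\<rparr>"

text \<open>The subring \<open>K\<langle>X\<^sub>1, \<dots>, X\<^sub>n, \<partial>\<^sub>1, \<dots>, \<partial>\<^sub>n\<rangle>\<close> of \<open>End\<^sub>K(V)\<close>, with \<open>\<partial>\<^sub>i\<close> given by \<open>der\<close>.\<close>

definition weyl_operators ::
    "nat \<Rightarrow> 'v::comm_ring_1 set \<Rightarrow> ('k::field mpoly \<Rightarrow> 'v) \<Rightarrow> (nat \<Rightarrow> 'v \<Rightarrow> 'v) \<Rightarrow> ('v \<Rightarrow> 'v) set" where
  "weyl_operators n V j der = generate_ring (lin_End V j)
     (range (\<lambda>c. \<lambda>v\<in>V. j (Const c) * v) \<union>
      (\<lambda>i. \<lambda>v\<in>V. j (Var i) * v) ` {..<n} \<union>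
      (\<lambda>i. \<lambda>v\<in>V. der i v) ` {..<n})"

text \<open>The grading determined by \<open>deg X\<^sub>i = 1\<close>, \<open>deg \<partial>\<^sub>i = -1\<close> and \<open>deg c = 0\<close> for \<open>c \<in> K\<close>.\<close>

inductive weyl_degree :: "nat \<Rightarrow> int \<Rightarrow> ('k::field mpoly \<Rightarrow> 'k mpoly) \<Rightarrow> bool" for n where
  zero: "weyl_degree n d (\<lambda>p\<in>polys n. 0)"
| const: "weyl_degree n 0 (\<lambda>p\<in>polys n. Const c * p)"
| var: "i < n \<Longrightarrow> weyl_degree n 1 (\<lambda>p\<in>polys n. Var i * p)"
| deriv: "i < n \<Longrightarrow> weyl_degree n (-1) (\<lambda>p\<in>polys n. pderivative i p)"
| add: "weyl_degree n d D \<Longrightarrow> weyl_degree n d D' \<Longrightarrow> weyl_degree n d (\<lambda>p\<in>polys n. D p + D' p)"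
| mult: "weyl_degree n d D \<Longrightarrow> weyl_degree n e D' \<Longrightarrow> weyl_degree n (d + e) (\<lambda>p\<in>polys n. D (D' p))"

definition weyl_algebra :: "nat \<Rightarrow> ('k::field mpoly \<Rightarrow> 'k mpoly) graded_ring" where
  "weyl_algebra n =
     \<lparr>carrier = weyl_operators n (polys n) id pderivative,
      monoid.mult = monoid.mult (lin_End (polys n) id), monoid.one = monoid.one (lin_End (polys n) id),
      ring.zero = ring.zero (lin_End (polys n) id), ring.add = ring.add (lin_End (polys n) id),
      gcomp = (\<lambda>d. {D. weyl_degree n d D})\<rparr>"

definition weyl_const :: "nat \<Rightarrow> 'k::field \<Rightarrow> 'k mpoly \<Rightarrow> 'k mpoly" where
  "weyl_const n c = (\<lambda>p\<in>polys n. Const c * p)"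

text \<open>
  A differential operator on \<open>K[X\<^sub>1, \<dots>, X\<^sub>n]\<close> extends uniquely to \<open>K(X\<^sub>1, \<dots>, X\<^sub>n)\<close>, with \<open>\<partial>\<^sub>i\<close> extended by
  the quotient rule.  This is the action of the Weyl algebra on all localizations.
\<close>

definition weyl_extension ::
    "nat \<Rightarrow> ('k::field mpoly \<Rightarrow> 'k mpoly) \<Rightarrow> 'k mpoly fract \<Rightarrow> 'k mpoly fract" where
  "weyl_extension n D = (THE D'. D' \<in> weyl_operators n (fracs n) to_frac frac_derivative \<and>
     (\<forall>p\<in>polys n. D' (to_frac p) = to_frac (D p)))"


section \<open>Local cohomology\<close>

text \<open>The localization \<open>R\<^sub>f\<close> and its component of degree \<open>l\<close>, for nonzero homogeneous \<open>f\<close>.\<close>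

definition localization :: "nat \<Rightarrow> 'k::field mpoly \<Rightarrow> 'k mpoly fract set" where
  "localization n f = {Fract g (f ^ k) | g k. g \<in> polys n}"

definition localization_comp :: "nat \<Rightarrow> 'k::field mpoly \<Rightarrow> int \<Rightarrow> 'k mpoly fract set" where
  "localization_comp n f l = {Fract g (f ^ k) | g k a b.
     g \<in> polys n \<and> homogeneous a g \<and> homogeneous b (f ^ k) \<and> l = a - b}"

text \<open>
  For \<open>fs = [f\<^sub>0, \<dots>, f\<^bsub>s-1\<^esub>]\<close>, the Cech module \<open>C\<^sup>k\<close> is the direct sum of the localizations of \<open>R\<close> at
  \<open>\<Prod>\<^bsub>t \<in> T\<^esub> f\<^sub>t\<close> over all \<open>T \<subseteq> {0, \<dots>, s - 1}\<close> with \<open>k\<close> elements; cochains are extended by zero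
  to all other \<open>T\<close>.
\<close>

definition cech_module ::
    "nat \<Rightarrow> 'k::field mpoly list \<Rightarrow> nat
      \<Rightarrow> ('k mpoly \<Rightarrow> 'k mpoly, nat set \<Rightarrow> 'k mpoly fract) graded_module" where
  "cech_module n fs k =
     \<lparr>carrier = {c. \<forall>T. if T \<subseteq> {..<length fs} \<and> card T = k
        then c T \<in> localization n (\<Prod>t\<in>T. fs ! t) else c T = 0},
      monoid.mult = undefined, monoid.one = undefined,
      ring.zero = (\<lambda>T. 0),
      ring.add = (\<lambda>c c' T. c T + c' T),
      smult = (\<lambda>D c T. if T \<subseteq> {..<length fs} \<and> card T = k then weyl_extension n D (c T) else 0),
      hcomp = (\<lambda>l. {c. \<forall>T. if T \<subseteq> {..<length fs} \<and> card T = k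
        then c T \<in> localization_comp n (\<Prod>t\<in>T. fs ! t) l else c T = 0})\<rparr>"

definition cech_diff ::
    "'k::field mpoly list \<Rightarrow> nat \<Rightarrow> (nat set \<Rightarrow> 'k mpoly fract) \<Rightarrow> nat set \<Rightarrow> 'k mpoly fract" where
  "cech_diff fs k c = (\<lambda>T. if T \<subseteq> {..<length fs} \<and> card T = Suc k
     then \<Sum>t\<in>T. (-1) ^ card {u \<in> T. u < t} * c (T - {t}) else 0)"

text \<open>
  \<open>H\<^sup>i\<^sub>I(R)\<close> as a graded left module over the Weyl algebra, computed from homogeneous generators \<open>fs\<close>
  of \<open>I\<close>.
\<close>

definition local_cohomology ::
    "nat \<Rightarrow> 'k::field mpoly list \<Rightarrow> nat
      \<Rightarrow> ('k mpoly \<Rightarrow> 'k mpoly, (nat set \<Rightarrow> 'k mpoly fract) set) graded_module" where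
  "local_cohomology n fs i = cohomology (cech_module n fs) (cech_diff fs) i"

end

theory Submission
  imports Defs
begin

text \<open>
  The Euler operator \<open>\<eta> = \<Sum> X\<^sub>i \<partial>\<^sub>i\<close> measures degrees: \<open>[\<eta>, a] = d a\<close> for every \<open>a\<close> of degree \<open>d\<close> in the Weyl
  algebra (\<open>weyl_euler_graded_ring\<close>).  Hence on every graded module \<open>P\<close> the map \<open>\<theta>\<^sub>P\<close> that sends
  \<open>x \<in> P\<^sub>k\<close> to \<open>(\<eta> - k) x\<close> is linear of degree 0 (\<open>euler_defect\<close>).  A linear map \<open>\<phi> : M \<rightarrow> Q\<close> of degree \<open>l\<close>
  shifts the number \<open>k\<close> by \<open>l\<close>, which gives the commutation rule
  \<open>\<phi> \<circ> \<theta>\<^sub>M = \<theta>\<^sub>Q \<circ> \<phi> + l \<phi>\<close> (\<open>euler_defect_natural\<close>); for \<open>l = 0\<close> it says that \<open>\<theta>\<close> is natural.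
  
  Local cohomology modules are Eulerian, which means that \<open>\<theta>\<close> vanishes on them
  (\<open>eulerian_local_cohomology\<close>).  By Euler's formula a quotient \<open>g / f\<^sup>k\<close> of homogeneous polynomials is an
  eigenvector of \<open>\<eta>\<close> whose eigenvalue is its degree, so \<open>\<theta>\<close> already vanishes on the Cech complex.  Two
  points need care.  The action on localizations is defined through the unique extension of an
  operator from polynomials to fractions, so that existence and uniqueness of the extension are shown
  first (\<open>weyl_operator_extends\<close>, \<open>weyl_operators_fracs_eqI\<close>).  Moreover, a cocycle is a sum of
  homogeneous cocycles, because eigenvectors for different eigenvalues are independent.
  
  Now let \<open>E\<close> be a graded injective resolution of \<open>N\<close>.  The maps \<open>\<theta>\<close> on the \<open>E\<^sup>i\<close> form an endomorphism of
  the complex \<open>E\<close> over \<open>\<theta>\<^sub>N = 0\<close>, so they are null-homotopic: \<open>\<theta> = \<delta> h + h \<delta>\<close> with \<open>h\<close> of degree 0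
  (\<open>euler_defect_null_homotopic\<close>).  If \<open>\<phi> : M \<rightarrow> E\<^sup>\<nu>\<close> has degree \<open>l\<close> and \<open>\<delta> \<phi> = 0\<close>, then
  \<open>0 = \<phi> \<circ> \<theta>\<^sub>M = \<theta> \<phi> + l \<phi> = \<delta> h \<phi> + l \<phi>\<close>, so for \<open>l \<noteq> 0\<close> the cocycle \<open>\<phi>\<close> is the coboundary of
  \<open>-(1/l) h \<phi>\<close> and its class vanishes (\<open>star_Ext_concentrated\<close>).
\<close>

section \<open>Homogeneous components\<close>

lemma internal_direct_sum_subgroup:
  assumes "internal_direct_sum G P" shows "additive_subgroup (P k) G"
  using assms unfolding internal_direct_sum_def by blast

definition component :: "('a, 'z) ring_scheme \<Rightarrow> (int \<Rightarrow> 'a set) \<Rightarrow> 'a \<Rightarrow> int \<Rightarrow> 'a" where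
  "component G P x = (THE c. (\<forall>k. c k \<in> P k) \<and> finite {k. c k \<noteq> \<zero>\<^bsub>G\<^esub>} \<and>
        x = finsum G c {k. c k \<noteq> \<zero>\<^bsub>G\<^esub>})"

lemma (in abelian_group) finsum_superset:
  assumes "finite L" "{k. c k \<noteq> \<zero>} \<subseteq> L" "\<And>k. c k \<in> carrier G"
  shows "finsum G c L = finsum G c {k. c k \<noteq> \<zero>}"
  by (rule add.finprod_mono_neutral_cong_right[OF assms(1,2)]) (use assms in auto)

lemma (in abelian_group) idem_zero:
  assumes "x \<in> carrier G" "x \<oplus> x = x" shows "x = \<zero>"
  using assms add.l_cancel_one'[of x x] by simp

text \<open>
  Scalar rings and modules are graded in the same sense, so homogeneous components are treated once
  for an abelian group with an internal direct sum.
\<close>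

locale direct_sum_decomposition = abelian_group G for G :: "('a, 'z) ring_scheme" (structure) +
  fixes P :: "int \<Rightarrow> 'a set"
  assumes direct_sum: "internal_direct_sum G P"
begin

sublocale comp_subgroup: additive_subgroup "P k" G for k
  using internal_direct_sum_subgroup[OF direct_sum] .

lemma in_carrier: "x \<in> P k \<Longrightarrow> x \<in> carrier G"
  using comp_subgroup.a_subset by blast

lemma component_props:
  assumes "x \<in> carrier G"
  shows "component G P x k \<in> P k" "finite {k. component G P x k \<noteq> \<zero>}"
    "finsum G (component G P x) {k. component G P x k \<noteq> \<zero>} = x"
proof -
  have "\<exists>!c. (\<forall>k. c k \<in> P k) \<and> finite {k. c k \<noteq> \<zero>} \<and> x = finsum G c {k. c k \<noteq> \<zero>}"
    using direct_sum assms unfolding internal_direct_sum_def by blast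
  from theI'[OF this] show "component G P x k \<in> P k" "finite {k. component G P x k \<noteq> \<zero>}"
    "finsum G (component G P x) {k. component G P x k \<noteq> \<zero>} = x"
    unfolding component_def by auto
qed

text \<open>
  Decompositions in practice come as sums over a convenient finite set of degrees, not over the exact
  support; hence the set \<open>L\<close>.
\<close>

lemma component_eqI:
  assumes "finite L" "\<And>k. c k \<in> P k" "\<And>k. k \<notin> L \<Longrightarrow> c k = \<zero>" "x = finsum G c L"
  shows "component G P x = c"
proof -
  have c: "c k \<in> carrier G" for k using assms(2) in_carrier by blast
  have sub: "{k. c k \<noteq> \<zero>} \<subseteq> L" using assms(3) by blast
  have x: "x \<in> carrier G" using c assms(4) by auto
  let ?dec = "\<lambda>c. (\<forall>k. c k \<in> P k) \<and> finite {k. c k \<noteq> \<zero>} \<and> x = finsum G c {k. c k \<noteq> \<zero>}"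
  have "\<exists>!c. ?dec c" using direct_sum x unfolding internal_direct_sum_def by blast
  moreover have "?dec c"
    using assms finsum_superset[OF assms(1) sub c] finite_subset[OF sub assms(1)] by auto
  ultimately show ?thesis unfolding component_def by (rule the1_equality[of ?dec])
qed

lemma component_homogeneous:
  assumes "x \<in> P k"
  shows "component G P x = (\<lambda>j. if j = k then x else \<zero>)"
proof (rule component_eqI[where L = "{k}"])
  show "(if j = k then x else \<zero>) \<in> P j" for j using assms by auto
  show "x = (\<Oplus>j\<in>{k}. if j = k then x else \<zero>)" using in_carrier[OF assms] by simp
qed auto

lemma component_add:
  assumes "x \<in> carrier G" "y \<in> carrier G"
  shows "component G P (x \<oplus> y) = (\<lambda>k. component G P x k \<oplus> component G P y k)"
proof (rule component_eqI)
  let ?L = "{k. component G P x k \<noteq> \<zero>} \<union> {k. component G P y k \<noteq> \<zero>}"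
  note px = component_props[OF assms(1)] and py = component_props[OF assms(2)]
  have cx: "component G P x k \<in> carrier G" and cy: "component G P y k \<in> carrier G" for k
    using px py in_carrier by blast+
  show fin: "finite ?L" using px py by blast
  show "component G P x k \<oplus> component G P y k \<in> P k" for k using px py by auto
  show "component G P x k \<oplus> component G P y k = \<zero>" if "k \<notin> ?L" for k using that by auto
  have "x = finsum G (component G P x) ?L"
    using finsum_superset[OF fin _ cx] px(3) by auto
  moreover have "y = finsum G (component G P y) ?L"
    using finsum_superset[OF fin _ cy] py(3) by auto
  ultimately show "x \<oplus> y = (\<Oplus>k\<in>?L. component G P x k \<oplus> component G P y k)"
    using finsum_addf[of "component G P x" ?L "component G P y"] cx cy by auto
qed

lemma homogeneous_induct [consumes 1, case_names zero homogeneous add]: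
  assumes x: "x \<in> carrier G" and zero: "Q \<zero>" and hom: "\<And>k y. y \<in> P k \<Longrightarrow> Q y"
    and add: "\<And>y z. \<lbrakk>y \<in> carrier G; z \<in> carrier G; Q y; Q z\<rbrakk> \<Longrightarrow> Q (y \<oplus> z)"
  shows "Q x"
proof -
  have "finite L \<Longrightarrow> Q (finsum G (component G P x) L)" for L
  proof (induction L rule: finite_induct)
    case (insert k L)
    have c: "component G P x j \<in> carrier G" for j
      using component_props(1)[OF x] in_carrier by blast
    have "Q (component G P x k \<oplus> finsum G (component G P x) L)"
      using insert.IH c by (intro add) (auto intro: hom[OF component_props(1)[OF x]])
    then show ?case using insert c by auto
  qed (use zero in simp)
  from this[OF component_props(2)[OF x]] show ?thesis unfolding component_props(3)[OF x] .
qed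

end

lemma (in Z_graded_ring) gcomp_decomposition: "direct_sum_decomposition S (gcomp S)"
  by unfold_locales (rule direct_sum)

lemma (in graded_left_module) hcomp_decomposition: "direct_sum_decomposition M (hcomp M)"
  by unfold_locales (rule hcomp_direct_sum)

section \<open>Linear maps between graded modules\<close>

lemma left_homD:
  assumes "\<phi> \<in> left_hom S M N"
  shows "\<phi> \<in> carrier M \<rightarrow>\<^sub>E carrier N"
    "\<And>x. x \<in> carrier M \<Longrightarrow> \<phi> x \<in> carrier N"
    "\<And>x y. \<lbrakk>x \<in> carrier M; y \<in> carrier M\<rbrakk> \<Longrightarrow> \<phi> (x \<oplus>\<^bsub>M\<^esub> y) = \<phi> x \<oplus>\<^bsub>N\<^esub> \<phi> y"
    "\<And>a x. \<lbrakk>a \<in> carrier S; x \<in> carrier M\<rbrakk> \<Longrightarrow> \<phi> (a \<odot>\<^bsub>M\<^esub> x) = a \<odot>\<^bsub>N\<^esub> \<phi> x"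
  using assms unfolding left_hom_def by auto

lemma graded_homD:
  assumes "\<phi> \<in> graded_hom S M N l"
  shows "\<phi> \<in> carrier M \<rightarrow>\<^sub>E carrier N"
    "\<And>x. x \<in> carrier M \<Longrightarrow> \<phi> x \<in> carrier N"
    "\<And>x y. \<lbrakk>x \<in> carrier M; y \<in> carrier M\<rbrakk> \<Longrightarrow> \<phi> (x \<oplus>\<^bsub>M\<^esub> y) = \<phi> x \<oplus>\<^bsub>N\<^esub> \<phi> y"
    "\<And>a x. \<lbrakk>a \<in> carrier S; x \<in> carrier M\<rbrakk> \<Longrightarrow> \<phi> (a \<odot>\<^bsub>M\<^esub> x) = a \<odot>\<^bsub>N\<^esub> \<phi> x"
    "\<And>x k. x \<in> hcomp M k \<Longrightarrow> \<phi> x \<in> hcomp N (k + l)"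
    "\<phi> \<in> left_hom S M N"
proof -
  have 1: "\<phi> \<in> left_hom S M N" and 2: "\<And>k. \<phi> ` hcomp M k \<subseteq> hcomp N (k + l)"
    using assms unfolding graded_hom_def by auto
  show "\<phi> \<in> left_hom S M N" by (rule 1)
  show "\<And>x k. x \<in> hcomp M k \<Longrightarrow> \<phi> x \<in> hcomp N (k + l)" using 2 by auto
qed (use left_homD[of \<phi> S M N] assms in \<open>auto simp: graded_hom_def\<close>)

lemma graded_homI:
  assumes "\<phi> \<in> carrier M \<rightarrow>\<^sub>E carrier N"
    "\<And>x y. \<lbrakk>x \<in> carrier M; y \<in> carrier M\<rbrakk> \<Longrightarrow> \<phi> (x \<oplus>\<^bsub>M\<^esub> y) = \<phi> x \<oplus>\<^bsub>N\<^esub> \<phi> y"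
    "\<And>a x. \<lbrakk>a \<in> carrier S; x \<in> carrier M\<rbrakk> \<Longrightarrow> \<phi> (a \<odot>\<^bsub>M\<^esub> x) = a \<odot>\<^bsub>N\<^esub> \<phi> x"
    "\<And>x k. x \<in> hcomp M k \<Longrightarrow> \<phi> x \<in> hcomp N (k + l)"
  shows "\<phi> \<in> graded_hom S M N l"
  using assms unfolding graded_hom_def left_hom_def by auto

context graded_left_module begin

sublocale MD: direct_sum_decomposition M "hcomp M" by (rule hcomp_decomposition)

lemma ring_S: "ring S" by unfold_locales

lemmas S_simprules = ring.ring_simprules[OF ring_S]

lemma smult_zero_right:
  assumes "a \<in> carrier S" shows "a \<odot>\<^bsub>M\<^esub> \<zero>\<^bsub>M\<^esub> = \<zero>\<^bsub>M\<^esub>"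
proof (rule M.idem_zero)
  show "a \<odot>\<^bsub>M\<^esub> \<zero>\<^bsub>M\<^esub> \<in> carrier M" using assms smult_closed by simp
  show "a \<odot>\<^bsub>M\<^esub> \<zero>\<^bsub>M\<^esub> \<oplus>\<^bsub>M\<^esub> a \<odot>\<^bsub>M\<^esub> \<zero>\<^bsub>M\<^esub> = a \<odot>\<^bsub>M\<^esub> \<zero>\<^bsub>M\<^esub>"
    using smult_r_distr[OF assms M.zero_closed M.zero_closed] by simp
qed

lemma smult_zero_left:
  assumes "x \<in> carrier M" shows "\<zero>\<^bsub>S\<^esub> \<odot>\<^bsub>M\<^esub> x = \<zero>\<^bsub>M\<^esub>"
proof (rule M.idem_zero)
  show "\<zero>\<^bsub>S\<^esub> \<odot>\<^bsub>M\<^esub> x \<in> carrier M" using assms smult_closed by simp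
  show "\<zero>\<^bsub>S\<^esub> \<odot>\<^bsub>M\<^esub> x \<oplus>\<^bsub>M\<^esub> \<zero>\<^bsub>S\<^esub> \<odot>\<^bsub>M\<^esub> x = \<zero>\<^bsub>S\<^esub> \<odot>\<^bsub>M\<^esub> x"
    using smult_l_distr[OF S_simprules(2) S_simprules(2) assms] by simp
qed

lemma smult_minus_left:
  assumes "a \<in> carrier S" "x \<in> carrier M" shows "(\<ominus>\<^bsub>S\<^esub> a) \<odot>\<^bsub>M\<^esub> x = \<ominus>\<^bsub>M\<^esub> (a \<odot>\<^bsub>M\<^esub> x)"
proof (rule M.minus_equality[symmetric])
  show "(\<ominus>\<^bsub>S\<^esub> a) \<odot>\<^bsub>M\<^esub> x \<oplus>\<^bsub>M\<^esub> a \<odot>\<^bsub>M\<^esub> x = \<zero>\<^bsub>M\<^esub>"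
    using smult_l_distr[of "\<ominus>\<^bsub>S\<^esub> a" a x] assms smult_zero_left S_simprules(9) by simp
qed (use assms smult_closed in auto)

lemma smult_minus_right:
  assumes "a \<in> carrier S" "x \<in> carrier M" shows "a \<odot>\<^bsub>M\<^esub> (\<ominus>\<^bsub>M\<^esub> x) = \<ominus>\<^bsub>M\<^esub> (a \<odot>\<^bsub>M\<^esub> x)"
proof (rule M.minus_equality[symmetric])
  show "a \<odot>\<^bsub>M\<^esub> (\<ominus>\<^bsub>M\<^esub> x) \<oplus>\<^bsub>M\<^esub> a \<odot>\<^bsub>M\<^esub> x = \<zero>\<^bsub>M\<^esub>"
    using smult_r_distr[of a "\<ominus>\<^bsub>M\<^esub> x" x] assms smult_zero_right M.l_neg by simp
qed (use assms smult_closed in auto)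

end

lemma left_hom_zero:
  assumes "abelian_group M" "abelian_group N" "\<phi> \<in> left_hom S M N"
  shows "\<phi> \<zero>\<^bsub>M\<^esub> = \<zero>\<^bsub>N\<^esub>"
proof -
  interpret M: abelian_group M by fact
  interpret N: abelian_group N by fact
  show ?thesis
    using left_homD(2)[OF assms(3) M.zero_closed]
      left_homD(3)[OF assms(3) M.zero_closed M.zero_closed] by (auto intro: N.idem_zero)
qed

lemma left_hom_uminus:
  assumes "abelian_group M" "abelian_group N" "\<phi> \<in> left_hom S M N" "x \<in> carrier M"
  shows "\<phi> (\<ominus>\<^bsub>M\<^esub> x) = \<ominus>\<^bsub>N\<^esub> \<phi> x"
proof -
  interpret M: abelian_group M by fact
  interpret N: abelian_group N by fact
  have "\<phi> (\<ominus>\<^bsub>M\<^esub> x) \<oplus>\<^bsub>N\<^esub> \<phi> x = \<zero>\<^bsub>N\<^esub>"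
    using left_homD(3)[OF assms(3), of "\<ominus>\<^bsub>M\<^esub> x" x] left_hom_zero[OF assms(1-3)] assms(4)
    by (simp add: M.l_neg)
  then show ?thesis
    using left_homD(2)[OF assms(3)] assms(4) by (metis M.a_inv_closed N.minus_equality)
qed

lemma left_hom_minus:
  assumes "abelian_group M" "abelian_group N" "\<phi> \<in> left_hom S M N" "x \<in> carrier M" "y \<in> carrier M"
  shows "\<phi> (x \<ominus>\<^bsub>M\<^esub> y) = \<phi> x \<ominus>\<^bsub>N\<^esub> \<phi> y"
proof -
  interpret M: abelian_group M by fact
  show ?thesis
    using left_homD(3)[OF assms(3), of x "\<ominus>\<^bsub>M\<^esub> y"] left_hom_uminus[OF assms(1-3)] assms(4,5)
    by (simp add: a_minus_def)
qed

lemma left_hom_finsum: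
  assumes "abelian_group M" "abelian_group N" "\<phi> \<in> left_hom S M N"
    "finite L" "\<And>k. c k \<in> carrier M"
  shows "\<phi> (finsum M c L) = finsum N (\<lambda>k. \<phi> (c k)) L"
proof -
  interpret M: abelian_group M by fact
  interpret N: abelian_group N by fact
  show ?thesis using assms(4)
  proof (induction L rule: finite_induct)
    case empty
    show ?case using left_hom_zero[OF assms(1-3)] by simp
  next
    case (insert k L)
    then show ?case
      using left_homD(2,3)[OF assms(3)] assms(5) by (simp add: Pi_def)
  qed
qed

text \<open>
  Every scalar and every vector is a finite sum of homogeneous ones, so linearity only has to be
  tested on homogeneous elements.  This builds linear maps whose formula depends on the degree of the
  argument.
\<close>

lemma homogeneous_family_hom:
  assumes "graded_left_module S P" "graded_left_module S Q"
    and hom: "\<And>k x. x \<in> hcomp P k \<Longrightarrow> f k x \<in> hcomp Q k"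
    and add: "\<And>k x y. \<lbrakk>x \<in> hcomp P k; y \<in> hcomp P k\<rbrakk> \<Longrightarrow> f k (x \<oplus>\<^bsub>P\<^esub> y) = f k x \<oplus>\<^bsub>Q\<^esub> f k y"
    and smult: "\<And>a d k x. \<lbrakk>a \<in> gcomp S d; x \<in> hcomp P k\<rbrakk> \<Longrightarrow> f (d + k) (a \<odot>\<^bsub>P\<^esub> x) = a \<odot>\<^bsub>Q\<^esub> f k x"
  shows "\<exists>\<phi>\<in>graded_hom S P Q 0. \<forall>k. \<forall>x\<in>hcomp P k. \<phi> x = f k x"
proof -
  interpret P: graded_left_module S P by fact
  interpret Q: graded_left_module S Q by fact
  interpret SD: direct_sum_decomposition S "gcomp S" by (rule P.gcomp_decomposition)
  let ?c = "component P (hcomp P)"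
  let ?supp = "\<lambda>x. {k. ?c x k \<noteq> \<zero>\<^bsub>P\<^esub>}"
  define \<phi> where "\<phi> = (\<lambda>x\<in>carrier P. finsum Q (\<lambda>k. f k (?c x k)) (?supp x))"
  have f0: "f k \<zero>\<^bsub>P\<^esub> = \<zero>\<^bsub>Q\<^esub>" for k
    using add[of "\<zero>\<^bsub>P\<^esub>" k "\<zero>\<^bsub>P\<^esub>"] hom[of "\<zero>\<^bsub>P\<^esub>" k] Q.MD.in_carrier
    by (intro Q.M.idem_zero) auto
  have fc: "f k (?c x k) \<in> carrier Q" if "x \<in> carrier P" for x k
    using hom P.MD.component_props(1)[OF that] Q.MD.in_carrier by blast
  have over: "\<phi> x = finsum Q (\<lambda>k. f k (?c x k)) L"
    if "x \<in> carrier P" "finite L" "?supp x \<subseteq> L" for x L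
  proof -
    have "finsum Q (\<lambda>k. f k (?c x k)) (?supp x) = finsum Q (\<lambda>k. f k (?c x k)) L"
      by (rule Q.M.add.finprod_mono_neutral_cong_left) (use that f0 fc in auto)
    then show ?thesis using that by (simp add: \<phi>_def)
  qed
  have closed: "\<phi> x \<in> carrier Q" if "x \<in> carrier P" for x
    using that fc by (simp add: \<phi>_def)
  have hom_eq: "\<phi> x = f k x" if x: "x \<in> hcomp P k" for k x
  proof -
    have "\<phi> x = finsum Q (\<lambda>j. f j (?c x j)) {k}"
      by (rule over) (use x P.MD.in_carrier P.MD.component_homogeneous[OF x] in auto)
    then show ?thesis
      using P.MD.component_homogeneous[OF x] fc[OF P.MD.in_carrier[OF x], of k] by simp
  qed
  have \<phi>_add: "\<phi> (x \<oplus>\<^bsub>P\<^esub> y) = \<phi> x \<oplus>\<^bsub>Q\<^esub> \<phi> y" if x: "x \<in> carrier P" and y: "y \<in> carrier P" for x y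
  proof -
    let ?L = "?supp x \<union> ?supp y"
    have fin: "finite ?L" using P.MD.component_props(2) x y by blast
    have c: "?c (x \<oplus>\<^bsub>P\<^esub> y) = (\<lambda>k. ?c x k \<oplus>\<^bsub>P\<^esub> ?c y k)" by (rule P.MD.component_add[OF x y])
    have "\<phi> (x \<oplus>\<^bsub>P\<^esub> y) = finsum Q (\<lambda>k. f k (?c (x \<oplus>\<^bsub>P\<^esub> y) k)) ?L"
      by (rule over) (use x y fin c in auto)
    also have "\<dots> = finsum Q (\<lambda>k. f k (?c x k) \<oplus>\<^bsub>Q\<^esub> f k (?c y k)) ?L"
      using add P.MD.component_props(1)[OF x] P.MD.component_props(1)[OF y] unfolding c by simp
    also have "\<dots> = finsum Q (\<lambda>k. f k (?c x k)) ?L \<oplus>\<^bsub>Q\<^esub> finsum Q (\<lambda>k. f k (?c y k)) ?L"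
      by (rule Q.M.finsum_addf) (use fc x y in auto)
    also have "\<dots> = \<phi> x \<oplus>\<^bsub>Q\<^esub> \<phi> y" using over[OF x fin] over[OF y fin] by auto
    finally show ?thesis .
  qed
  have \<phi>0: "\<phi> \<zero>\<^bsub>P\<^esub> = \<zero>\<^bsub>Q\<^esub>"
    using \<phi>_add[of "\<zero>\<^bsub>P\<^esub>" "\<zero>\<^bsub>P\<^esub>"] closed by (intro Q.M.idem_zero) auto
  have smult_hom: "\<phi> (a \<odot>\<^bsub>P\<^esub> x) = a \<odot>\<^bsub>Q\<^esub> \<phi> x" if a: "a \<in> gcomp S d" and x: "x \<in> carrier P" for a d x
    using x
  proof (induction x rule: P.MD.homogeneous_induct)
    case zero
    then show ?case
      using \<phi>0 P.smult_zero_right Q.smult_zero_right SD.in_carrier[OF a] by simp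
  next
    case (homogeneous k y)
    then show ?case
      using hom_eq[OF P.hcomp_smult[OF a homogeneous]] hom_eq[OF homogeneous] smult[OF a homogeneous] by metis
  next
    case (add y z)
    then show ?case
      using P.smult_r_distr Q.smult_r_distr SD.in_carrier[OF a] \<phi>_add closed P.smult_closed by simp
  qed
  have \<phi>_smult: "\<phi> (a \<odot>\<^bsub>P\<^esub> x) = a \<odot>\<^bsub>Q\<^esub> \<phi> x" if a: "a \<in> carrier S" and x: "x \<in> carrier P" for a x
    using a
  proof (induction a rule: SD.homogeneous_induct)
    case zero
    then show ?case using \<phi>0 P.smult_zero_left Q.smult_zero_left closed x by simp
  next
    case (homogeneous d b)
    then show ?case using smult_hom x by blast
  next
    case (add b c)
    then show ?case
      using P.smult_l_distr Q.smult_l_distr \<phi>_add closed P.smult_closed x by simp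
  qed
  have "\<phi> \<in> carrier P \<rightarrow>\<^sub>E carrier Q" using closed unfolding \<phi>_def by auto
  moreover have "\<phi> x \<in> hcomp Q (k + 0)" if "x \<in> hcomp P k" for x k
    using hom_eq hom that by simp
  ultimately have "\<phi> \<in> graded_hom S P Q 0" using \<phi>_add \<phi>_smult by (intro graded_homI) auto
  then show ?thesis using hom_eq by blast
qed

text \<open>
  The image is graded by the images of the components of \<open>P\<close>.  With this choice decompositions exist
  because they exist in \<open>P\<close>, and are unique because they are unique in \<open>Q\<close>.
\<close>

definition image_module :: "('p \<Rightarrow> 'm) \<Rightarrow> ('s, 'p) graded_module \<Rightarrow> ('s, 'm) graded_module \<Rightarrow> ('s, 'm) graded_module" where
  "image_module \<delta> P Q = Q\<lparr>carrier := \<delta> ` carrier P, hcomp := (\<lambda>k. \<delta> ` hcomp P k)\<rparr>"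

lemma image_module_simps [simp]:
  "carrier (image_module \<delta> P Q) = \<delta> ` carrier P" "hcomp (image_module \<delta> P Q) k = \<delta> ` hcomp P k"
  "x \<oplus>\<^bsub>image_module \<delta> P Q\<^esub> y = x \<oplus>\<^bsub>Q\<^esub> y" "\<zero>\<^bsub>image_module \<delta> P Q\<^esub> = \<zero>\<^bsub>Q\<^esub>"
  "a \<odot>\<^bsub>image_module \<delta> P Q\<^esub> x = a \<odot>\<^bsub>Q\<^esub> x"
  by (simp_all add: image_module_def)

lemma graded_left_module_image:
  assumes "graded_left_module S P" "graded_left_module S Q" "\<delta> \<in> graded_hom S P Q 0"
  shows "graded_left_module S (image_module \<delta> P Q)"
proof -
  interpret P: graded_left_module S P by fact
  interpret Q: graded_left_module S Q by fact
  interpret SD: direct_sum_decomposition S "gcomp S" by (rule P.gcomp_decomposition)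
  let ?A = "image_module \<delta> P Q"
  note \<delta> = graded_homD[OF assms(3)]
  note \<delta>0 = left_hom_zero[OF P.M.abelian_group_axioms Q.M.abelian_group_axioms \<delta>(6)]
  have ag: "abelian_group ?A"
  proof (rule abelian_groupI)
    fix y assume "y \<in> carrier ?A"
    then obtain x where x: "x \<in> carrier P" "y = \<delta> x" by auto
    then have "\<delta> (\<ominus>\<^bsub>P\<^esub> x) \<oplus>\<^bsub>Q\<^esub> y = \<zero>\<^bsub>Q\<^esub>"
      using \<delta>(3)[of "\<ominus>\<^bsub>P\<^esub> x" x] \<delta>0 by (simp add: P.M.l_neg)
    then show "\<exists>z\<in>carrier ?A. z \<oplus>\<^bsub>?A\<^esub> y = \<zero>\<^bsub>?A\<^esub>" using x by auto
  qed (use \<delta>(2) \<delta>(3)[symmetric] \<delta>0[symmetric] in \<open>auto intro: Q.M.a_comm Q.M.a_assoc\<close>)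
  then interpret A: abelian_group ?A .
  have fs: "finsum ?A c L = finsum Q c L" if "finite L" "\<And>k. c k \<in> carrier ?A" for c L
    using that(1)
  proof (induction L rule: finite_induct)
    case (insert k L)
    have "c j \<in> carrier Q" for j using that(2)[of j] \<delta>(2) by auto
    then show ?case using insert that(2) by (simp add: Pi_def)
  qed auto
  have sub: "additive_subgroup (hcomp ?A k) ?A" for k
  proof (rule additive_subgroupI, rule subgroup.intro)
    show "hcomp ?A k \<subseteq> carrier (add_monoid ?A)" using P.MD.in_carrier by auto
    fix x y assume "x \<in> hcomp ?A k" "y \<in> hcomp ?A k"
    then obtain u v where "u \<in> hcomp P k" "v \<in> hcomp P k" "x = \<delta> u" "y = \<delta> v" by auto
    then have "x \<oplus>\<^bsub>Q\<^esub> y = \<delta> (u \<oplus>\<^bsub>P\<^esub> v)" "u \<oplus>\<^bsub>P\<^esub> v \<in> hcomp P k"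
      using \<delta>(3) P.MD.in_carrier by auto
    then show "x \<otimes>\<^bsub>add_monoid ?A\<^esub> y \<in> hcomp ?A k" by auto
  next
    show "\<one>\<^bsub>add_monoid ?A\<^esub> \<in> hcomp ?A k" using \<delta>0[symmetric] by auto
  next
    fix x assume "x \<in> hcomp ?A k"
    then obtain u where u: "u \<in> hcomp P k" "x = \<delta> u" by auto
    have uc: "u \<in> carrier P" using P.MD.in_carrier u by blast
    have "\<delta> (\<ominus>\<^bsub>P\<^esub> u) \<oplus>\<^bsub>Q\<^esub> x = \<zero>\<^bsub>Q\<^esub>"
      using \<delta>(3)[of "\<ominus>\<^bsub>P\<^esub> u" u] \<delta>0 u uc by (simp add: P.M.l_neg)
    then have "\<ominus>\<^bsub>?A\<^esub> x = \<delta> (\<ominus>\<^bsub>P\<^esub> u)"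
      by (intro A.minus_equality) (use u uc in auto)
    moreover have "\<delta> (\<ominus>\<^bsub>P\<^esub> u) \<in> hcomp ?A k"
      unfolding image_module_simps using u(1) by (intro imageI P.MD.comp_subgroup.a_inv_closed)
    ultimately show "inv\<^bsub>add_monoid ?A\<^esub> x \<in> hcomp ?A k" unfolding a_inv_def by (simp only:)
  qed
  have ids: "internal_direct_sum ?A (hcomp ?A)"
    unfolding internal_direct_sum_def
  proof (intro conjI allI ballI sub)
    fix y assume "y \<in> carrier ?A"
    then obtain x where x: "x \<in> carrier P" "y = \<delta> x" by auto
    let ?c = "component P (hcomp P) x"
    note cx = P.MD.component_props[OF x(1)]
    have cc: "?c k \<in> carrier P" for k using cx P.MD.in_carrier by blast
    have y: "y = finsum Q (\<lambda>k. \<delta> (?c k)) {k. ?c k \<noteq> \<zero>\<^bsub>P\<^esub>}"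
      using left_hom_finsum[OF P.M.abelian_group_axioms Q.M.abelian_group_axioms \<delta>(6) cx(2), of ?c] cc cx(3) x(2) by simp
    show "\<exists>!c. (\<forall>k. c k \<in> hcomp ?A k) \<and> finite {k. c k \<noteq> \<zero>\<^bsub>?A\<^esub>} \<and>
        y = finsum ?A c {k. c k \<noteq> \<zero>\<^bsub>?A\<^esub>}"
    proof (rule ex1I[of _ "\<lambda>k. \<delta> (?c k)"], intro conjI allI)
      show "\<delta> (?c k) \<in> hcomp ?A k" for k using cx(1) by auto
      have s: "{k. \<delta> (?c k) \<noteq> \<zero>\<^bsub>?A\<^esub>} \<subseteq> {k. ?c k \<noteq> \<zero>\<^bsub>P\<^esub>}" using \<delta>0 by auto
      show fin: "finite {k. \<delta> (?c k) \<noteq> \<zero>\<^bsub>?A\<^esub>}" using finite_subset[OF s cx(2)] .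
      show "y = finsum ?A (\<lambda>k. \<delta> (?c k)) {k. \<delta> (?c k) \<noteq> \<zero>\<^bsub>?A\<^esub>}"
        using fs[OF fin, of "\<lambda>k. \<delta> (?c k)"] cc Q.M.finsum_superset[OF cx(2), of "\<lambda>k. \<delta> (?c k)"] s y \<delta>(2) by auto
    next
      fix c assume c: "(\<forall>k. c k \<in> hcomp ?A k) \<and> finite {k. c k \<noteq> \<zero>\<^bsub>?A\<^esub>} \<and>
        y = finsum ?A c {k. c k \<noteq> \<zero>\<^bsub>?A\<^esub>}"
      have ck: "c k \<in> \<delta> ` hcomp P k" for k using c by simp
      have cA: "c k \<in> carrier ?A" for k
        unfolding image_module_simps using ck[of k] P.MD.in_carrier by blast
      have cQ: "c k \<in> hcomp Q k" for k
        using ck[of k] \<delta>(5)[of _ k] by (auto simp del: image_module_simps)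
      have "component Q (hcomp Q) y = c"
      proof (rule Q.MD.component_eqI)
        show fin: "finite {k. c k \<noteq> \<zero>\<^bsub>?A\<^esub>}" using c by blast
        show "c k = \<zero>\<^bsub>Q\<^esub>" if "k \<notin> {k. c k \<noteq> \<zero>\<^bsub>?A\<^esub>}" for k using that by simp
        show "y = finsum Q c {k. c k \<noteq> \<zero>\<^bsub>?A\<^esub>}"
          using c fs[OF fin cA] by (simp only:)
      qed (rule cQ)
      moreover have "component Q (hcomp Q) y = (\<lambda>k. \<delta> (?c k))"
      proof (rule Q.MD.component_eqI[OF cx(2) _ _ y])
        show "\<delta> (?c k) \<in> hcomp Q k" for k using \<delta>(5)[OF cx(1)] by simp
        show "\<delta> (?c k) = \<zero>\<^bsub>Q\<^esub>" if "k \<notin> {k. ?c k \<noteq> \<zero>\<^bsub>P\<^esub>}" for k using that \<delta>0 by simp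
      qed
      ultimately show "c = (\<lambda>k. \<delta> (?c k))" by simp
    qed
  qed
  have lm: "left_module S ?A"
    by (intro left_module.intro left_module_axioms.intro P.ring_S ag)
      (use \<delta>(3)[symmetric] \<delta>(4)[symmetric] P.smult_closed P.smult_l_distr P.smult_r_distr
        P.smult_assoc1 P.smult_one P.S_simprules(1,5,6) in auto)
  show ?thesis
  proof (intro graded_left_module.intro graded_left_module_axioms.intro lm ids P.Z_graded_ring_axioms)
    fix a d x k assume "a \<in> gcomp S d" "x \<in> hcomp ?A k"
    then show "a \<odot>\<^bsub>?A\<^esub> x \<in> hcomp ?A (d + k)"
      using \<delta>(4)[symmetric] P.MD.in_carrier SD.in_carrier P.hcomp_smult by auto
  qed
qed

text \<open>
  The map that \<open>\<omega>\<close> induces on the image of \<open>\<delta>\<close> is extended to \<open>Q\<close> by injectivity.  The image has its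
  carrier in the type of \<open>Q\<close> and \<open>E\<close>, so it is one of the test modules in the definition of
  \<open>graded_injective\<close>, while the type of \<open>P\<close> is arbitrary.
\<close>

lemma graded_injective_factor:
  fixes P :: "('s, 'p) graded_module" and Q E :: "('s, 'm) graded_module"
  assumes "graded_left_module S P" "graded_left_module S Q" "graded_injective S E"
    and \<delta>: "\<delta> \<in> graded_hom S P Q 0" and \<omega>: "\<omega> \<in> graded_hom S P E 0"
    and ker: "\<And>x. \<lbrakk>x \<in> carrier P; \<delta> x = \<zero>\<^bsub>Q\<^esub>\<rbrakk> \<Longrightarrow> \<omega> x = \<zero>\<^bsub>E\<^esub>"
  shows "\<exists>h\<in>graded_hom S Q E 0. \<forall>x\<in>carrier P. h (\<delta> x) = \<omega> x"
proof -
  have E: "graded_left_module S E" using assms(3) unfolding graded_injective_def by blast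
  interpret P: graded_left_module S P by fact
  interpret Q: graded_left_module S Q by fact
  interpret E: graded_left_module S E by fact
  let ?A = "image_module \<delta> P Q"
  note \<delta>D = graded_homD[OF \<delta>] and \<omega>D = graded_homD[OF \<omega>]
  have well: "\<omega> x = \<omega> y" if "x \<in> carrier P" "y \<in> carrier P" "\<delta> x = \<delta> y" for x y
  proof -
    have "\<delta> (x \<ominus>\<^bsub>P\<^esub> y) = \<zero>\<^bsub>Q\<^esub>"
      using left_hom_minus[OF P.M.abelian_group_axioms Q.M.abelian_group_axioms \<delta>D(6)] that \<delta>D(2)
      by (simp add: Q.M.r_neg a_minus_def)
    then have "\<omega> x \<ominus>\<^bsub>E\<^esub> \<omega> y = \<zero>\<^bsub>E\<^esub>"
      using ker[of "x \<ominus>\<^bsub>P\<^esub> y"] that left_hom_minus[OF P.M.abelian_group_axioms E.M.abelian_group_axioms \<omega>D(6)] by simp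
    then have "\<omega> x \<oplus>\<^bsub>E\<^esub> \<ominus>\<^bsub>E\<^esub> \<omega> y = \<zero>\<^bsub>E\<^esub>" by (simp add: a_minus_def)
    from E.M.minus_equality[OF this] have "\<ominus>\<^bsub>E\<^esub> (\<ominus>\<^bsub>E\<^esub> \<omega> y) = \<omega> x"
      using that(1,2) \<omega>D(2) by blast
    then show ?thesis using E.M.minus_minus[OF \<omega>D(2)[OF that(2)]] by simp
  qed
  define g where "g = (\<lambda>y\<in>carrier ?A. \<omega> (SOME x. x \<in> carrier P \<and> \<delta> x = y))"
  have g: "g (\<delta> x) = \<omega> x" if x: "x \<in> carrier P" for x
  proof -
    define x' where "x' = (SOME x'. x' \<in> carrier P \<and> \<delta> x' = \<delta> x)"
    have "x' \<in> carrier P \<and> \<delta> x' = \<delta> x"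
      unfolding x'_def by (rule someI[of _ x]) (use x in auto)
    then have "\<omega> x' = \<omega> x" using x by (intro well) auto
    moreover have "g (\<delta> x) = \<omega> x'" using x by (simp add: g_def x'_def)
    ultimately show ?thesis by simp
  qed
  have "g \<in> graded_hom S ?A E 0"
  proof (rule graded_homI)
    have "g y \<in> carrier E" if "y \<in> carrier ?A" for y using that g \<omega>D(2) by auto
    moreover have "g y = undefined" if "y \<notin> carrier ?A" for y using that by (simp add: g_def)
    ultimately show "g \<in> carrier ?A \<rightarrow>\<^sub>E carrier E" by (simp add: PiE_iff extensional_def)
    show "g (x \<oplus>\<^bsub>?A\<^esub> y) = g x \<oplus>\<^bsub>E\<^esub> g y" if "x \<in> carrier ?A" "y \<in> carrier ?A" for x y
      using that g \<delta>D(3)[symmetric] \<omega>D(3) by auto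
    show "g (a \<odot>\<^bsub>?A\<^esub> x) = a \<odot>\<^bsub>E\<^esub> g x" if "a \<in> carrier S" "x \<in> carrier ?A" for a x
      using that g \<delta>D(4)[symmetric] \<omega>D(4) P.smult_closed by auto
    show "g x \<in> hcomp E (k + 0)" if "x \<in> hcomp ?A k" for x k
      using that g \<omega>D(5) P.MD.in_carrier by auto
  qed
  moreover have "(\<lambda>x\<in>carrier ?A. x) \<in> graded_hom S ?A Q 0"
  proof (rule graded_homI)
    show "(\<lambda>x\<in>carrier ?A. x) \<in> carrier ?A \<rightarrow>\<^sub>E carrier Q" using \<delta>D(2) by auto
    show "(\<lambda>x\<in>carrier ?A. x) x \<in> hcomp Q (k + 0)" if "x \<in> hcomp ?A k" for x k
      using that \<delta>D(5) P.MD.in_carrier by fastforce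
  qed (use \<delta>D(3)[symmetric] \<delta>D(4)[symmetric] P.smult_closed in auto)
  moreover have "inj_on (\<lambda>x\<in>carrier ?A. x) (carrier ?A)" by (auto simp: inj_on_def)
  ultimately obtain h where h: "h \<in> graded_hom S Q E 0"
    "\<forall>x\<in>carrier ?A. h ((\<lambda>x\<in>carrier ?A. x) x) = g x"
    using assms(3) graded_left_module_image[OF assms(1,2) \<delta>] assms(2)
    unfolding graded_injective_def by blast
  then have "\<forall>x\<in>carrier P. h (\<delta> x) = \<omega> x" using g by simp
  then show ?thesis using h(1) by blast
qed

lemma graded_hom_comp:
  assumes "\<phi> \<in> graded_hom S M Q l" "h \<in> graded_hom S Q Q' m"
    and "\<And>x y. \<lbrakk>x \<in> carrier M; y \<in> carrier M\<rbrakk> \<Longrightarrow> x \<oplus>\<^bsub>M\<^esub> y \<in> carrier M"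
    and "\<And>a x. \<lbrakk>a \<in> carrier S; x \<in> carrier M\<rbrakk> \<Longrightarrow> a \<odot>\<^bsub>M\<^esub> x \<in> carrier M"
    and "\<And>k x. x \<in> hcomp M k \<Longrightarrow> x \<in> carrier M"
  shows "(\<lambda>x\<in>carrier M. h (\<phi> x)) \<in> graded_hom S M Q' (l + m)"
proof (rule graded_homI)
  note \<phi> = graded_homD[OF assms(1)] and h = graded_homD[OF assms(2)]
  show "(\<lambda>x\<in>carrier M. h (\<phi> x)) \<in> carrier M \<rightarrow>\<^sub>E carrier Q'" using \<phi>(2) h(2) by auto
  show "(\<lambda>x\<in>carrier M. h (\<phi> x)) x \<in> hcomp Q' (k + (l + m))" if "x \<in> hcomp M k" for x k
    using that assms(5) h(5)[OF \<phi>(5)[OF that]] by (simp add: add.assoc)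
qed (use assms graded_homD[OF assms(1)] graded_homD[OF assms(2)] in auto)

lemma graded_hom_minus:
  assumes P: "graded_left_module S P" and Q: "graded_left_module S Q"
    and "\<alpha> \<in> graded_hom S P Q l" "\<beta> \<in> graded_hom S P Q l"
  shows "(\<lambda>x\<in>carrier P. \<alpha> x \<ominus>\<^bsub>Q\<^esub> \<beta> x) \<in> graded_hom S P Q l"
proof (rule graded_homI)
  interpret P: graded_left_module S P by fact
  interpret Q: graded_left_module S Q by fact
  note \<alpha> = graded_homD[OF assms(3)] and \<beta> = graded_homD[OF assms(4)]
  show "(\<lambda>x\<in>carrier P. \<alpha> x \<ominus>\<^bsub>Q\<^esub> \<beta> x) \<in> carrier P \<rightarrow>\<^sub>E carrier Q" using \<alpha>(2) \<beta>(2) by auto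
  fix x y assume x: "x \<in> carrier P" and y: "y \<in> carrier P"
  show "(\<lambda>x\<in>carrier P. \<alpha> x \<ominus>\<^bsub>Q\<^esub> \<beta> x) (x \<oplus>\<^bsub>P\<^esub> y) =
    (\<lambda>x\<in>carrier P. \<alpha> x \<ominus>\<^bsub>Q\<^esub> \<beta> x) x \<oplus>\<^bsub>Q\<^esub> (\<lambda>x\<in>carrier P. \<alpha> x \<ominus>\<^bsub>Q\<^esub> \<beta> x) y"
    using x y \<alpha>(2,3) \<beta>(2,3) by (simp add: a_minus_def Q.M.minus_add Q.M.a_ac)
next
  interpret P: graded_left_module S P by fact
  interpret Q: graded_left_module S Q by fact
  note \<alpha> = graded_homD[OF assms(3)] and \<beta> = graded_homD[OF assms(4)]
  fix a x assume a: "a \<in> carrier S" and x: "x \<in> carrier P"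
  show "(\<lambda>x\<in>carrier P. \<alpha> x \<ominus>\<^bsub>Q\<^esub> \<beta> x) (a \<odot>\<^bsub>P\<^esub> x) = a \<odot>\<^bsub>Q\<^esub> (\<lambda>x\<in>carrier P. \<alpha> x \<ominus>\<^bsub>Q\<^esub> \<beta> x) x"
    using a x \<alpha>(2,4) \<beta>(2,4) P.smult_closed Q.smult_minus_right Q.smult_r_distr
    by (simp add: a_minus_def)
next
  interpret P: graded_left_module S P by fact
  interpret Q: graded_left_module S Q by fact
  note \<alpha> = graded_homD[OF assms(3)] and \<beta> = graded_homD[OF assms(4)]
  fix x k assume x: "x \<in> hcomp P k"
  then show "(\<lambda>x\<in>carrier P. \<alpha> x \<ominus>\<^bsub>Q\<^esub> \<beta> x) x \<in> hcomp Q (k + l)"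
    using \<alpha>(5)[OF x] \<beta>(5)[OF x] P.MD.in_carrier[OF x] by (simp add: a_minus_def)
qed

section \<open>Rings with an Euler element\<close>

inductive_set homogeneous_span :: "('s, 'm) graded_module \<Rightarrow> 'm set" for M where
  zero: "\<zero>\<^bsub>M\<^esub> \<in> homogeneous_span M"
| homogeneous: "x \<in> hcomp M k \<Longrightarrow> x \<in> homogeneous_span M"
| add: "\<lbrakk>x \<in> homogeneous_span M; y \<in> homogeneous_span M\<rbrakk> \<Longrightarrow> x \<oplus>\<^bsub>M\<^esub> y \<in> homogeneous_span M"

text \<open>
  The scalar field acts through \<open>\<iota>\<close>, and \<open>\<eta>\<close> is an abstract Euler operator: its commutator with a
  homogeneous element multiplies that element by its degree.
\<close>

locale euler_graded_ring = Z_graded_ring S for S :: "('s, 'z) graded_ring_scheme" (structure) +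
  fixes \<iota> :: "'k::field_char_0 \<Rightarrow> 's" and \<eta> :: 's
  assumes scalar_gcomp: "\<iota> c \<in> gcomp S 0"
    and scalar_add: "\<iota> (c + c') = \<iota> c \<oplus> \<iota> c'"
    and scalar_mult: "\<iota> (c * c') = \<iota> c \<otimes> \<iota> c'"
    and scalar_one: "\<iota> 1 = \<one>"
    and scalar_central: "a \<in> carrier S \<Longrightarrow> \<iota> c \<otimes> a = a \<otimes> \<iota> c"
    and euler_gcomp: "\<eta> \<in> gcomp S 0"
    and euler_commutator: "a \<in> gcomp S d \<Longrightarrow> \<eta> \<otimes> a = a \<otimes> \<eta> \<oplus> \<iota> (of_int d) \<otimes> a"
begin

sublocale SD: direct_sum_decomposition S "gcomp S" by (rule gcomp_decomposition)

definition euler_shift :: "int \<Rightarrow> 's" where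
  "euler_shift k = \<eta> \<oplus> \<iota> (of_int (- k))"

lemma scalar_closed: "\<iota> c \<in> carrier S"
  using SD.in_carrier[OF scalar_gcomp] .

lemma euler_closed: "\<eta> \<in> carrier S"
  using SD.in_carrier[OF euler_gcomp] .

lemma euler_shift_gcomp: "euler_shift k \<in> gcomp S 0"
  unfolding euler_shift_def using euler_gcomp scalar_gcomp by (rule SD.comp_subgroup.a_closed)

lemma euler_shift_closed: "euler_shift k \<in> carrier S"
  using SD.in_carrier[OF euler_shift_gcomp] .

lemma scalar_zero: "\<iota> 0 = \<zero>"
  using scalar_add[of 0 0] scalar_closed[of 0] by (intro idem_zero) auto

lemma euler_shift_add: "euler_shift (k + l) \<oplus> \<iota> (of_int l) = euler_shift k"
proof -
  have "\<iota> (of_int (- (k + l))) \<oplus> \<iota> (of_int l) = \<iota> (of_int (- k))"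
    using scalar_add[of "of_int (- (k + l))" "of_int l"] by simp
  then show ?thesis
    unfolding euler_shift_def using a_assoc euler_closed scalar_closed by simp
qed

text \<open>
  The commutator with \<open>\<eta>\<close> compensates exactly for the change of degree under \<open>a\<close>.  This is the linearity of
  the map \<open>x \<mapsto> (\<eta> - k) x\<close> on components of degree \<open>k\<close>.
\<close>

lemma euler_shift_commute:
  assumes a: "a \<in> gcomp S d"
  shows "euler_shift (d + k) \<otimes> a = a \<otimes> euler_shift k"
proof -
  have ac: "a \<in> carrier S" using SD.in_carrier[OF a] .
  have "euler_shift (d + k) \<otimes> a = (a \<otimes> \<eta> \<oplus> \<iota> (of_int d) \<otimes> a) \<oplus> \<iota> (of_int (- (d + k))) \<otimes> a"
    unfolding euler_shift_def
    using l_distr[OF euler_closed scalar_closed ac] euler_commutator[OF a] by simp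
  also have "\<dots> = a \<otimes> \<eta> \<oplus> (\<iota> (of_int d) \<otimes> a \<oplus> \<iota> (of_int (- (d + k))) \<otimes> a)"
    using a_assoc ac euler_closed scalar_closed by simp
  also have "\<iota> (of_int d) \<otimes> a \<oplus> \<iota> (of_int (- (d + k))) \<otimes> a = \<iota> (of_int (- k)) \<otimes> a"
    using l_distr[OF scalar_closed scalar_closed ac, symmetric]
      scalar_add[of "of_int d" "of_int (- (d + k))"] by simp
  also have "\<iota> (of_int (- k)) \<otimes> a = a \<otimes> \<iota> (of_int (- k))" by (rule scalar_central[OF ac])
  finally show ?thesis
    unfolding euler_shift_def using r_distr[OF euler_closed scalar_closed ac] by simp
qed

text \<open>
  The map \<open>\<theta>\<^sub>Q\<close> that measures how far degrees in \<open>Q\<close> are from being eigenvalues of \<open>\<eta>\<close>.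
\<close>

definition euler_defect :: "('s, 'm) graded_module \<Rightarrow> 'm \<Rightarrow> 'm" where
  "euler_defect Q = (SOME \<theta>. \<theta> \<in> graded_hom S Q Q 0 \<and>
     (\<forall>k. \<forall>x\<in>hcomp Q k. \<theta> x = euler_shift k \<odot>\<^bsub>Q\<^esub> x))"

lemma euler_defect:
  assumes "graded_left_module S Q"
  shows "euler_defect Q \<in> graded_hom S Q Q 0"
    "x \<in> hcomp Q k \<Longrightarrow> euler_defect Q x = euler_shift k \<odot>\<^bsub>Q\<^esub> x"
proof -
  interpret Q: graded_left_module S Q by fact
  have "\<exists>\<theta>\<in>graded_hom S Q Q 0. \<forall>k. \<forall>x\<in>hcomp Q k. \<theta> x = euler_shift k \<odot>\<^bsub>Q\<^esub> x"
  proof (rule homogeneous_family_hom[OF assms assms])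
    show "euler_shift k \<odot>\<^bsub>Q\<^esub> x \<in> hcomp Q k" if "x \<in> hcomp Q k" for k x
      using Q.hcomp_smult[OF euler_shift_gcomp that] by simp
    show "euler_shift k \<odot>\<^bsub>Q\<^esub> (x \<oplus>\<^bsub>Q\<^esub> y) = euler_shift k \<odot>\<^bsub>Q\<^esub> x \<oplus>\<^bsub>Q\<^esub> euler_shift k \<odot>\<^bsub>Q\<^esub> y"
      if "x \<in> hcomp Q k" "y \<in> hcomp Q k" for k x y
      using Q.smult_r_distr[OF euler_shift_closed] Q.MD.in_carrier that by blast
    show "euler_shift (d + k) \<odot>\<^bsub>Q\<^esub> (a \<odot>\<^bsub>Q\<^esub> x) = a \<odot>\<^bsub>Q\<^esub> (euler_shift k \<odot>\<^bsub>Q\<^esub> x)"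
      if "a \<in> gcomp S d" "x \<in> hcomp Q k" for a d k x
      using Q.smult_assoc1[symmetric, OF _ _ Q.MD.in_carrier[OF that(2)]] euler_shift_closed
        SD.in_carrier[OF that(1)] euler_shift_commute[OF that(1)] by simp
  qed
  then have "\<exists>\<theta>. \<theta> \<in> graded_hom S Q Q 0 \<and> (\<forall>k. \<forall>x\<in>hcomp Q k. \<theta> x = euler_shift k \<odot>\<^bsub>Q\<^esub> x)" by blast
  from someI_ex[OF this] show "euler_defect Q \<in> graded_hom S Q Q 0"
    "x \<in> hcomp Q k \<Longrightarrow> euler_defect Q x = euler_shift k \<odot>\<^bsub>Q\<^esub> x"
    unfolding euler_defect_def by blast+
qed

text \<open>
  On a homogeneous element of degree \<open>k\<close> the two sides compare \<open>\<eta> - k\<close> with \<open>\<eta> - (k + l)\<close>, and these differ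
  by \<open>l\<close>.  The map \<open>T\<close> stands for the defect of \<open>M\<close>: it is the actual \<open>euler_defect\<close> when \<open>M\<close> is a graded
  module, and zero when \<open>M\<close> is Eulerian.
\<close>

lemma euler_defect_natural:
  assumes Q: "graded_left_module S Q" and \<phi>: "\<phi> \<in> graded_hom S M Q l"
    and hc: "\<And>k x. x \<in> hcomp M k \<Longrightarrow> x \<in> carrier M"
    and T: "\<And>x. x \<in> carrier M \<Longrightarrow> T x \<in> carrier M"
      "\<And>k x. x \<in> hcomp M k \<Longrightarrow> T x = euler_shift k \<odot>\<^bsub>M\<^esub> x"
      "\<And>x y. \<lbrakk>x \<in> carrier M; y \<in> carrier M\<rbrakk> \<Longrightarrow> T (x \<oplus>\<^bsub>M\<^esub> y) = T x \<oplus>\<^bsub>M\<^esub> T y"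
      "T \<zero>\<^bsub>M\<^esub> = \<zero>\<^bsub>M\<^esub>"
    and M: "\<zero>\<^bsub>M\<^esub> \<in> carrier M" "\<zero>\<^bsub>M\<^esub> \<oplus>\<^bsub>M\<^esub> \<zero>\<^bsub>M\<^esub> = \<zero>\<^bsub>M\<^esub>"
      "\<And>x y. \<lbrakk>x \<in> carrier M; y \<in> carrier M\<rbrakk> \<Longrightarrow> x \<oplus>\<^bsub>M\<^esub> y \<in> carrier M"
    and x: "x \<in> homogeneous_span M"
  shows "\<phi> (T x) = euler_defect Q (\<phi> x) \<oplus>\<^bsub>Q\<^esub> \<iota> (of_int l) \<odot>\<^bsub>Q\<^esub> \<phi> x"
proof -
  interpret Q: graded_left_module S Q by fact
  note \<phi>D = graded_homD[OF \<phi>] and \<theta> = graded_homD[OF euler_defect(1)[OF Q]]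
  have \<phi>0: "\<phi> \<zero>\<^bsub>M\<^esub> = \<zero>\<^bsub>Q\<^esub>"
    using \<phi>D(3)[OF M(1) M(1)] M(1,2) \<phi>D(2) by (intro Q.M.idem_zero) auto
  have \<theta>0: "euler_defect Q \<zero>\<^bsub>Q\<^esub> = \<zero>\<^bsub>Q\<^esub>"
    by (rule left_hom_zero[OF Q.M.abelian_group_axioms Q.M.abelian_group_axioms \<theta>(6)])
  have "x \<in> carrier M \<and> \<phi> (T x) = euler_defect Q (\<phi> x) \<oplus>\<^bsub>Q\<^esub> \<iota> (of_int l) \<odot>\<^bsub>Q\<^esub> \<phi> x"
    using x
  proof induction
    case zero
    then show ?case using \<phi>0 \<theta>0 T(4) M(1) Q.smult_zero_right[OF scalar_closed] by simp
  next
    case (homogeneous x k)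
    have c: "x \<in> carrier M" "\<phi> x \<in> carrier Q" using hc[OF homogeneous] \<phi>D(2) by auto
    have "\<phi> (T x) = euler_shift k \<odot>\<^bsub>Q\<^esub> \<phi> x"
      using T(2)[OF homogeneous] \<phi>D(4)[OF euler_shift_closed c(1)] by simp
    also have "\<dots> = euler_shift (k + l) \<odot>\<^bsub>Q\<^esub> \<phi> x \<oplus>\<^bsub>Q\<^esub> \<iota> (of_int l) \<odot>\<^bsub>Q\<^esub> \<phi> x"
      using Q.smult_l_distr[OF euler_shift_closed scalar_closed c(2)] euler_shift_add by metis
    finally show ?case using euler_defect(2)[OF Q \<phi>D(5)[OF homogeneous]] c(1) by simp
  next
    case (add x y)
    let ?\<theta> = "euler_defect Q" and ?c = "\<iota> (of_int l)"
    have c: "\<phi> x \<in> carrier Q" "\<phi> y \<in> carrier Q" "?\<theta> (\<phi> x) \<in> carrier Q" "?\<theta> (\<phi> y) \<in> carrier Q"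
      "?c \<odot>\<^bsub>Q\<^esub> \<phi> x \<in> carrier Q" "?c \<odot>\<^bsub>Q\<^esub> \<phi> y \<in> carrier Q"
      using add \<phi>D(2) \<theta>(2) Q.smult_closed[OF scalar_closed] by auto
    have "\<phi> (T (x \<oplus>\<^bsub>M\<^esub> y)) = \<phi> (T x) \<oplus>\<^bsub>Q\<^esub> \<phi> (T y)" using add T(1,3) \<phi>D(3) by simp
    also have "\<dots> = (?\<theta> (\<phi> x) \<oplus>\<^bsub>Q\<^esub> ?c \<odot>\<^bsub>Q\<^esub> \<phi> x) \<oplus>\<^bsub>Q\<^esub> (?\<theta> (\<phi> y) \<oplus>\<^bsub>Q\<^esub> ?c \<odot>\<^bsub>Q\<^esub> \<phi> y)" using add by simp
    also have "\<dots> = (?\<theta> (\<phi> x) \<oplus>\<^bsub>Q\<^esub> ?\<theta> (\<phi> y)) \<oplus>\<^bsub>Q\<^esub> (?c \<odot>\<^bsub>Q\<^esub> \<phi> x \<oplus>\<^bsub>Q\<^esub> ?c \<odot>\<^bsub>Q\<^esub> \<phi> y)"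
      using c by (simp add: Q.M.a_ac)
    also have "\<dots> = ?\<theta> (\<phi> (x \<oplus>\<^bsub>M\<^esub> y)) \<oplus>\<^bsub>Q\<^esub> ?c \<odot>\<^bsub>Q\<^esub> \<phi> (x \<oplus>\<^bsub>M\<^esub> y)"
      using add \<phi>D(3) \<theta>(3) c Q.smult_r_distr[OF scalar_closed] by simp
    finally show ?case using add M(3) by simp
  qed
  then show ?thesis by blast
qed

text \<open>
  The last condition is the vanishing of the defect.  The others are what maps out of \<open>M\<close> require:
  linear maps are extensional, so a composite is linear only if the carrier is closed under the
  operations; \<open>0 + 0 = 0\<close> makes linear maps preserve zero; and the span condition makes a linear map
  determined by its values on homogeneous elements.
\<close>

definition eulerian :: "('s, 'm) graded_module \<Rightarrow> bool" where
  "eulerian M \<longleftrightarrow> \<zero>\<^bsub>M\<^esub> \<in> carrier M \<and> \<zero>\<^bsub>M\<^esub> \<oplus>\<^bsub>M\<^esub> \<zero>\<^bsub>M\<^esub> = \<zero>\<^bsub>M\<^esub> \<and>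
     (\<forall>x\<in>carrier M. \<forall>y\<in>carrier M. x \<oplus>\<^bsub>M\<^esub> y \<in> carrier M) \<and>
     (\<forall>a\<in>carrier S. \<forall>x\<in>carrier M. a \<odot>\<^bsub>M\<^esub> x \<in> carrier M) \<and>
     (\<forall>k. hcomp M k \<subseteq> carrier M) \<and> carrier M \<subseteq> homogeneous_span M \<and>
     (\<forall>k. \<forall>x\<in>hcomp M k. euler_shift k \<odot>\<^bsub>M\<^esub> x = \<zero>\<^bsub>M\<^esub>)"

lemma eulerian_euler_defect:
  assumes M: "eulerian M" and Q: "graded_left_module S Q" and \<phi>: "\<phi> \<in> graded_hom S M Q l"
    and x: "x \<in> carrier M"
  shows "euler_defect Q (\<phi> x) \<oplus>\<^bsub>Q\<^esub> \<iota> (of_int l) \<odot>\<^bsub>Q\<^esub> \<phi> x = \<zero>\<^bsub>Q\<^esub>"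
proof -
  interpret Q: graded_left_module S Q by fact
  note \<phi>D = graded_homD[OF \<phi>]
  have "\<phi> \<zero>\<^bsub>M\<^esub> = euler_defect Q (\<phi> x) \<oplus>\<^bsub>Q\<^esub> \<iota> (of_int l) \<odot>\<^bsub>Q\<^esub> \<phi> x"
    by (rule euler_defect_natural[OF Q \<phi>, where T = "\<lambda>_. \<zero>\<^bsub>M\<^esub>"])
      (use M x in \<open>auto simp: eulerian_def subset_iff\<close>)
  moreover have "\<phi> \<zero>\<^bsub>M\<^esub> = \<zero>\<^bsub>Q\<^esub>"
    using \<phi>D(3)[of "\<zero>\<^bsub>M\<^esub>" "\<zero>\<^bsub>M\<^esub>"] M \<phi>D(2) by (intro Q.M.idem_zero) (auto simp: eulerian_def)
  ultimately show ?thesis by simp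
qed

lemma graded_left_module_span:
  assumes "graded_left_module S P" shows "carrier P \<subseteq> homogeneous_span P"
proof
  interpret P: graded_left_module S P by fact
  fix x assume "x \<in> carrier P"
  then show "x \<in> homogeneous_span P"
    by (induction x rule: P.MD.homogeneous_induct) (auto intro: homogeneous_span.intros)
qed

lemma euler_defect_commute:
  assumes P: "graded_left_module S P" and Q: "graded_left_module S Q" and \<delta>: "\<delta> \<in> graded_hom S P Q 0"
    and x: "x \<in> carrier P"
  shows "euler_defect Q (\<delta> x) = \<delta> (euler_defect P x)"
proof -
  interpret P: graded_left_module S P by fact
  interpret Q: graded_left_module S Q by fact
  note \<theta> = graded_homD[OF euler_defect(1)[OF P]] and \<theta>Q = graded_homD[OF euler_defect(1)[OF Q]]
    and \<delta>D = graded_homD[OF \<delta>]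
  have "\<delta> (euler_defect P x) = euler_defect Q (\<delta> x) \<oplus>\<^bsub>Q\<^esub> \<iota> (of_int 0) \<odot>\<^bsub>Q\<^esub> \<delta> x"
  proof (rule euler_defect_natural[OF Q \<delta>])
    show "x \<in> homogeneous_span P" using x graded_left_module_span[OF P] by blast
    show "euler_defect P \<zero>\<^bsub>P\<^esub> = \<zero>\<^bsub>P\<^esub>"
      by (rule left_hom_zero[OF P.M.abelian_group_axioms P.M.abelian_group_axioms \<theta>(6)])
  qed (use \<theta> P.MD.in_carrier euler_defect(2)[OF P] in auto)
  then show ?thesis
    using scalar_zero Q.smult_zero_left[OF \<delta>D(2)[OF x]] \<theta>Q(2)[OF \<delta>D(2)[OF x]] by simp
qed

section \<open>Concentration of Ext in degree zero\<close>

text \<open>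
  This is the comparison theorem for injective resolutions, applied to the endomorphism \<open>\<theta>\<close> of the
  resolution, which covers the zero map on \<open>N\<close>.
\<close>

lemma euler_defect_null_homotopic:
  assumes N: "eulerian N" and res: "graded_injective_resolution S N E \<epsilon> \<delta>"
  obtains h where "\<And>i. h i \<in> graded_hom S (E (Suc i)) (E i) 0"
    and "\<And>x. x \<in> carrier (E 0) \<Longrightarrow> euler_defect (E 0) x = h 0 (\<delta> 0 x)"
    and "\<And>i x. x \<in> carrier (E (Suc i)) \<Longrightarrow>
      euler_defect (E (Suc i)) x = \<delta> i (h i x) \<oplus>\<^bsub>E (Suc i)\<^esub> h (Suc i) (\<delta> (Suc i) x)"
proof -
  have inj: "graded_injective S (E i)" for i
    using res unfolding graded_injective_resolution_def by blast
  then have E: "graded_left_module S (E i)" for i unfolding graded_injective_def by blast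
  interpret E: graded_left_module S "E i" for i by (rule E)
  have \<delta>: "\<delta> i \<in> graded_hom S (E i) (E (Suc i)) 0" for i
    using res unfolding graded_injective_resolution_def by blast
  have \<epsilon>: "\<epsilon> \<in> graded_hom S N (E 0) 0"
    and ex0: "\<epsilon> ` carrier N = {x \<in> carrier (E 0). \<delta> 0 x = \<zero>\<^bsub>E 1\<^esub>}"
    and ex: "\<delta> i ` carrier (E i) = {x \<in> carrier (E (Suc i)). \<delta> (Suc i) x = \<zero>\<^bsub>E (Suc (Suc i))\<^esub>}" for i
    using res unfolding graded_injective_resolution_def by blast+
  note \<delta>D = graded_homD[OF \<delta>] and \<theta> = euler_defect(1)[OF E]
  note \<theta>D = graded_homD[OF \<theta>]
  \<comment> \<open>By the second clause \<open>\<theta> - \<delta> h\<close> vanishes on the image of \<open>\<delta> i\<close>, the kernel of \<open>\<delta> (Suc i)\<close>;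
    this is what the construction of the next homotopy needs.\<close>
  let ?P = "\<lambda>i h. h \<in> graded_hom S (E (Suc i)) (E i) 0 \<and>
    (\<forall>x\<in>carrier (E i). euler_defect (E (Suc i)) (\<delta> i x) = \<delta> i (h (\<delta> i x))) \<and>
    (i = 0 \<longrightarrow> (\<forall>x\<in>carrier (E 0). euler_defect (E 0) x = h (\<delta> 0 x)))"
  let ?R = "\<lambda>i h h'. \<forall>x\<in>carrier (E (Suc i)).
      euler_defect (E (Suc i)) x = \<delta> i (h x) \<oplus>\<^bsub>E (Suc i)\<^esub> h' (\<delta> (Suc i) x)"
  have base: "\<exists>h. ?P 0 h"
  proof -
    have ker: "euler_defect (E 0) x = \<zero>\<^bsub>E 0\<^esub>" if "x \<in> carrier (E 0)" "\<delta> 0 x = \<zero>\<^bsub>E (Suc 0)\<^esub>" for x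
    proof -
      have "x \<in> \<epsilon> ` carrier N" unfolding ex0 using that by simp
      then obtain y where y: "y \<in> carrier N" "x = \<epsilon> y" by blast
      show ?thesis
        using eulerian_euler_defect[OF N E \<epsilon> y(1)] scalar_zero E.smult_zero_left[OF that(1)] \<theta>D(2)[OF that(1)]
        unfolding y(2)[symmetric] by simp
    qed
    obtain h where h: "h \<in> graded_hom S (E (Suc 0)) (E 0) 0"
      "\<forall>x\<in>carrier (E 0). h (\<delta> 0 x) = euler_defect (E 0) x"
      using graded_injective_factor[OF E E inj \<delta> \<theta> ker] by blast
    have "euler_defect (E (Suc 0)) (\<delta> 0 x) = \<delta> 0 (h (\<delta> 0 x))" if "x \<in> carrier (E 0)" for x
      using euler_defect_commute[OF E E \<delta> that] h(2) that by simp
    then show ?thesis using h by auto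
  qed
  have step: "\<exists>h'. ?P (Suc i) h' \<and> ?R i h h'" if Ph: "?P i h" for i h
  proof -
    have h: "h \<in> graded_hom S (E (Suc i)) (E i) 0" using Ph by blast
    note hD = graded_homD[OF h]
    let ?\<omega> = "\<lambda>x\<in>carrier (E (Suc i)). euler_defect (E (Suc i)) x \<ominus>\<^bsub>E (Suc i)\<^esub>
      (\<lambda>x\<in>carrier (E (Suc i)). \<delta> i (h x)) x"
    have "(\<lambda>x\<in>carrier (E (Suc i)). \<delta> i (h x)) \<in> graded_hom S (E (Suc i)) (E (Suc i)) (0 + 0)"
      by (rule graded_hom_comp[OF h \<delta>]) (use E.MD.in_carrier E.smult_closed in auto)
    then have "(\<lambda>x\<in>carrier (E (Suc i)). \<delta> i (h x)) \<in> graded_hom S (E (Suc i)) (E (Suc i)) 0"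
      by (simp only: add_0_left)
    note \<omega> = graded_hom_minus[OF E E \<theta> this]
    have ker: "?\<omega> x = \<zero>\<^bsub>E (Suc i)\<^esub>"
      if x: "x \<in> carrier (E (Suc i))" "\<delta> (Suc i) x = \<zero>\<^bsub>E (Suc (Suc i))\<^esub>" for x
    proof -
      obtain y where y: "y \<in> carrier (E i)" "x = \<delta> i y" using ex[of i] x by auto
      have "euler_defect (E (Suc i)) x = \<delta> i (h x)" using Ph y by auto
      then show ?thesis using x(1) \<delta>D(2)[OF hD(2)[OF x(1)]] by (simp add: a_minus_def E.M.r_neg)
    qed
    obtain h' where h': "h' \<in> graded_hom S (E (Suc (Suc i))) (E (Suc i)) 0"
      "\<forall>x\<in>carrier (E (Suc i)). h' (\<delta> (Suc i) x) = ?\<omega> x"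
      using graded_injective_factor[OF E E inj \<delta> \<omega> ker] by blast
    have R: "?R i h h'"
    proof
      fix x assume x: "x \<in> carrier (E (Suc i))"
      have c: "euler_defect (E (Suc i)) x \<in> carrier (E (Suc i))" "\<delta> i (h x) \<in> carrier (E (Suc i))"
        using \<theta>D(2)[OF x] \<delta>D(2)[OF hD(2)[OF x]] .
      have "h' (\<delta> (Suc i) x) = euler_defect (E (Suc i)) x \<oplus>\<^bsub>E (Suc i)\<^esub> \<ominus>\<^bsub>E (Suc i)\<^esub> \<delta> i (h x)"
        using h'(2) x by (simp add: a_minus_def)
      then show "euler_defect (E (Suc i)) x = \<delta> i (h x) \<oplus>\<^bsub>E (Suc i)\<^esub> h' (\<delta> (Suc i) x)"
        using c E.M.a_lcomm[OF c(2) c(1) E.M.a_inv_closed[OF c(2)]] by (simp add: E.M.r_neg)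
    qed
    have "euler_defect (E (Suc (Suc i))) (\<delta> (Suc i) x) = \<delta> (Suc i) (h' (\<delta> (Suc i) x))"
      if x: "x \<in> carrier (E (Suc i))" for x
    proof -
      have c: "\<delta> i (h x) \<in> carrier (E (Suc i))" "h' (\<delta> (Suc i) x) \<in> carrier (E (Suc i))"
        using \<delta>D(2)[OF hD(2)[OF x]] graded_homD(2)[OF h'(1) \<delta>D(2)[OF x]] .
      have "\<delta> i (h x) \<in> {x \<in> carrier (E (Suc i)). \<delta> (Suc i) x = \<zero>\<^bsub>E (Suc (Suc i))\<^esub>}"
        unfolding ex[symmetric] using hD(2)[OF x] by blast
      then have "\<delta> (Suc i) (euler_defect (E (Suc i)) x) = \<delta> (Suc i) (h' (\<delta> (Suc i) x))"
        using R x \<delta>D(3)[OF c] \<delta>D(2)[OF c(2)] by simp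
      then show ?thesis using euler_defect_commute[OF E E \<delta> x] by simp
    qed
    then show ?thesis using h'(1) R by blast
  qed
  have "\<exists>h. \<forall>i. ?P i (h i) \<and> ?R i (h i) (h (Suc i))"
    by (rule dependent_nat_choice[of ?P ?R, OF base step])
  then obtain h where h: "\<forall>i. ?P i (h i) \<and> ?R i (h i) (h (Suc i))" by (rule exE)
  note P = h[THEN spec, THEN conjunct1] and R = h[THEN spec, THEN conjunct2]
  show thesis
  proof (rule that[of h])
    show "h i \<in> graded_hom S (E (Suc i)) (E i) 0" for i using P[of i] by (rule conjunct1)
    show "euler_defect (E 0) x = h 0 (\<delta> 0 x)" if "x \<in> carrier (E 0)" for x
      using P[of 0, THEN conjunct2, THEN conjunct2] that by simp
  qed (rule R[THEN bspec])
qed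

lemma graded_hom_scalar:
  assumes Q: "graded_left_module S Q" and \<phi>: "\<phi> \<in> graded_hom S M Q l"
    and M: "\<And>x y. \<lbrakk>x \<in> carrier M; y \<in> carrier M\<rbrakk> \<Longrightarrow> x \<oplus>\<^bsub>M\<^esub> y \<in> carrier M"
      "\<And>a x. \<lbrakk>a \<in> carrier S; x \<in> carrier M\<rbrakk> \<Longrightarrow> a \<odot>\<^bsub>M\<^esub> x \<in> carrier M"
      "\<And>k x. x \<in> hcomp M k \<Longrightarrow> x \<in> carrier M"
  shows "(\<lambda>x\<in>carrier M. \<iota> c \<odot>\<^bsub>Q\<^esub> \<phi> x) \<in> graded_hom S M Q l"
proof -
  interpret Q: graded_left_module S Q by fact
  note \<phi>D = graded_homD[OF \<phi>]
  have comm: "\<iota> c \<odot>\<^bsub>Q\<^esub> (a \<odot>\<^bsub>Q\<^esub> y) = a \<odot>\<^bsub>Q\<^esub> (\<iota> c \<odot>\<^bsub>Q\<^esub> y)" if "a \<in> carrier S" "y \<in> carrier Q" for a y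
    using Q.smult_assoc1[symmetric] scalar_closed that scalar_central by simp
  show ?thesis
  proof (rule graded_homI)
    show "(\<lambda>x\<in>carrier M. \<iota> c \<odot>\<^bsub>Q\<^esub> \<phi> x) \<in> carrier M \<rightarrow>\<^sub>E carrier Q"
      using \<phi>D(2) Q.smult_closed scalar_closed by auto
    show "(\<lambda>x\<in>carrier M. \<iota> c \<odot>\<^bsub>Q\<^esub> \<phi> x) x \<in> hcomp Q (k + l)" if "x \<in> hcomp M k" for x k
      using Q.hcomp_smult[OF scalar_gcomp \<phi>D(5)[OF that]] M(3)[OF that] by simp
  qed (use M \<phi>D comm Q.smult_r_distr scalar_closed in auto)
qed

text \<open>
  The degree \<open>l\<close> may already occur among the components of \<open>\<beta>\<close>; then the new map is added to that
  component.
\<close>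

lemma star_Hom_add_homogeneous:
  assumes Q: "graded_left_module S Q" and M: "eulerian M"
    and \<beta>: "\<beta> \<in> carrier (star_Hom S \<iota> M Q)" and \<psi>: "\<psi> \<in> graded_hom S M Q l"
  shows "(\<lambda>x\<in>carrier M. \<beta> x \<oplus>\<^bsub>Q\<^esub> \<psi> x) \<in> carrier (star_Hom S \<iota> M Q)"
proof -
  interpret Q: graded_left_module S Q by fact
  have closed: "\<And>x y. \<lbrakk>x \<in> carrier M; y \<in> carrier M\<rbrakk> \<Longrightarrow> x \<oplus>\<^bsub>M\<^esub> y \<in> carrier M"
      "\<And>a x. \<lbrakk>a \<in> carrier S; x \<in> carrier M\<rbrakk> \<Longrightarrow> a \<odot>\<^bsub>M\<^esub> x \<in> carrier M"
      "\<And>k x. x \<in> hcomp M k \<Longrightarrow> x \<in> carrier M"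
    using M unfolding eulerian_def by blast+
  obtain L g where \<beta>h: "\<beta> \<in> left_hom S M Q" and fin: "finite L"
    and g: "\<And>l. l \<in> L \<Longrightarrow> g l \<in> graded_hom S M Q l" "\<And>x. x \<in> carrier M \<Longrightarrow> \<beta> x = finsum Q (\<lambda>l. g l x) L"
    using \<beta> unfolding star_Hom_def by auto
  note \<beta>D = left_homD[OF \<beta>h] and \<psi>D = graded_homD[OF \<psi>]
  have sum_hom: "(\<lambda>x\<in>carrier M. \<alpha> x \<oplus>\<^bsub>Q\<^esub> \<psi> x) \<in> left_hom S M Q" if "\<alpha> \<in> left_hom S M Q" for \<alpha>
    using closed left_homD[OF that] \<psi>D Q.smult_r_distr Q.smult_closed
    by (auto simp: left_hom_def Q.M.a_ac)
  have sum_graded: "(\<lambda>x\<in>carrier M. \<alpha> x \<oplus>\<^bsub>Q\<^esub> \<psi> x) \<in> graded_hom S M Q l" if "\<alpha> \<in> graded_hom S M Q l" for \<alpha>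
    using sum_hom[of \<alpha>] closed(3) graded_homD[OF that] \<psi>D(5) by (auto simp: graded_hom_def)
  define g' where "g' = g(l := if l \<in> L then (\<lambda>x\<in>carrier M. g l x \<oplus>\<^bsub>Q\<^esub> \<psi> x) else \<psi>)"
  have g'h: "g' j \<in> graded_hom S M Q j" if "j \<in> insert l L" for j
    using that g(1) sum_graded \<psi> by (auto simp: g'_def)
  have "\<beta> x \<oplus>\<^bsub>Q\<^esub> \<psi> x = finsum Q (\<lambda>j. g' j x) (insert l L)" if x: "x \<in> carrier M" for x
  proof -
    have gx: "g j x \<in> carrier Q" if "j \<in> L" for j using graded_homD(2)[OF g(1)[OF that] x] .
    have \<psi>x: "\<psi> x \<in> carrier Q" by (rule \<psi>D(2)[OF x])
    let ?L = "L - {l}"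
    have same: "finsum Q (\<lambda>j. g' j x) ?L = finsum Q (\<lambda>j. g j x) ?L"
      by (rule Q.M.finsum_cong') (use gx in \<open>auto simp: g'_def\<close>)
    have cl: "finsum Q (\<lambda>j. g j x) ?L \<in> carrier Q" using gx by (intro Q.M.finsum_closed) auto
    have "finsum Q (\<lambda>j. g' j x) (insert l ?L) = g' l x \<oplus>\<^bsub>Q\<^esub> finsum Q (\<lambda>j. g' j x) ?L"
      by (rule Q.M.finsum_insert) (use fin gx graded_homD(2)[OF g'h x] in auto)
    also have "\<dots> = finsum Q (\<lambda>j. g j x) L \<oplus>\<^bsub>Q\<^esub> \<psi> x"
    proof (cases "l \<in> L")
      case True
      then have "finsum Q (\<lambda>j. g j x) L = g l x \<oplus>\<^bsub>Q\<^esub> finsum Q (\<lambda>j. g j x) ?L"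
        using Q.M.finsum_insert[of ?L l "\<lambda>j. g j x"] fin gx by (auto simp: insert_absorb)
      then show ?thesis using True same gx[OF True] \<psi>x cl x by (simp add: g'_def Q.M.a_ac)
    next
      case False
      then show ?thesis using same cl \<psi>x by (simp add: g'_def Q.M.a_ac)
    qed
    finally show ?thesis using g(2)[OF x] by simp
  qed
  then show ?thesis using sum_hom[OF \<beta>h] g'h fin
    unfolding star_Hom_def by (auto intro!: exI[of _ "insert l L"] exI[of _ g'])
qed

text \<open>
  The defect of \<open>M\<close> vanishes and that of the resolution is \<open>\<delta> h + h \<delta>\<close>, so the commutation rule turns a
  cocycle \<open>\<phi>\<close> of degree \<open>l\<close> into \<open>- l \<phi> = \<delta> h \<phi>\<close>; it remains to divide by \<open>l\<close>.  Cohomology is made of cosets,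
  so the claim proved is that translation by \<open>\<phi>\<close> maps the set \<open>B\<close> of coboundaries onto itself.
\<close>

theorem star_Ext_concentrated:
  assumes M: "eulerian M" and N: "eulerian N"
    and res: "graded_injective_resolution S N E \<epsilon> \<delta>" and l: "l \<noteq> 0"
  shows "hcomp (star_Ext S \<iota> M E \<delta> \<nu>) l = {\<zero>\<^bsub>star_Ext S \<iota> M E \<delta> \<nu>\<^esub>}"
proof -
  have E: "graded_left_module S (E i)" for i
    using res unfolding graded_injective_resolution_def graded_injective_def by blast
  interpret E: graded_left_module S "E i" for i by (rule E)
  have \<delta>: "\<delta> i \<in> graded_hom S (E i) (E (Suc i)) 0" for i
    using res unfolding graded_injective_resolution_def by blast
  note \<delta>D = graded_homD[OF \<delta>]
  have \<delta>0: "\<delta> i \<zero>\<^bsub>E i\<^esub> = \<zero>\<^bsub>E (Suc i)\<^esub>" for i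
    by (rule left_hom_zero[OF E.M.abelian_group_axioms E.M.abelian_group_axioms \<delta>D(6)])
  have closed: "\<And>x y. \<lbrakk>x \<in> carrier M; y \<in> carrier M\<rbrakk> \<Longrightarrow> x \<oplus>\<^bsub>M\<^esub> y \<in> carrier M"
      "\<And>a x. \<lbrakk>a \<in> carrier S; x \<in> carrier M\<rbrakk> \<Longrightarrow> a \<odot>\<^bsub>M\<^esub> x \<in> carrier M"
      "\<And>k x. x \<in> hcomp M k \<Longrightarrow> x \<in> carrier M"
    using M unfolding eulerian_def by blast+
  let ?d = "\<lambda>i \<phi>. \<lambda>x\<in>carrier M. \<delta> i (\<phi> x)"
  let ?C = "\<lambda>i. star_Hom S \<iota> M (E i)"
  define B where "B = coboundaries ?C ?d \<nu>"
  have absorb: "(\<lambda>b. (\<lambda>x\<in>carrier M. b x \<oplus>\<^bsub>E \<nu>\<^esub> \<phi> x)) ` B = B"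
    if \<phi>: "\<phi> \<in> graded_hom S M (E \<nu>) l" and cocycle: "\<And>x. x \<in> carrier M \<Longrightarrow> \<delta> \<nu> (\<phi> x) = \<zero>\<^bsub>E (Suc \<nu>)\<^esub>" for \<phi>
  proof -
    note \<phi>D = graded_homD[OF \<phi>]
    obtain h where h: "\<And>i. h i \<in> graded_hom S (E (Suc i)) (E i) 0"
      and h0: "\<And>x. x \<in> carrier (E 0) \<Longrightarrow> euler_defect (E 0) x = h 0 (\<delta> 0 x)"
      and hS: "\<And>i x. x \<in> carrier (E (Suc i)) \<Longrightarrow>
        euler_defect (E (Suc i)) x = \<delta> i (h i x) \<oplus>\<^bsub>E (Suc i)\<^esub> h (Suc i) (\<delta> (Suc i) x)"
      using euler_defect_null_homotopic[OF N res] by blast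
    note hD = graded_homD[OF h]
    have hz: "h i \<zero>\<^bsub>E (Suc i)\<^esub> = \<zero>\<^bsub>E i\<^esub>" for i
      by (rule left_hom_zero[OF E.M.abelian_group_axioms E.M.abelian_group_axioms hD(6)])
    have inv_l: "\<iota> (inverse (of_int l)) \<odot>\<^bsub>E \<nu>\<^esub> (\<iota> (of_int l) \<odot>\<^bsub>E \<nu>\<^esub> y) = y" if "y \<in> carrier (E \<nu>)" for y
      using E.smult_assoc1[OF scalar_closed scalar_closed that, of "inverse (of_int l)" "of_int l"] l
        E.smult_one[OF that] by (simp add: scalar_mult[symmetric] scalar_one)
    show ?thesis
    proof (cases \<nu>)
      case 0
      \<comment> \<open>Here \<open>\<theta> = h \<delta>\<close> without a term \<open>\<delta> h\<close>, so \<open>l \<phi> = 0\<close>.\<close>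
      have "\<phi> x = \<zero>\<^bsub>E 0\<^esub>" if x: "x \<in> carrier M" for x
      proof -
        have "\<phi> x \<in> carrier (E 0)" using \<phi>D(2)[OF x] 0 by simp
        then have "euler_defect (E 0) (\<phi> x) = \<zero>\<^bsub>E 0\<^esub>"
          using h0 cocycle[OF x] hz 0 by simp
        then have "\<iota> (of_int l) \<odot>\<^bsub>E 0\<^esub> \<phi> x = \<zero>\<^bsub>E 0\<^esub>"
          using eulerian_euler_defect[OF M E \<phi> x] 0 E.smult_closed[OF scalar_closed \<phi>D(2)[OF x]] by simp
        then show ?thesis
          using inv_l[OF \<phi>D(2)[OF x]] E.smult_zero_right[OF scalar_closed] 0 by simp
      qed
      moreover have "B = {\<lambda>x\<in>carrier M. \<zero>\<^bsub>E 0\<^esub>}"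
        by (simp add: B_def 0 coboundaries_def star_Hom_def)
      ultimately show ?thesis by (auto simp: 0 cong: restrict_cong)
    next
      case (Suc j)
      have \<phi>': "\<phi> \<in> graded_hom S M (E (Suc j)) l" using \<phi> Suc by simp
      define \<chi> where "\<chi> = (\<lambda>x\<in>carrier M. h j (\<phi> x))"
      have \<chi>: "\<chi> \<in> graded_hom S M (E j) l"
        using graded_hom_comp[OF \<phi>' h closed] by (simp add: \<chi>_def)
      note \<chi>D = graded_homD[OF \<chi>]
      have \<delta>\<chi>: "\<delta> j (\<chi> x) = \<ominus>\<^bsub>E \<nu>\<^esub> (\<iota> (of_int l) \<odot>\<^bsub>E \<nu>\<^esub> \<phi> x)" if x: "x \<in> carrier M" for x
      proof -
        have c: "\<phi> x \<in> carrier (E (Suc j))" using \<phi>D(2)[OF x] Suc by simp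
        have "euler_defect (E (Suc j)) (\<phi> x) = \<delta> j (\<chi> x)"
          using hS[OF c] cocycle[OF x] hz \<delta>D(2)[OF hD(2)[OF c]] Suc x by (simp add: \<chi>_def)
        then have "\<delta> j (\<chi> x) \<oplus>\<^bsub>E \<nu>\<^esub> \<iota> (of_int l) \<odot>\<^bsub>E \<nu>\<^esub> \<phi> x = \<zero>\<^bsub>E \<nu>\<^esub>"
          using eulerian_euler_defect[OF M E \<phi> x] Suc by simp
        from E.M.minus_equality[OF this] show ?thesis
          using c Suc \<delta>D(2)[OF \<chi>D(2)[OF x]] E.smult_closed[OF scalar_closed c] by simp
      qed
      \<comment> \<open>The choices \<open>c = -1/l\<close> and \<open>c = 1/l\<close> give primitives of \<open>\<phi>\<close> and of \<open>- \<phi>\<close>, one for each inclusion.\<close>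
      let ?s = "\<lambda>c. \<lambda>x\<in>carrier M. \<iota> c \<odot>\<^bsub>E j\<^esub> \<chi> x"
      have s: "?s c \<in> graded_hom S M (E j) l" for c by (rule graded_hom_scalar[OF E \<chi> closed])
      have \<delta>s: "\<delta> j (?s c x) = \<ominus>\<^bsub>E \<nu>\<^esub> (\<iota> (c * of_int l) \<odot>\<^bsub>E \<nu>\<^esub> \<phi> x)" if x: "x \<in> carrier M" for c x
        using x \<delta>\<chi>[OF x] \<delta>D(4)[OF scalar_closed \<chi>D(2)[OF x]] \<phi>D(2)[OF x] Suc scalar_closed
          E.smult_minus_right E.smult_closed E.smult_assoc1 by (simp add: scalar_mult)
      have BS: "B = ?d j ` carrier (?C j)" by (simp add: B_def coboundaries_def Suc)
      have shift: "(\<lambda>x\<in>carrier M. b x \<oplus>\<^bsub>E \<nu>\<^esub> \<delta> j (?s c x)) \<in> B" if b: "b \<in> B" for b c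
      proof -
        obtain \<beta> where \<beta>: "\<beta> \<in> carrier (?C j)" "b = ?d j \<beta>"
          using b by (auto simp: B_def coboundaries_def Suc)
        have "\<beta> \<in> left_hom S M (E j)" using \<beta>(1) by (simp add: star_Hom_def)
        note \<beta>D = left_homD[OF this]
        have "(\<lambda>x\<in>carrier M. b x \<oplus>\<^bsub>E \<nu>\<^esub> \<delta> j (?s c x)) = ?d j (\<lambda>x\<in>carrier M. \<beta> x \<oplus>\<^bsub>E j\<^esub> ?s c x)"
          using \<beta>(2) \<delta>D(3)[OF \<beta>D(2) graded_homD(2)[OF s]] Suc by (auto simp: fun_eq_iff)
        moreover have "?d j (\<lambda>x\<in>carrier M. \<beta> x \<oplus>\<^bsub>E j\<^esub> ?s c x) \<in> B"
          unfolding BS by (rule imageI) (rule star_Hom_add_homogeneous[OF E M \<beta>(1) s])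
        ultimately show ?thesis by (simp only:)
      qed
      have plus: "\<delta> j (?s (- inverse (of_int l)) x) = \<phi> x" if x: "x \<in> carrier M" for x
      proof -
        have "\<iota> (- 1) = \<ominus> \<one>"
          using scalar_add[of "- 1" 1] scalar_zero scalar_one scalar_closed
          by (metis add.left_inverse minus_equality one_closed)
        then show ?thesis
          using \<delta>s[OF x, of "- inverse (of_int l)"] l \<phi>D(2)[OF x] E.smult_minus_left E.smult_one
          by simp
      qed
      have minus: "\<delta> j (?s (inverse (of_int l)) x) = \<ominus>\<^bsub>E \<nu>\<^esub> \<phi> x" if x: "x \<in> carrier M" for x
        using \<delta>s[OF x, of "inverse (of_int l)"] l \<phi>D(2)[OF x] E.smult_one by (simp add: scalar_one)
      show ?thesis
      proof (intro equalityI subsetI)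
        fix b assume "b \<in> (\<lambda>b. (\<lambda>x\<in>carrier M. b x \<oplus>\<^bsub>E \<nu>\<^esub> \<phi> x)) ` B"
        then obtain b' where b': "b' \<in> B" "b = (\<lambda>x\<in>carrier M. b' x \<oplus>\<^bsub>E \<nu>\<^esub> \<phi> x)" by blast
        have "b = (\<lambda>x\<in>carrier M. b' x \<oplus>\<^bsub>E \<nu>\<^esub> \<delta> j (?s (- inverse (of_int l)) x))"
          unfolding b'(2) by (rule restrict_ext) (simp only: plus)
        then show "b \<in> B" using shift[OF b'(1)] by simp
      next
        fix b assume b: "b \<in> B"
        let ?b' = "\<lambda>x\<in>carrier M. b x \<oplus>\<^bsub>E \<nu>\<^esub> \<delta> j (?s (inverse (of_int l)) x)"
        have bE: "b \<in> carrier M \<rightarrow>\<^sub>E carrier (E \<nu>)"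
        proof -
          obtain \<beta> where \<beta>: "\<beta> \<in> left_hom S M (E j)" "b = ?d j \<beta>"
            using b unfolding BS star_Hom_def by auto
          show ?thesis unfolding \<beta>(2) Suc using \<delta>D(2)[OF left_homD(2)[OF \<beta>(1)]] by auto
        qed
        have "b x = (\<lambda>x\<in>carrier M. ?b' x \<oplus>\<^bsub>E \<nu>\<^esub> \<phi> x) x" for x
        proof (cases "x \<in> carrier M")
          case True
          then have "b x \<in> carrier (E \<nu>)" using bE by blast
          then show ?thesis using True minus[OF True] \<phi>D(2)[OF True] by (simp add: E.M.a_assoc E.M.l_neg)
        next
          case False
          then show ?thesis using bE by (auto simp: PiE_def extensional_def)
        qed
        then show "b \<in> (\<lambda>b. (\<lambda>x\<in>carrier M. b x \<oplus>\<^bsub>E \<nu>\<^esub> \<phi> x)) ` B" using shift[OF b] by blast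
      qed
    qed
  qed
  let ?Z = "{\<phi> \<in> graded_hom S M (E \<nu>) l. ?d \<nu> \<phi> = (\<lambda>x\<in>carrier M. \<zero>\<^bsub>E (Suc \<nu>)\<^esub>)}"
  have "hcomp (star_Ext S \<iota> M E \<delta> \<nu>) l = (\<lambda>\<phi>. (\<lambda>b. (\<lambda>x\<in>carrier M. b x \<oplus>\<^bsub>E \<nu>\<^esub> \<phi> x)) ` B) ` ?Z"
    by (auto simp: star_Ext_def cohomology_def quotient_module_def cocycles_def B_def star_Hom_def a_r_coset_def')
  also have "\<dots> = (\<lambda>\<phi>. B) ` ?Z"
  proof (rule image_cong[OF refl])
    fix \<phi> assume "\<phi> \<in> ?Z"
    then have \<phi>: "\<phi> \<in> graded_hom S M (E \<nu>) l"
      and eq: "?d \<nu> \<phi> = (\<lambda>x\<in>carrier M. \<zero>\<^bsub>E (Suc \<nu>)\<^esub>)" by auto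
    have "\<delta> \<nu> (\<phi> x) = \<zero>\<^bsub>E (Suc \<nu>)\<^esub>" if "x \<in> carrier M" for x
      using fun_cong[OF eq, of x] that by simp
    then show "(\<lambda>b. (\<lambda>x\<in>carrier M. b x \<oplus>\<^bsub>E \<nu>\<^esub> \<phi> x)) ` B = B" by (rule absorb[OF \<phi>])
  qed
  also have "\<dots> = {B}"
  proof -
    have "(\<lambda>x\<in>carrier M. \<zero>\<^bsub>E \<nu>\<^esub>) \<in> ?Z"
      using closed E.smult_zero_right \<delta>0 by (auto simp: graded_hom_def left_hom_def)
    then show ?thesis by blast
  qed
  also have "B = \<zero>\<^bsub>star_Ext S \<iota> M E \<delta> \<nu>\<^esub>"
    by (simp add: star_Ext_def cohomology_def quotient_module_def B_def)
  finally show ?thesis .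
qed

end

section \<open>Polynomials and their derivatives\<close>

lemma mpoly_induct:
  fixes p :: "'k::field mpoly"
  assumes "P 0" "\<And>m. m \<in> Poly_Mapping.keys p \<Longrightarrow> P (Poly_Mapping.single m (Poly_Mapping.lookup p m))"
    "\<And>q r. \<lbrakk>P q; P r\<rbrakk> \<Longrightarrow> P (q + r)"
  shows "P p"
proof -
  have eq: "p = (\<Sum>m\<in>Poly_Mapping.keys p. Poly_Mapping.single m (Poly_Mapping.lookup p m))"
    by (rule poly_mapping_eqI)
      (simp add: lookup_sum lookup_single when_def in_keys_iff sum.delta)
  have "finite A \<Longrightarrow> A \<subseteq> Poly_Mapping.keys p \<Longrightarrow>
      P (\<Sum>m\<in>A. Poly_Mapping.single m (Poly_Mapping.lookup p m))" for A
    by (induction A rule: finite_induct) (use assms in auto)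
  from this[OF finite_keys subset_refl] show ?thesis by (simp only: eq[symmetric])
qed

lemma polys_0 [simp]: "0 \<in> polys n" by (simp add: polys_def)

lemma polys_add [simp]: "p \<in> polys n \<Longrightarrow> q \<in> polys n \<Longrightarrow> p + q \<in> polys n"
  using keys_add[of p q] by (fastforce simp: polys_def)

lemma polys_uminus [simp]: "p \<in> polys n \<Longrightarrow> - p \<in> polys n"
  by (auto simp: polys_def in_keys_iff)

lemma polys_diff [simp]: "p \<in> polys n \<Longrightarrow> q \<in> polys n \<Longrightarrow> p - q \<in> polys n"
  using polys_add[of p n "- q"] by simp

lemma polys_mult [simp]:
  assumes "p \<in> polys n" "q \<in> polys n" shows "p * q \<in> polys n"
  unfolding polys_def
proof safe
  fix m x assume "m \<in> Poly_Mapping.keys (p * q)" "x \<in> Poly_Mapping.keys m"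
  then obtain a b where "m = a + b" "a \<in> Poly_Mapping.keys p" "b \<in> Poly_Mapping.keys q"
    using keys_mult[of p q] by blast
  then show "x < n" using assms keys_add[of a b] \<open>x \<in> Poly_Mapping.keys m\<close> by (fastforce simp: polys_def)
qed

lemma polys_Const [simp]: "Const c \<in> polys n"
  by (auto simp: polys_def Const_def)

lemma polys_1 [simp]: "1 \<in> polys n"
  by (auto simp: polys_def)

lemma polys_Var [simp]: "i < n \<Longrightarrow> Var i \<in> polys n"
  by (auto simp: polys_def Var_def)

lemma polys_sum [simp]: "(\<And>i. i \<in> A \<Longrightarrow> f i \<in> polys n) \<Longrightarrow> sum f A \<in> polys n"
  by (induction A rule: infinite_finite_induct) auto

lemma polys_power [simp]: "p \<in> polys n \<Longrightarrow> p ^ k \<in> polys n"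
  by (induction k) auto

lemma polys_prod [simp]: "(\<And>i. i \<in> A \<Longrightarrow> f i \<in> polys n) \<Longrightarrow> prod f A \<in> polys n"
  by (induction A rule: infinite_finite_induct) auto

lemma Const_add: "Const (a + b) = Const a + Const b" by (simp add: Const_def single_add)
lemma Const_mult: "Const (a * b) = Const a * Const b" by (simp add: Const_def mult_single)
lemma Const_1: "Const 1 = 1" by (simp add: Const_def)
lemma Const_of_int: "Const (of_int d) = of_int d" by (simp add: Const_def)

lemma pderivative_superset:
  assumes "finite A" "Poly_Mapping.keys p \<subseteq> A"
  shows "pderivative i p = (\<Sum>m\<in>A. Poly_Mapping.single (m - Poly_Mapping.single i 1)
       (of_nat (Poly_Mapping.lookup m i) * Poly_Mapping.lookup p m))"
  unfolding pderivative_def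
  by (rule sum.mono_neutral_left) (use assms in \<open>auto simp: in_keys_iff\<close>)

lemma pderivative_add [simp]: "pderivative i (p + q) = pderivative i p + pderivative i q"
proof -
  let ?A = "Poly_Mapping.keys p \<union> Poly_Mapping.keys q"
  have "pderivative i (p + q) = (\<Sum>m\<in>?A. Poly_Mapping.single (m - Poly_Mapping.single i 1)
       (of_nat (Poly_Mapping.lookup m i) * Poly_Mapping.lookup (p + q) m))"
    by (rule pderivative_superset) (use keys_add[of p q] in auto)
  then show ?thesis
    by (simp add: pderivative_superset[of ?A p] pderivative_superset[of ?A q] lookup_add
        distrib_left single_add sum.distrib)
qed

lemma pderivative_0 [simp]: "pderivative i 0 = 0"
  by (simp add: pderivative_def)

lemma pderivative_single:
  "pderivative i (Poly_Mapping.single m c) =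
    Poly_Mapping.single (m - Poly_Mapping.single i 1) (of_nat (Poly_Mapping.lookup m i) * c)"
  by (subst pderivative_superset[of "{m}"]) auto

text \<open>
  Subtraction of exponents is truncated, but not where \<open>X\<^sub>i\<close> occurs; where it does not occur, the coefficient
  of the derivative is zero and its exponent is irrelevant.
\<close>

lemma exponent_minus_add:
  fixes m m' :: "nat \<Rightarrow>\<^sub>0 nat"
  assumes "Poly_Mapping.lookup m i \<noteq> 0"
  shows "m - Poly_Mapping.single i 1 + m' = m + m' - Poly_Mapping.single i 1"
  by (rule poly_mapping_eqI)
    (use assms in \<open>auto simp: lookup_add minus_poly_mapping.rep_eq lookup_single when_def\<close>)

lemma pderivative_mult: "pderivative i (p * q) = pderivative i p * q + p * pderivative i q"
proof (induction p rule: mpoly_induct)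
  case (2 m)
  define c where "c = Poly_Mapping.lookup p m"
  have "pderivative i (Poly_Mapping.single m c * q) =
      pderivative i (Poly_Mapping.single m c) * q + Poly_Mapping.single m c * pderivative i q"
  proof (induction q rule: mpoly_induct)
    case (2 m')
    define c' where "c' = Poly_Mapping.lookup q m'"
    let ?t = "\<lambda>r. Poly_Mapping.single (m + m' - Poly_Mapping.single i 1) r"
    have "pderivative i (Poly_Mapping.single m c) * Poly_Mapping.single m' c' =
        ?t (of_nat (Poly_Mapping.lookup m i) * (c * c'))"
      using exponent_minus_add[of m i m']
      by (cases "Poly_Mapping.lookup m i = 0") (simp_all add: pderivative_single mult_single mult.assoc)
    moreover have "Poly_Mapping.single m c * pderivative i (Poly_Mapping.single m' c') =
        ?t (of_nat (Poly_Mapping.lookup m' i) * (c * c'))"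
      using exponent_minus_add[of m' i m]
      by (cases "Poly_Mapping.lookup m' i = 0")
        (simp_all add: pderivative_single mult_single add.commute[of m] mult.left_commute)
    moreover have "pderivative i (Poly_Mapping.single m c * Poly_Mapping.single m' c') =
        ?t (of_nat (Poly_Mapping.lookup m i) * (c * c')) + ?t (of_nat (Poly_Mapping.lookup m' i) * (c * c'))"
      by (simp add: mult_single pderivative_single lookup_add distrib_right single_add)
    ultimately show ?case unfolding c'_def by (simp only:)
  next
    case (3 q r)
    then show ?case by (simp add: distrib_left)
  qed simp
  then show ?case unfolding c_def .
next
  case (3 q r)
  then show ?case by (simp add: distrib_right)
qed simp

lemma pderivative_Const [simp]: "pderivative i (Const c) = 0"
  by (simp add: Const_def pderivative_single)

lemma pderivative_1 [simp]: "pderivative i 1 = 0"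
  using pderivative_Const[of i 1] by (simp only: Const_1)

lemma polys_pderivative [simp]:
  assumes "p \<in> polys n" shows "pderivative i p \<in> polys n"
  unfolding pderivative_def
proof (rule polys_sum)
  fix m assume "m \<in> Poly_Mapping.keys p"
  then have "Poly_Mapping.keys m \<subseteq> {..<n}" using assms by (auto simp: polys_def)
  moreover have "Poly_Mapping.keys (m - Poly_Mapping.single i 1) \<subseteq> Poly_Mapping.keys m"
    by (auto simp: in_keys_iff minus_poly_mapping.rep_eq)
  ultimately have "Poly_Mapping.keys (m - Poly_Mapping.single i 1) \<subseteq> {..<n}" by blast
  then show "Poly_Mapping.single (m - Poly_Mapping.single i 1)
       (of_nat (Poly_Mapping.lookup m i) * Poly_Mapping.lookup p m) \<in> polys n"
    by (auto simp: polys_def)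
qed

section \<open>Homogeneous polynomials\<close>

definition total_degree :: "(nat \<Rightarrow>\<^sub>0 nat) \<Rightarrow> nat" where
  "total_degree m = (\<Sum>i\<in>Poly_Mapping.keys m. Poly_Mapping.lookup m i)"

lemma total_degree_superset:
  assumes "finite A" "Poly_Mapping.keys m \<subseteq> A"
  shows "total_degree m = (\<Sum>i\<in>A. Poly_Mapping.lookup m i)"
  unfolding total_degree_def
  by (rule sum.mono_neutral_left) (use assms in \<open>auto simp: in_keys_iff\<close>)

lemma total_degree_add: "total_degree (m + m') = total_degree m + total_degree m'"
proof -
  let ?A = "Poly_Mapping.keys m \<union> Poly_Mapping.keys m'"
  have "total_degree (m + m') = (\<Sum>i\<in>?A. Poly_Mapping.lookup (m + m') i)"
    by (rule total_degree_superset) (use keys_add[of m m'] in auto)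
  then show ?thesis
    by (simp add: total_degree_superset[of ?A m] total_degree_superset[of ?A m'] lookup_add sum.distrib)
qed

lemma homogeneous_iff:
  "homogeneous d p \<longleftrightarrow> (\<forall>m\<in>Poly_Mapping.keys p. int (total_degree m) = d)"
  by (simp add: homogeneous_def total_degree_def)

lemma homogeneous_0 [simp]: "homogeneous d 0"
  by (simp add: homogeneous_iff)

lemma homogeneous_single: "homogeneous (int (total_degree m)) (Poly_Mapping.single m c)"
  by (auto simp: homogeneous_iff)

lemma homogeneous_add: "homogeneous d p \<Longrightarrow> homogeneous d q \<Longrightarrow> homogeneous d (p + q)"
  using keys_add[of p q] by (auto simp: homogeneous_iff)

lemma homogeneous_sum: "(\<And>i. i \<in> A \<Longrightarrow> homogeneous d (f i)) \<Longrightarrow> homogeneous d (sum f A)"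
  by (induction A rule: infinite_finite_induct) (auto intro: homogeneous_add)

lemma homogeneous_mult:
  assumes "homogeneous d p" "homogeneous e q" shows "homogeneous (d + e) (p * q)"
  unfolding homogeneous_iff
proof
  fix m assume "m \<in> Poly_Mapping.keys (p * q)"
  then obtain a b where "m = a + b" "a \<in> Poly_Mapping.keys p" "b \<in> Poly_Mapping.keys q"
    using keys_mult[of p q] by blast
  then show "int (total_degree m) = d + e" using assms by (auto simp: homogeneous_iff total_degree_add)
qed

lemma homogeneous_Const: "homogeneous 0 (Const c)"
  using homogeneous_single[of 0 c] by (simp add: Const_def total_degree_def)

lemma homogeneous_1: "homogeneous 0 1"
  using homogeneous_Const[of 1] by (simp add: Const_1)

lemma homogeneous_Var: "homogeneous 1 (Var i)"
  using homogeneous_single[of "Poly_Mapping.single i 1" 1] by (simp add: Var_def total_degree_def)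

lemma homogeneous_pderivative:
  assumes "homogeneous d p" shows "homogeneous (d - 1) (pderivative i p)"
  unfolding pderivative_def
proof (rule homogeneous_sum)
  fix m assume m: "m \<in> Poly_Mapping.keys p"
  let ?c = "of_nat (Poly_Mapping.lookup m i) * Poly_Mapping.lookup p m"
  show "homogeneous (d - 1) (Poly_Mapping.single (m - Poly_Mapping.single i 1) ?c)"
  proof (cases "Poly_Mapping.lookup m i = 0")
    case False
    then have "m - Poly_Mapping.single i 1 + Poly_Mapping.single i 1 = m"
      using exponent_minus_add[of m i "Poly_Mapping.single i 1"] by simp
    then have "total_degree m = total_degree (m - Poly_Mapping.single i 1) + 1"
      using total_degree_add[of "m - Poly_Mapping.single i 1" "Poly_Mapping.single i 1"]
      by (simp add: total_degree_def[of "Poly_Mapping.single i (Suc 0)"])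
    then have "int (total_degree (m - Poly_Mapping.single i 1)) = d - 1"
      using assms m by (auto simp: homogeneous_iff)
    then show ?thesis
      using homogeneous_single[of "m - Poly_Mapping.single i 1" ?c] by simp
  qed simp
qed

lemma homogeneous_power: "homogeneous d p \<Longrightarrow> \<exists>e. homogeneous e (p ^ k)"
  by (induction k) (auto intro: homogeneous_1 homogeneous_mult)

lemma homogeneous_prod:
  "(\<And>i. i \<in> A \<Longrightarrow> \<exists>d. homogeneous d (f i)) \<Longrightarrow> \<exists>d. homogeneous d (prod f A)"
proof (induction A rule: infinite_finite_induct)
  case (insert x A)
  then obtain d e where "homogeneous d (f x)" "homogeneous e (prod f A)" by (metis insertCI)
  then have "homogeneous (d + e) (prod f (insert x A))" using insert.hyps homogeneous_mult by simp
  then show ?case ..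
qed (auto intro: homogeneous_1)

lemma homogeneous_poly_induct [consumes 1, case_names homogeneous add]:
  assumes "p \<in> polys n"
    and hom: "\<And>d q. \<lbrakk>q \<in> polys n; homogeneous d q\<rbrakk> \<Longrightarrow> P q"
    and add: "\<And>q r. \<lbrakk>q \<in> polys n; r \<in> polys n; P q; P r\<rbrakk> \<Longrightarrow> P (q + r)"
  shows "P p"
proof -
  have "p \<in> polys n \<and> P p"
  proof (induction p rule: mpoly_induct[where P = "\<lambda>q. q \<in> polys n \<and> P q"])
    case 1
    show ?case using hom[of 0] by simp
  next
    case (2 m)
    then have "Poly_Mapping.single m (Poly_Mapping.lookup p m) \<in> polys n"
      using assms(1) by (auto simp: polys_def)
    then show ?case using hom homogeneous_single by blast
  qed (use add in auto)
  then show ?thesis by blast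
qed

lemma polys_decompose:
  assumes "p \<in> polys n"
  shows "\<exists>L c. finite L \<and> (\<forall>d. c d \<in> polys n \<and> homogeneous d (c d)) \<and> (\<forall>d. d \<notin> L \<longrightarrow> c d = 0) \<and>
    p = (\<Sum>d\<in>L. c d)"
  using assms
proof (induction p rule: homogeneous_poly_induct)
  case (homogeneous d q)
  then show ?case by (intro exI[of _ "{d}"] exI[of _ "\<lambda>e. if e = d then q else 0"]) auto
next
  case (add q r)
  then obtain L c L' c' where
    c: "finite L" "\<forall>d. c d \<in> polys n \<and> homogeneous d (c d)" "\<forall>d. d \<notin> L \<longrightarrow> c d = 0" "q = (\<Sum>d\<in>L. c d)"
    and c': "finite L'" "\<forall>d. c' d \<in> polys n \<and> homogeneous d (c' d)" "\<forall>d. d \<notin> L' \<longrightarrow> c' d = 0" "r = (\<Sum>d\<in>L'. c' d)"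
    by blast
  have "q = (\<Sum>d\<in>L \<union> L'. c d)" unfolding c(4) by (rule sum.mono_neutral_left) (use c c' in auto)
  moreover have "r = (\<Sum>d\<in>L \<union> L'. c' d)" unfolding c'(4) by (rule sum.mono_neutral_left) (use c c' in auto)
  ultimately show ?case
    using c c' by (intro exI[of _ "L \<union> L'"] exI[of _ "\<lambda>d. c d + c' d"])
      (auto simp: sum.distrib intro: homogeneous_add)
qed

lemma of_nat_mult_single:
  "of_nat k * Poly_Mapping.single m c = Poly_Mapping.single m (of_nat k * c :: 'k::field)" for m :: "nat \<Rightarrow>\<^sub>0 nat"
proof -
  have "of_nat k * Poly_Mapping.single m c = Poly_Mapping.single 0 (of_nat k) * Poly_Mapping.single m c" by simp
  then show ?thesis by (simp only: mult_single add_0_left)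
qed

definition euler_poly :: "nat \<Rightarrow> 'k::field mpoly \<Rightarrow> 'k mpoly" where
  "euler_poly n p = (\<Sum>i<n. Var i * pderivative i p)"

lemma euler_poly_add: "euler_poly n (p + q) = euler_poly n p + euler_poly n q"
  by (simp add: euler_poly_def distrib_left sum.distrib)

lemma euler_poly_homogeneous:
  fixes p :: "'a::field mpoly"
  assumes "p \<in> polys n" "homogeneous d p"
  shows "euler_poly n p = of_int d * p"
proof -
  have single: "euler_poly n (Poly_Mapping.single m c) = of_nat (total_degree m) * Poly_Mapping.single m c"
    if m: "Poly_Mapping.keys m \<subseteq> {..<n}" for m and c :: 'a
  proof -
    have "Var i * pderivative i (Poly_Mapping.single m c) = of_nat (Poly_Mapping.lookup m i) * Poly_Mapping.single m c" for i
    proof (cases "Poly_Mapping.lookup m i = 0")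
      case False
      then have "Poly_Mapping.single i 1 + (m - Poly_Mapping.single i 1) = m"
        using exponent_minus_add[of m i "Poly_Mapping.single i 1"] by (simp add: add.commute)
      then show ?thesis
        by (simp add: Var_def pderivative_single mult_single of_nat_mult_single)
    qed (simp add: pderivative_single)
    then have "euler_poly n (Poly_Mapping.single m c) = (\<Sum>i<n. of_nat (Poly_Mapping.lookup m i)) * Poly_Mapping.single m c"
      by (simp add: euler_poly_def sum_distrib_right)
    also have "(\<Sum>i<n. of_nat (Poly_Mapping.lookup m i)) = (of_nat (total_degree m) :: 'a mpoly)"
      using total_degree_superset[OF _ m] by simp
    finally show ?thesis .
  qed
  have "euler_poly n (Poly_Mapping.single m (Poly_Mapping.lookup p m)) = of_int d * Poly_Mapping.single m (Poly_Mapping.lookup p m)"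
    if "m \<in> Poly_Mapping.keys p" for m
  proof -
    have "Poly_Mapping.keys m \<subseteq> {..<n}" "int (total_degree m) = d"
      using that assms by (auto simp: polys_def homogeneous_iff)
    then show ?thesis using single[of m "Poly_Mapping.lookup p m"] by auto
  qed
  then show ?thesis
  proof (rule mpoly_induct[rotated])
    show "euler_poly n (q + r) = of_int d * (q + r)"
      if "euler_poly n q = of_int d * q" "euler_poly n r = of_int d * r" for q r
      using that by (simp add: euler_poly_add distrib_left)
  qed (simp_all add: euler_poly_def)
qed

section \<open>Rational functions\<close>

text \<open>
  The quotient rule does not depend on the representation: differentiate \<open>a b' = a' b\<close> and multiply by
  \<open>b b'\<close>.
\<close>

lemma frac_derivative_Fract:
  assumes "b \<noteq> 0"
  shows "frac_derivative i (Fract a b) = Fract (pderivative i a * b - a * pderivative i b) (b * b)"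
  unfolding frac_derivative_def
proof (rule the_equality)
  show "\<exists>a' b'. b' \<noteq> 0 \<and> Fract a b = Fract a' b' \<and>
     Fract (pderivative i a * b - a * pderivative i b) (b * b) =
     Fract (pderivative i a' * b' - a' * pderivative i b') (b' * b')"
    using assms by blast
next
  fix y assume "\<exists>a' b'. b' \<noteq> 0 \<and> Fract a b = Fract a' b' \<and>
     y = Fract (pderivative i a' * b' - a' * pderivative i b') (b' * b')"
  then obtain a' b' where b': "b' \<noteq> 0" and eq: "a * b' = a' * b"
    and y: "y = Fract (pderivative i a' * b' - a' * pderivative i b') (b' * b')"
    using assms by (auto simp: eq_fract)
  let ?d = "pderivative i"
  have key: "?d a * b' = ?d a' * b + a' * ?d b - a * ?d b'"
    using arg_cong[OF eq, of ?d] by (simp add: pderivative_mult algebra_simps)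
  have "(?d a * b - a * ?d b) * (b' * b') = (?d a * b') * (b * b') - (a * b') * (?d b * b')"
    by (simp add: algebra_simps)
  also have "\<dots> = ?d a' * b * b * b' - (a * b') * (?d b' * b) + (a' * b - a * b') * (?d b * b')"
    unfolding key by (simp add: algebra_simps)
  also have "\<dots> = ?d a' * b * b * b' - (a * b') * (?d b' * b)" using eq by simp
  also have "\<dots> = (?d a' * b' - a' * ?d b') * (b * b)"
    unfolding eq by (simp add: algebra_simps)
  finally have "(?d a' * b' - a' * ?d b') * (b * b) = (?d a * b - a * ?d b) * (b' * b')" ..
  then show "y = Fract (pderivative i a * b - a * pderivative i b) (b * b)"
    unfolding y using assms b' by (simp add: eq_fract)
qed

lemma frac_derivative_add: "frac_derivative i (x + y) = frac_derivative i x + frac_derivative i y"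
proof -
  obtain a b where x: "x = Fract a b" "b \<noteq> 0" by (cases x)
  obtain c d where y: "y = Fract c d" "d \<noteq> 0" by (cases y)
  show ?thesis using x y
    by (simp add: frac_derivative_Fract pderivative_mult eq_fract algebra_simps)
qed

lemma frac_derivative_mult: "frac_derivative i (x * y) = frac_derivative i x * y + x * frac_derivative i y"
proof -
  obtain a b where x: "x = Fract a b" "b \<noteq> 0" by (cases x)
  obtain c d where y: "y = Fract c d" "d \<noteq> 0" by (cases y)
  show ?thesis using x y
    by (simp add: frac_derivative_Fract pderivative_mult eq_fract algebra_simps)
qed

lemma frac_derivative_to_frac: "frac_derivative i (Fract p 1) = Fract (pderivative i p) 1"
  by (simp add: frac_derivative_Fract)

lemma frac_derivative_0 [simp]: "frac_derivative i 0 = 0"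
  using frac_derivative_to_frac[of i 0] by (simp add: Zero_fract_def[symmetric])

lemma to_frac_add: "Fract (p + q) 1 = Fract p 1 + Fract q 1" for p :: "'a::idom" by simp
lemma to_frac_mult: "Fract (p * q) 1 = Fract p 1 * Fract q 1" for p :: "'a::idom" by simp
lemma to_frac_sum: "Fract (\<Sum>i\<in>A. f i) 1 = (\<Sum>i\<in>A. Fract (f i) 1)" for f :: "'b \<Rightarrow> 'a::idom"
  by (induction A rule: infinite_finite_induct) (auto simp: to_frac_add fract_collapse simp del: add_fract)

lemma to_frac_of_int: "Fract (of_int d) 1 = (of_int d :: 'a::idom fract)"
  by (cases d rule: int_cases2) (simp_all add: of_nat_fract)

lemma Fract_add_same: "Fract (a + b) c = Fract a c + Fract b c" for a :: "'a::idom"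
  by (cases "c = 0") (simp_all add: eq_fract algebra_simps Zero_fract_def[symmetric] fract_collapse)

lemma Fract_sum_same: "Fract (\<Sum>i\<in>A. f i) c = (\<Sum>i\<in>A. Fract (f i) c)" for f :: "'b \<Rightarrow> 'a::idom"
  by (induction A rule: infinite_finite_induct) (auto simp: Fract_add_same fract_collapse)

lemma fracsI: "a \<in> polys n \<Longrightarrow> b \<in> polys n \<Longrightarrow> b \<noteq> 0 \<Longrightarrow> Fract a b \<in> fracs n"
  by (auto simp: fracs_def)

lemma fracsE:
  assumes "v \<in> fracs n"
  obtains a b where "v = Fract a b" "a \<in> polys n" "b \<in> polys n" "b \<noteq> 0"
  using assms by (auto simp: fracs_def)

lemma fracs_to_frac [simp]: "p \<in> polys n \<Longrightarrow> Fract p 1 \<in> fracs n"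
  by (auto intro: fracsI)

lemma fracs_0 [simp]: "0 \<in> fracs n"
  using fracs_to_frac[of 0 n] by (simp add: Zero_fract_def)

lemma fracs_add [simp]: "v \<in> fracs n \<Longrightarrow> w \<in> fracs n \<Longrightarrow> v + w \<in> fracs n"
  by (elim fracsE) (simp, rule fracsI, auto)

lemma fracs_mult [simp]: "v \<in> fracs n \<Longrightarrow> w \<in> fracs n \<Longrightarrow> v * w \<in> fracs n"
  by (elim fracsE) (simp, rule fracsI, auto)

lemma fracs_uminus [simp]: "v \<in> fracs n \<Longrightarrow> - v \<in> fracs n"
  by (elim fracsE) (simp, rule fracsI, auto)

lemma fracs_diff [simp]: "v \<in> fracs n \<Longrightarrow> w \<in> fracs n \<Longrightarrow> v - w \<in> fracs n"
  using fracs_add[of v n "- w"] by simp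

lemma fracs_sum [simp]: "(\<And>i. i \<in> A \<Longrightarrow> f i \<in> fracs n) \<Longrightarrow> sum f A \<in> fracs n"
  by (induction A rule: infinite_finite_induct) auto

lemma fracs_frac_derivative [simp]: "v \<in> fracs n \<Longrightarrow> frac_derivative i v \<in> fracs n"
  by (elim fracsE) (simp add: frac_derivative_Fract fracsI)

lemma localization_fracs: "f \<in> polys n \<Longrightarrow> f \<noteq> 0 \<Longrightarrow> v \<in> localization n f \<Longrightarrow> v \<in> fracs n"
  by (auto simp: localization_def intro: fracsI)

lemma localizationI: "g \<in> polys n \<Longrightarrow> Fract g (f ^ k) \<in> localization n f"
  by (auto simp: localization_def)

lemma localization_0: "0 \<in> localization n f"
  using localizationI[of 0 n f 0] by (simp add: Zero_fract_def)

lemma localization_add: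
  assumes "f \<in> polys n" "f \<noteq> 0" "v \<in> localization n f" "w \<in> localization n f"
  shows "v + w \<in> localization n f"
proof -
  obtain g k h l where "v = Fract g (f ^ k)" "w = Fract h (f ^ l)" "g \<in> polys n" "h \<in> polys n"
    using assms by (auto simp: localization_def)
  then show ?thesis
    using assms localizationI[of "g * f ^ l + h * f ^ k" n f "k + l"] by (simp add: power_add)
qed

lemma localization_mult_poly:
  assumes "p \<in> polys n" "v \<in> localization n f" shows "Fract p 1 * v \<in> localization n f"
  using assms by (auto simp: localization_def) (metis polys_mult)

lemma localization_uminus: "v \<in> localization n f \<Longrightarrow> - v \<in> localization n f"
  by (auto simp: localization_def) (metis polys_uminus)

lemma localization_frac_derivative:
  assumes "f \<in> polys n" "f \<noteq> 0" "v \<in> localization n f"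
  shows "frac_derivative i v \<in> localization n f"
proof -
  obtain g k where "v = Fract g (f ^ k)" "g \<in> polys n"
    using assms by (auto simp: localization_def)
  then show ?thesis
    using assms localizationI[of "pderivative i g * f ^ k - g * pderivative i (f ^ k)" n f "k + k"]
    by (simp add: frac_derivative_Fract power_add)
qed

definition euler_frac :: "nat \<Rightarrow> 'k::field mpoly fract \<Rightarrow> 'k mpoly fract" where
  "euler_frac n v = (\<Sum>i<n. Fract (Var i) 1 * frac_derivative i v)"

lemma euler_frac_add: "euler_frac n (v + w) = euler_frac n v + euler_frac n w"
  by (simp add: euler_frac_def frac_derivative_add distrib_left sum.distrib)

lemma euler_frac_mult: "euler_frac n (v * w) = euler_frac n v * w + v * euler_frac n w"
  by (simp add: euler_frac_def frac_derivative_mult distrib_left sum.distrib sum_distrib_right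
      sum_distrib_left mult_ac)

lemma euler_frac_to_frac: "euler_frac n (Fract p 1) = Fract (euler_poly n p) 1"
  by (simp add: euler_frac_def euler_poly_def to_frac_sum frac_derivative_to_frac)

text \<open>
  Apply the derivation \<open>euler_frac n\<close> to \<open>h \<cdot> (g / h) = g\<close> and use Euler's formula for \<open>g\<close> and \<open>h\<close>.
\<close>

lemma euler_frac_homogeneous:
  assumes "g \<in> polys n" "homogeneous a g" "h \<in> polys n" "homogeneous b h" "h \<noteq> 0"
  shows "euler_frac n (Fract g h) = of_int (a - b) * Fract g h"
proof -
  let ?v = "Fract g h"
  have hv: "Fract h 1 * ?v = Fract g 1" using assms(5) by (simp add: eq_fract)
  have "of_int a * (Fract h 1 * ?v) = euler_frac n (Fract h 1 * ?v)"
    unfolding hv euler_frac_to_frac euler_poly_homogeneous[OF assms(1,2)] to_frac_mult to_frac_of_int ..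
  also have "\<dots> = of_int b * Fract h 1 * ?v + Fract h 1 * euler_frac n ?v"
    unfolding euler_frac_mult euler_frac_to_frac euler_poly_homogeneous[OF assms(3,4)] to_frac_mult to_frac_of_int ..
  finally have "Fract h 1 * euler_frac n ?v = Fract h 1 * (of_int (a - b) * ?v)"
    by (simp add: algebra_simps del: mult_fract)
  moreover have "Fract h 1 \<noteq> 0" using assms(5) by (simp add: Zero_fract_def eq_fract)
  ultimately show ?thesis using mult_left_cancel by blast
qed

lemma euler_frac_localization_comp:
  assumes "f \<in> polys n" "f \<noteq> 0" "v \<in> localization_comp n f l"
  shows "euler_frac n v = of_int l * v"
  using assms euler_frac_homogeneous[of _ n _ "f ^ _"] by (auto simp: localization_comp_def)

lemma localization_comp_subset: "localization_comp n f l \<subseteq> localization n f"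
  by (auto simp: localization_comp_def localization_def)

text \<open>
  A common denominator \<open>f\<^sup>k\<close> is fixed, and the numerator is split into homogeneous parts.
\<close>

lemma localization_decompose:
  assumes f: "homogeneous e f" and v: "v \<in> localization n f"
  shows "\<exists>L w. finite L \<and> (\<forall>l. w l \<in> localization_comp n f l) \<and> (\<forall>l. l \<notin> L \<longrightarrow> w l = 0) \<and> v = (\<Sum>l\<in>L. w l)"
proof -
  obtain g k where g: "v = Fract g (f ^ k)" "g \<in> polys n" using v by (auto simp: localization_def)
  obtain b where b: "homogeneous b (f ^ k)" using homogeneous_power[OF f] by blast
  obtain D c where c: "finite D" "\<And>d. c d \<in> polys n" "\<And>d. homogeneous d (c d)" "\<And>d. d \<notin> D \<Longrightarrow> c d = 0"
    "g = (\<Sum>d\<in>D. c d)"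
    using polys_decompose[OF g(2)] by blast
  let ?w = "\<lambda>l. Fract (c (l + b)) (f ^ k)"
  have "v = (\<Sum>d\<in>D. Fract (c d) (f ^ k))" unfolding g(1) c(5) Fract_sum_same ..
  also have "\<dots> = (\<Sum>l\<in>(\<lambda>d. d - b) ` D. ?w l)"
    by (subst sum.reindex) (auto simp: inj_on_def)
  finally have sum: "v = (\<Sum>l\<in>(\<lambda>d. d - b) ` D. ?w l)" .
  have "?w l \<in> localization_comp n f l" for l
    unfolding localization_comp_def
    using c(2,3)[of "l + b"] b by (intro CollectI exI[of _ "c (l + b)"] exI[of _ k] exI[of _ "l + b"] exI[of _ b]) simp
  moreover have "?w l = 0" if "l \<notin> (\<lambda>d. d - b) ` D" for l
  proof -
    have "l + b \<notin> D" using that by force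
    then show ?thesis using c(4) by (simp add: fract_collapse)
  qed
  ultimately show ?thesis using sum c(1) by (intro exI[of _ "(\<lambda>d. d - b) ` D"] exI[of _ ?w]) blast
qed

lemma of_int_fract_eq_0_iff: "of_int d = (0 :: 'k::field_char_0 mpoly fract) \<longleftrightarrow> d = 0"
proof -
  have "of_int d = (0 :: 'k mpoly fract) \<longleftrightarrow> Fract (of_int d) 1 = (Fract 0 1 :: 'k mpoly fract)"
    by (simp only: to_frac_of_int Zero_fract_def)
  also have "\<dots> \<longleftrightarrow> (of_int d :: 'k mpoly) = 0" by (simp add: eq_fract)
  finally show ?thesis by simp
qed

lemma euler_frac_0 [simp]: "euler_frac n 0 = 0"
  by (simp add: euler_frac_def)

lemma euler_frac_of_int_mult:
  fixes v :: "'k::field mpoly fract"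
  shows "euler_frac n (of_int d * v) = of_int d * euler_frac n v"
proof -
  have "euler_poly n (Const (of_int d) :: 'k mpoly) = 0"
    by (simp add: euler_poly_def)
  then have "euler_frac n (of_int d :: 'k mpoly fract) = 0"
    using euler_frac_to_frac[of n "Const (of_int d) :: 'k mpoly"]
    by (simp only: Const_of_int to_frac_of_int fract_collapse)
  then show ?thesis by (simp add: euler_frac_mult)
qed

text \<open>
  The usual elimination: applying \<open>euler_frac n - m\<close> removes the summand \<open>y m\<close> and multiplies the others by
  \<open>l - m\<close>, which is invertible in characteristic zero.
\<close>

lemma euler_eigenvectors_independent:
  fixes y :: "int \<Rightarrow> 'k::field_char_0 mpoly fract"
  assumes "finite L" "\<And>l. l \<in> L \<Longrightarrow> euler_frac n (y l) = of_int l * y l" "(\<Sum>l\<in>L. y l) = 0" "l \<in> L"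
  shows "y l = 0"
  using assms
proof (induction L arbitrary: y l rule: finite_induct)
  case (insert m L)
  have sum: "euler_frac n (\<Sum>l\<in>A. y l) = (\<Sum>l\<in>A. euler_frac n (y l))" if "finite A" for A
    using that by (induction A rule: finite_induct) (auto simp: euler_frac_add)
  have "0 = euler_frac n (\<Sum>l\<in>insert m L. y l) - of_int m * (\<Sum>l\<in>insert m L. y l)"
    using insert.prems(2) by simp
  also have "\<dots> = (\<Sum>l\<in>insert m L. of_int l * y l) - of_int m * (\<Sum>l\<in>insert m L. y l)"
    using sum[of "insert m L"] insert.prems(1) insert.hyps(1) by simp
  also have "\<dots> = (\<Sum>l\<in>L. of_int (l - m) * y l)"
    using insert.hyps by (simp add: algebra_simps sum_distrib_left sum_subtractf)
  finally have "(\<Sum>l\<in>L. of_int (l - m) * y l) = 0" by simp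
  moreover have "euler_frac n (of_int (l - m) * y l) = of_int l * (of_int (l - m) * y l)" if "l \<in> L" for l
    using insert.prems(1)[OF insertI2[OF that]] by (simp only: euler_frac_of_int_mult mult.left_commute)
  ultimately have "of_int (l - m) * y l = 0" if "l \<in> L" for l
    using insert.IH[of "\<lambda>l. of_int (l - m) * y l"] that by blast
  then have L: "y l = 0" if "l \<in> L" for l
    using that insert.hyps(2) of_int_fract_eq_0_iff[of "l - m", where 'k = 'k] by (metis eq_iff_diff_eq_0 mult_eq_0_iff)
  then have "y m = 0" using insert.prems(2) insert.hyps by simp
  then show ?case using L insert.prems(3) by auto
qed simp

section \<open>Extending differential operators to rational functions\<close>

lemma lin_End_simps [simp]:
  "D \<otimes>\<^bsub>lin_End V j\<^esub> D' = (\<lambda>v\<in>V. D (D' v))" "\<one>\<^bsub>lin_End V j\<^esub> = (\<lambda>v\<in>V. v)"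
  "\<zero>\<^bsub>lin_End V j\<^esub> = (\<lambda>v\<in>V. 0)" "D \<oplus>\<^bsub>lin_End V j\<^esub> D' = (\<lambda>v\<in>V. D v + D' v)"
  by (simp_all add: lin_End_def)

lemma lin_EndD:
  assumes "D \<in> carrier (lin_End V j)"
  shows "D \<in> V \<rightarrow>\<^sub>E V" "v \<in> V \<Longrightarrow> D v \<in> V" "\<lbrakk>v \<in> V; w \<in> V\<rbrakk> \<Longrightarrow> D (v + w) = D v + D w"
    "v \<in> V \<Longrightarrow> D (j (Const c) * v) = j (Const c) * D v"
  using assms by (auto simp: lin_End_def)

lemma lin_EndI:
  assumes "D \<in> V \<rightarrow>\<^sub>E V" "\<And>v w. \<lbrakk>v \<in> V; w \<in> V\<rbrakk> \<Longrightarrow> D (v + w) = D v + D w"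
    "\<And>c v. v \<in> V \<Longrightarrow> D (j (Const c) * v) = j (Const c) * D v"
  shows "D \<in> carrier (lin_End V j)"
  using assms by (auto simp: lin_End_def)

text \<open>
  The conditions under which \<open>lin_End V j\<close> is a ring, satisfied by polynomials and by fractions.
\<close>

locale scalar_stable =
  fixes V :: "'v::comm_ring_1 set" and j :: "'k::field mpoly \<Rightarrow> 'v"
  assumes zero: "0 \<in> V" and add: "\<And>v w. v \<in> V \<Longrightarrow> w \<in> V \<Longrightarrow> v + w \<in> V"
    and uminus: "\<And>v. v \<in> V \<Longrightarrow> - v \<in> V" and scale: "\<And>c v. v \<in> V \<Longrightarrow> j (Const c) * v \<in> V"
begin

lemma End_uminus:
  assumes "D \<in> carrier (lin_End V j)"
  shows "(\<lambda>v\<in>V. - D v) \<in> carrier (lin_End V j)"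
    "(\<lambda>v\<in>V. - D v) \<oplus>\<^bsub>lin_End V j\<^esub> D = \<zero>\<^bsub>lin_End V j\<^esub>"
  using lin_EndD[OF assms] by (auto intro!: lin_EndI simp: add uminus scale restrict_def fun_eq_iff)

lemma ring_End: "ring (lin_End V j)"
proof (rule ringI)
  show "abelian_group (lin_End V j)"
  proof (rule abelian_groupI)
    show "\<exists>D'\<in>carrier (lin_End V j). D' \<oplus>\<^bsub>lin_End V j\<^esub> D = \<zero>\<^bsub>lin_End V j\<^esub>"
      if "D \<in> carrier (lin_End V j)" for D
      using End_uminus[OF that] by blast
    show "\<zero>\<^bsub>lin_End V j\<^esub> \<oplus>\<^bsub>lin_End V j\<^esub> D = D" if "D \<in> carrier (lin_End V j)" for D
      using lin_EndD(1)[OF that] by (auto simp: fun_eq_iff PiE_def extensional_def)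
    show "D \<oplus>\<^bsub>lin_End V j\<^esub> D' \<in> carrier (lin_End V j)"
      if "D \<in> carrier (lin_End V j)" "D' \<in> carrier (lin_End V j)" for D D'
      using lin_EndD[OF that(1)] lin_EndD[OF that(2)]
      by (auto intro!: lin_EndI simp: add scale distrib_left add_ac)
    show "\<zero>\<^bsub>lin_End V j\<^esub> \<in> carrier (lin_End V j)"
      by (auto intro!: lin_EndI simp: zero add scale)
  qed (auto simp: fun_eq_iff algebra_simps)
  show "Group.monoid (lin_End V j)"
  proof (rule monoidI)
    show "\<one>\<^bsub>lin_End V j\<^esub> \<in> carrier (lin_End V j)" by (auto intro!: lin_EndI simp: add scale)
    show "D \<otimes>\<^bsub>lin_End V j\<^esub> D' \<in> carrier (lin_End V j)"
      if "D \<in> carrier (lin_End V j)" "D' \<in> carrier (lin_End V j)" for D D'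
      using lin_EndD[OF that(1)] lin_EndD[OF that(2)] by (auto intro!: lin_EndI simp: add scale)
    show "\<one>\<^bsub>lin_End V j\<^esub> \<otimes>\<^bsub>lin_End V j\<^esub> D = D" "D \<otimes>\<^bsub>lin_End V j\<^esub> \<one>\<^bsub>lin_End V j\<^esub> = D"
      if "D \<in> carrier (lin_End V j)" for D
      using lin_EndD(1)[OF that] by (auto simp: fun_eq_iff PiE_def extensional_def)
    show "D \<otimes>\<^bsub>lin_End V j\<^esub> D' \<otimes>\<^bsub>lin_End V j\<^esub> D'' = D \<otimes>\<^bsub>lin_End V j\<^esub> (D' \<otimes>\<^bsub>lin_End V j\<^esub> D'')"
      if "D'' \<in> carrier (lin_End V j)" for D D' D''
      using lin_EndD(2)[OF that] by (auto simp: fun_eq_iff)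
  qed
  fix D D' D'' assume "D \<in> carrier (lin_End V j)" "D' \<in> carrier (lin_End V j)" "D'' \<in> carrier (lin_End V j)"
  note D = lin_EndD[OF this(1)] lin_EndD[OF this(2)] lin_EndD[OF this(3)]
  show "(D \<oplus>\<^bsub>lin_End V j\<^esub> D') \<otimes>\<^bsub>lin_End V j\<^esub> D'' = D \<otimes>\<^bsub>lin_End V j\<^esub> D'' \<oplus>\<^bsub>lin_End V j\<^esub> D' \<otimes>\<^bsub>lin_End V j\<^esub> D''"
    "D'' \<otimes>\<^bsub>lin_End V j\<^esub> (D \<oplus>\<^bsub>lin_End V j\<^esub> D') = D'' \<otimes>\<^bsub>lin_End V j\<^esub> D \<oplus>\<^bsub>lin_End V j\<^esub> D'' \<otimes>\<^bsub>lin_End V j\<^esub> D'"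
    using D by (auto simp: fun_eq_iff)
qed

sublocale End: ring "lin_End V j" by (rule ring_End)

lemma End_a_inv:
  assumes "D \<in> carrier (lin_End V j)" shows "\<ominus>\<^bsub>lin_End V j\<^esub> D = (\<lambda>v\<in>V. - D v)"
  using End.minus_equality[OF End_uminus(2)[OF assms] assms End_uminus(1)[OF assms]] .

end

lemma polys_scalar_stable: "scalar_stable (polys n) (id :: 'k::field mpoly \<Rightarrow> _)"
  by unfold_locales auto

lemma fracs_scalar_stable: "scalar_stable (fracs n) (\<lambda>p::'k::field mpoly. Fract p 1)"
  by unfold_locales auto

lemma weyl_operators_polys_subset:
  "weyl_operators n (polys n) id pderivative \<subseteq> carrier (lin_End (polys n) (id :: 'k::field mpoly \<Rightarrow> _))"
proof -
  interpret scalar_stable "polys n" "id :: 'k mpoly \<Rightarrow> _" by (rule polys_scalar_stable)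
  show ?thesis
    unfolding weyl_operators_def
    by (rule End.generate_ring_incl)
      (auto intro!: lin_EndI simp: algebra_simps pderivative_mult)
qed

lemma weyl_operators_fracs_subset:
  "weyl_operators n (fracs n) (\<lambda>p. Fract p 1) frac_derivative \<subseteq>
    carrier (lin_End (fracs n) (\<lambda>p::'k::field mpoly. Fract p 1))"
proof -
  interpret scalar_stable "fracs n" "\<lambda>p::'k mpoly. Fract p 1" by (rule fracs_scalar_stable)
  show ?thesis
    unfolding weyl_operators_def
    by (rule End.generate_ring_incl)
      (auto intro!: lin_EndI simp: algebra_simps frac_derivative_mult frac_derivative_add
        frac_derivative_to_frac fract_collapse simp del: mult_fract)
qed

lemma weyl_operators_fracs_induct [consumes 1, case_names one const var deriv uminus add mult]:
  fixes n :: nat and D :: "'k::field mpoly fract \<Rightarrow> 'k mpoly fract"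
  defines "W \<equiv> weyl_operators n (fracs n) (\<lambda>p::'k mpoly. Fract p 1) frac_derivative"
  assumes "D \<in> W"
    and "P (\<lambda>v\<in>fracs n. v)"
    and "\<And>c. P (\<lambda>v\<in>fracs n. Fract (Const c) 1 * v)"
    and "\<And>i. i < n \<Longrightarrow> P (\<lambda>v\<in>fracs n. Fract (Var i) 1 * v)"
    and "\<And>i. i < n \<Longrightarrow> P (\<lambda>v\<in>fracs n. frac_derivative i v)"
    and "\<And>D. \<lbrakk>D \<in> W; P D\<rbrakk> \<Longrightarrow> P (\<lambda>v\<in>fracs n. - D v)"
    and "\<And>D D'. \<lbrakk>D \<in> W; P D; D' \<in> W; P D'\<rbrakk> \<Longrightarrow> P (\<lambda>v\<in>fracs n. D v + D' v)"
    and "\<And>D D'. \<lbrakk>D \<in> W; P D; D' \<in> W; P D'\<rbrakk> \<Longrightarrow> P (\<lambda>v\<in>fracs n. D (D' v))"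
  shows "P D"
proof -
  interpret scalar_stable "fracs n" "\<lambda>p::'k mpoly. Fract p 1" by (rule fracs_scalar_stable)
  have sub: "W \<subseteq> carrier (lin_End (fracs n) (\<lambda>p::'k mpoly. Fract p 1))"
    unfolding W_def by (rule weyl_operators_fracs_subset)
  show ?thesis
    using assms(2) unfolding W_def weyl_operators_def
  proof (induction D rule: generate_ring.induct)
    case (a_inv D)
    then have D: "D \<in> W" by (simp add: W_def weyl_operators_def)
    then have "D \<in> carrier (lin_End (fracs n) (\<lambda>p::'k mpoly. Fract p 1))" using sub by blast
    then show ?case using End_a_inv[of D] assms(7)[OF D] a_inv.IH by (simp only:)
  next
    case one
    show ?case unfolding lin_End_simps by (rule assms(3))
  next
    case (incl h)
    then consider (c) c where "h = (\<lambda>v\<in>fracs n. Fract (Const c) 1 * v)"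
      | (v) i where "i < n" "h = (\<lambda>v\<in>fracs n. Fract (Var i) 1 * v)"
      | (d) i where "i < n" "h = (\<lambda>v\<in>fracs n. frac_derivative i v)" by blast
    then show ?case by cases (simp_all only: assms(4-6))
  next
    case (eng_add D D')
    show ?case unfolding lin_End_simps
      by (rule assms(8)) (use eng_add in \<open>simp_all only: W_def weyl_operators_def\<close>)
  next
    case (eng_mult D D')
    show ?case unfolding lin_End_simps
      by (rule assms(9)) (use eng_mult in \<open>simp_all only: W_def weyl_operators_def\<close>)
  qed
qed

lemma weyl_operators_fracs_closed:
  fixes n :: nat and D D' :: "'k::field mpoly fract \<Rightarrow> 'k mpoly fract"
  defines "W \<equiv> weyl_operators n (fracs n) (\<lambda>p::'k mpoly. Fract p 1) frac_derivative"
  shows "(\<lambda>v\<in>fracs n. v) \<in> W" "(\<lambda>v\<in>fracs n. 0) \<in> W" "(\<lambda>v\<in>fracs n. Fract (Const c) 1 * v) \<in> W"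
    "i < n \<Longrightarrow> (\<lambda>v\<in>fracs n. Fract (Var i) 1 * v) \<in> W"
    "i < n \<Longrightarrow> (\<lambda>v\<in>fracs n. frac_derivative i v) \<in> W"
    "D \<in> W \<Longrightarrow> (\<lambda>v\<in>fracs n. - D v) \<in> W"
    "\<lbrakk>D \<in> W; D' \<in> W\<rbrakk> \<Longrightarrow> (\<lambda>v\<in>fracs n. D v + D' v) \<in> W"
    "\<lbrakk>D \<in> W; D' \<in> W\<rbrakk> \<Longrightarrow> (\<lambda>v\<in>fracs n. D (D' v)) \<in> W"
proof -
  interpret scalar_stable "fracs n" "\<lambda>p::'k mpoly. Fract p 1" by (rule fracs_scalar_stable)
  have sub: "W \<subseteq> carrier (lin_End (fracs n) (\<lambda>p::'k mpoly. Fract p 1))"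
    unfolding W_def by (rule weyl_operators_fracs_subset)
  show "(\<lambda>v\<in>fracs n. v) \<in> W"
    using generate_ring.one[of "lin_End (fracs n) (\<lambda>p::'k mpoly. Fract p 1)"]
    by (simp add: W_def weyl_operators_def)
  show "(\<lambda>v\<in>fracs n. 0) \<in> W"
    using End.zero_in_generate by (simp add: W_def weyl_operators_def)
  show "(\<lambda>v\<in>fracs n. Fract (Const c) 1 * v) \<in> W"
    "i < n \<Longrightarrow> (\<lambda>v\<in>fracs n. Fract (Var i) 1 * v) \<in> W"
    "i < n \<Longrightarrow> (\<lambda>v\<in>fracs n. frac_derivative i v) \<in> W"
    unfolding W_def weyl_operators_def by (auto intro!: generate_ring.incl)
  show "(\<lambda>v\<in>fracs n. - D v) \<in> W" if "D \<in> W"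
    using generate_ring.a_inv[of D] that End_a_inv[of D] sub
    unfolding W_def weyl_operators_def by fastforce
  show "(\<lambda>v\<in>fracs n. D v + D' v) \<in> W" if "D \<in> W" "D' \<in> W"
    using generate_ring.eng_add[OF that[unfolded W_def weyl_operators_def]]
    by (simp add: W_def weyl_operators_def)
  show "(\<lambda>v\<in>fracs n. D (D' v)) \<in> W" if "D \<in> W" "D' \<in> W"
    using generate_ring.eng_mult[OF that[unfolded W_def weyl_operators_def]]
    by (simp add: W_def weyl_operators_def)
qed

text \<open>
  Each generator \<open>c\<close>, \<open>X\<^sub>i\<close>, \<open>\<partial>\<^sub>i\<close> extends to fractions, and extending is compatible with the ring operations.
\<close>

lemma weyl_operator_extends:
  fixes D :: "'k::field mpoly \<Rightarrow> 'k mpoly"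
  assumes "D \<in> weyl_operators n (polys n) id pderivative"
  shows "\<exists>D'\<in>weyl_operators n (fracs n) (\<lambda>p. Fract p 1) frac_derivative.
    \<forall>p\<in>polys n. D' (Fract p 1) = Fract (D p) 1"
proof -
  interpret P: scalar_stable "polys n" "id :: 'k mpoly \<Rightarrow> _" by (rule polys_scalar_stable)
  let ?W = "weyl_operators n (fracs n) (\<lambda>p::'k mpoly. Fract p 1) frac_derivative"
  note W = weyl_operators_fracs_closed[where n = n and 'k = 'k]
  have sub: "generate_ring (lin_End (polys n) id)
     (range (\<lambda>c. \<lambda>v\<in>polys n. id (Const c) * v) \<union>
      (\<lambda>i. \<lambda>v\<in>polys n. id (Var i) * v) ` {..<n} \<union>
      (\<lambda>i. \<lambda>v\<in>polys n. pderivative i v) ` {..<n}) \<subseteq> carrier (lin_End (polys n) (id :: 'k mpoly \<Rightarrow> _))"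
    using weyl_operators_polys_subset unfolding weyl_operators_def .
  show ?thesis
    using assms unfolding weyl_operators_def[of n "polys n"]
  proof (induction D rule: generate_ring.induct)
    case one
    show ?case using W(1) by (intro bexI[of _ "\<lambda>v\<in>fracs n. v"]) auto
  next
    case (incl h)
    then consider (c) c where "h = (\<lambda>v\<in>polys n. Const c * v)"
      | (v) i where "i < n" "h = (\<lambda>v\<in>polys n. Var i * v)"
      | (d) i where "i < n" "h = (\<lambda>v\<in>polys n. pderivative i v)" by auto
    then show ?case
    proof cases
      case c
      then show ?thesis by (intro bexI[OF _ W(3)[of c]]) auto
    next
      case v
      then show ?thesis by (intro bexI[OF _ W(4)[OF v(1)]]) auto
    next
      case d
      then show ?thesis by (intro bexI[OF _ W(5)[OF d(1)]]) (auto simp: frac_derivative_to_frac)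
    qed
  next
    case (a_inv h)
    then obtain D' where "D' \<in> ?W" "\<forall>p\<in>polys n. D' (Fract p 1) = Fract (h p) 1" by blast
    then show ?case
      using P.End_a_inv[of h] sub a_inv.hyps by (intro bexI[OF _ W(6)[of D']]) auto
  next
    case (eng_add h1 h2)
    then obtain D1 D2 where "D1 \<in> ?W" "\<forall>p\<in>polys n. D1 (Fract p 1) = Fract (h1 p) 1"
       "D2 \<in> ?W" "\<forall>p\<in>polys n. D2 (Fract p 1) = Fract (h2 p) 1" by blast
    then show ?case by (intro bexI[OF _ W(7)[of D1 D2]]) auto
  next
    case (eng_mult h1 h2)
    then obtain D1 D2 where "D1 \<in> ?W" "\<forall>p\<in>polys n. D1 (Fract p 1) = Fract (h1 p) 1"
       "D2 \<in> ?W" "\<forall>p\<in>polys n. D2 (Fract p 1) = Fract (h2 p) 1" by blast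
    moreover have "h2 p \<in> polys n" if "p \<in> polys n" for p
      using eng_mult.hyps(2) sub lin_EndD(2) that by blast
    ultimately show ?case by (intro bexI[OF _ W(8)[of D1 D2]]) auto
  qed
qed

text \<open>
  Grothendieck's description of differential operators by iterated commutators with polynomials.  The
  index exceeds the usual order by one: index 0 is the zero operator and index 1 means linear over
  polynomials.  With this convention every recursion starts from the zero operator.
\<close>

primrec diff_order :: "nat \<Rightarrow> nat \<Rightarrow> ('k::field mpoly fract \<Rightarrow> 'k mpoly fract) \<Rightarrow> bool" where
  "diff_order n 0 D \<longleftrightarrow> (\<forall>v\<in>fracs n. D v = 0)"
| "diff_order n (Suc k) D \<longleftrightarrow> (\<forall>f\<in>polys n. diff_order n k (\<lambda>v. D (Fract f 1 * v) - Fract f 1 * D v))"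

lemma diff_order_cong:
  "(\<And>v. v \<in> fracs n \<Longrightarrow> D v = D' v) \<Longrightarrow> diff_order n k D \<Longrightarrow> diff_order n k D'"
proof (induction k arbitrary: D D')
  case (Suc k)
  show ?case unfolding diff_order.simps
  proof
    fix f :: "'a mpoly" assume f: "f \<in> polys n"
    show "diff_order n k (\<lambda>v. D' (Fract f 1 * v) - Fract f 1 * D' v)"
      by (rule Suc.IH[of "\<lambda>v. D (Fract f 1 * v) - Fract f 1 * D v"]) (use Suc.prems f in auto)
  qed
qed auto

lemma diff_order_zero: "(\<And>v. v \<in> fracs n \<Longrightarrow> D v = 0) \<Longrightarrow> diff_order n k D"
  by (induction k arbitrary: D) auto

lemma diff_order_Suc: "diff_order n k D \<Longrightarrow> diff_order n (Suc k) D"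
proof (induction k arbitrary: D)
  case 0
  then show ?case by simp
next
  case (Suc k)
  show ?case unfolding diff_order.simps(2)[of n "Suc k"]
  proof
    fix f :: "'a mpoly" assume "f \<in> polys n"
    then show "diff_order n (Suc k) (\<lambda>v. D (Fract f 1 * v) - Fract f 1 * D v)"
      using Suc.prems by (intro Suc.IH) simp
  qed
qed

lemma diff_order_mono: "diff_order n k D \<Longrightarrow> diff_order n (k + l) D"
  by (induction l) (auto intro: diff_order_Suc simp del: diff_order.simps)

lemma diff_order_uminus: "diff_order n k D \<Longrightarrow> diff_order n k (\<lambda>v. - D v)"
proof (induction k arbitrary: D)
  case (Suc k)
  show ?case unfolding diff_order.simps
  proof
    fix f :: "'a mpoly" assume "f \<in> polys n"
    then have "diff_order n k (\<lambda>v. - (D (Fract f 1 * v) - Fract f 1 * D v))"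
      using Suc.prems by (intro Suc.IH) simp
    moreover have "(\<lambda>v. - (D (Fract f 1 * v) - Fract f 1 * D v)) =
        (\<lambda>v. - D (Fract f 1 * v) - Fract f 1 * - D v)" by (simp add: fun_eq_iff)
    ultimately show "diff_order n k (\<lambda>v. - D (Fract f 1 * v) - Fract f 1 * - D v)" by (simp only:)
  qed
qed simp

lemma diff_order_add:
  "diff_order n k D \<Longrightarrow> diff_order n k D' \<Longrightarrow> diff_order n k (\<lambda>v. D v + D' v)"
proof (induction k arbitrary: D D')
  case (Suc k)
  show ?case unfolding diff_order.simps
  proof
    fix f :: "'a mpoly" assume "f \<in> polys n"
    then have "diff_order n k (\<lambda>v. (D (Fract f 1 * v) - Fract f 1 * D v) + (D' (Fract f 1 * v) - Fract f 1 * D' v))"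
      using Suc by simp
    moreover have "(\<lambda>v. (D (Fract f 1 * v) - Fract f 1 * D v) + (D' (Fract f 1 * v) - Fract f 1 * D' v)) =
        (\<lambda>v. (D (Fract f 1 * v) + D' (Fract f 1 * v)) - Fract f 1 * (D v + D' v))"
      by (simp add: fun_eq_iff algebra_simps)
    ultimately show "diff_order n k (\<lambda>v. (D (Fract f 1 * v) + D' (Fract f 1 * v)) - Fract f 1 * (D v + D' v))"
      by (simp only:)
  qed
qed simp

text \<open>
  By the identity \<open>[D D', f] = D [D', f] + [D, f] D'\<close>.
\<close>

lemma diff_order_comp:
  fixes D D' :: "'k::field mpoly fract \<Rightarrow> 'k mpoly fract"
  assumes "diff_order n k D" "diff_order n l D'"
    and "\<And>v. v \<in> fracs n \<Longrightarrow> D' v \<in> fracs n"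
    and "\<And>v w. \<lbrakk>v \<in> fracs n; w \<in> fracs n\<rbrakk> \<Longrightarrow> D (v + w) = D v + D w"
  shows "diff_order n (k + l) (\<lambda>v. D (D' v))"
  using assms
proof (induction "k + l" arbitrary: k l D D')
  case 0
  then show ?case by simp
next
  case (Suc s)
  note closed = Suc.prems(3) and additive = Suc.prems(4)
  show ?case
  proof (cases "k = 0 \<or> l = 0")
    case True
    have "D 0 + D 0 = D 0 + 0" using additive[of 0 0] by simp
    then have "D 0 = 0" by (rule add_left_imp_eq)
    then have "D (D' v) = 0" if "v \<in> fracs n" for v
      using True Suc.prems(1,2) closed that by auto
    then show ?thesis by (rule diff_order_zero)
  next
    case False
    then obtain k' l' where kl: "k = Suc k'" "l = Suc l'" by (meson not0_implies_Suc)
    have "diff_order n s (\<lambda>v. D (D' (Fract f 1 * v)) - Fract f 1 * D (D' v))" if f: "f \<in> polys n" for f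
    proof -
      let ?E = "\<lambda>v. D (Fract f 1 * v) - Fract f 1 * D v" and ?E' = "\<lambda>v. D' (Fract f 1 * v) - Fract f 1 * D' v"
      have "diff_order n (k + l') (\<lambda>v. D (?E' v))"
        using Suc.prems f closed additive kl Suc.hyps(2) by (intro Suc.hyps(1)) auto
      moreover have "diff_order n (k' + l) (\<lambda>v. ?E (D' v))"
        using Suc.prems f closed additive kl Suc.hyps(2)
        by (intro Suc.hyps(1)) (auto simp: distrib_left algebra_simps simp del: mult_fract)
      moreover have "k + l' = s" "k' + l = s" using kl Suc.hyps(2) by auto
      ultimately have "diff_order n s (\<lambda>v. D (?E' v) + ?E (D' v))" by (intro diff_order_add) auto
      then show ?thesis
      proof (rule diff_order_cong[rotated])
        fix v :: "'k mpoly fract" assume v: "v \<in> fracs n"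
        have "D' (Fract f 1 * v) = ?E' v + Fract f 1 * D' v" by simp
        then have "D (D' (Fract f 1 * v)) = D (?E' v) + D (Fract f 1 * D' v)"
          using additive[of "?E' v" "Fract f 1 * D' v"] closed v f by simp
        then show "D (?E' v) + ?E (D' v) = D (D' (Fract f 1 * v)) - Fract f 1 * D (D' v)" by simp
      qed
    qed
    then show ?thesis using Suc.hyps(2) by (simp flip: Suc.hyps(2))
  qed
qed

lemma diff_order_mult: "diff_order n 1 (\<lambda>v. w * v)"
  by (simp add: mult.left_commute)

lemma diff_order_frac_derivative: "diff_order n 2 (frac_derivative i)"
  unfolding numeral_2_eq_2 diff_order.simps(2)[of n "Suc 0"]
proof
  fix f :: "'a mpoly" assume "f \<in> polys n"
  show "diff_order n (Suc 0) (\<lambda>v. frac_derivative i (Fract f 1 * v) - Fract f 1 * frac_derivative i v)"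
    by (rule diff_order_cong[OF _ diff_order_mult[of n "frac_derivative i (Fract f 1)", unfolded One_nat_def]])
      (simp add: frac_derivative_mult)
qed

lemma weyl_operator_diff_order:
  fixes D :: "'k::field mpoly fract \<Rightarrow> 'k mpoly fract"
  assumes "D \<in> weyl_operators n (fracs n) (\<lambda>p. Fract p 1) frac_derivative"
  shows "\<exists>k. diff_order n k D"
  using assms
proof (induction D rule: weyl_operators_fracs_induct)
  case one
  show ?case by (rule exI, rule diff_order_cong[OF _ diff_order_mult[of n 1]]) auto
next
  case (const c)
  show ?case by (rule exI, rule diff_order_cong[OF _ diff_order_mult]) auto
next
  case (var i)
  show ?case by (rule exI, rule diff_order_cong[OF _ diff_order_mult]) auto
next
  case (deriv i)
  show ?case by (rule exI, rule diff_order_cong[OF _ diff_order_frac_derivative]) auto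
next
  case (uminus D)
  then obtain k where "diff_order n k D" by blast
  show ?case by (rule exI, rule diff_order_cong[OF _ diff_order_uminus[OF \<open>diff_order n k D\<close>]]) auto
next
  case (add D D')
  then obtain k l where "diff_order n k D" "diff_order n l D'" by blast
  then have "diff_order n (k + l) D" "diff_order n (k + l) D'"
    using diff_order_mono[of n k D l] diff_order_mono[of n l D' k] by (auto simp: add.commute)
  note sum = diff_order_add[OF this]
  show ?case by (rule exI, rule diff_order_cong[OF _ sum]) auto
next
  case (mult D D')
  then obtain k l where "diff_order n k D" "diff_order n l D'" by blast
  moreover have "D \<in> carrier (lin_End (fracs n) (\<lambda>p::'k mpoly. Fract p 1))"
    "D' \<in> carrier (lin_End (fracs n) (\<lambda>p::'k mpoly. Fract p 1))"
    using mult.hyps weyl_operators_fracs_subset by blast+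
  ultimately have comp: "diff_order n (k + l) (\<lambda>v. D (D' v))"
    by (intro diff_order_comp) (auto dest: lin_EndD)
  show ?case by (rule exI, rule diff_order_cong[OF _ comp]) auto
qed

text \<open>
  By induction the commutator of \<open>D\<close> with the denominator \<open>b\<close> vanishes on fractions, so
  \<open>b D(a / b) = D(a) = 0\<close>.  This makes a differential operator on fractions determined by its restriction to
  polynomials.
\<close>

lemma diff_order_vanish:
  assumes "diff_order n k D" "\<And>p. p \<in> polys n \<Longrightarrow> D (Fract p 1) = 0" "v \<in> fracs n"
  shows "D v = 0"
  using assms
proof (induction k arbitrary: D v)
  case (Suc k)
  obtain a b where v: "v = Fract a b" "a \<in> polys n" "b \<in> polys n" "b \<noteq> 0"
    using Suc.prems(3) by (rule fracsE)
  have "D (Fract b 1 * v) - Fract b 1 * D v = 0"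
  proof (rule Suc.IH[of "\<lambda>v. D (Fract b 1 * v) - Fract b 1 * D v"])
    show "diff_order n k (\<lambda>v. D (Fract b 1 * v) - Fract b 1 * D v)" using Suc.prems(1) v(3) by simp
    show "D (Fract b 1 * Fract p 1) - Fract b 1 * D (Fract p 1) = 0" if "p \<in> polys n" for p
      using Suc.prems(2) that v(3) by simp
  qed fact
  moreover have "Fract b 1 * v = Fract a 1" using v by (simp add: eq_fract)
  ultimately have "Fract b 1 * D v = 0" using Suc.prems(2) v(2) by simp
  moreover have "Fract b 1 \<noteq> 0" using v(4) by (simp add: Zero_fract_def eq_fract)
  ultimately show ?case by simp
qed simp

lemma weyl_operators_fracs_eqI:
  fixes D D' :: "'k::field mpoly fract \<Rightarrow> 'k mpoly fract"
  assumes "D \<in> weyl_operators n (fracs n) (\<lambda>p. Fract p 1) frac_derivative"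
    "D' \<in> weyl_operators n (fracs n) (\<lambda>p. Fract p 1) frac_derivative"
    "\<And>p. p \<in> polys n \<Longrightarrow> D (Fract p 1) = D' (Fract p 1)"
  shows "D = D'"
proof -
  let ?d = "\<lambda>v\<in>fracs n. D v + (\<lambda>v\<in>fracs n. - D' v) v"
  have "?d \<in> weyl_operators n (fracs n) (\<lambda>p. Fract p 1) frac_derivative"
    by (intro weyl_operators_fracs_closed assms)
  then obtain k where "diff_order n k ?d" using weyl_operator_diff_order by blast
  then have "?d v = 0" if "v \<in> fracs n" for v
    by (rule diff_order_vanish) (use assms(3) that in auto)
  then have "D v = D' v" if "v \<in> fracs n" for v using that by fastforce
  moreover have "D \<in> fracs n \<rightarrow>\<^sub>E fracs n" "D' \<in> fracs n \<rightarrow>\<^sub>E fracs n"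
    using assms weyl_operators_fracs_subset lin_EndD(1) by blast+
  ultimately show ?thesis by (intro PiE_ext) auto
qed

text \<open>
  Existence and uniqueness of the extension turn the description operator in \<open>weyl_extension\<close> into a
  usable characterization.
\<close>

lemma weyl_extension:
  fixes D :: "'k::field mpoly \<Rightarrow> 'k mpoly"
  assumes "D \<in> weyl_operators n (polys n) id pderivative"
  shows "weyl_extension n D \<in> weyl_operators n (fracs n) (\<lambda>p. Fract p 1) frac_derivative"
    and "\<lbrakk>D' \<in> weyl_operators n (fracs n) (\<lambda>p. Fract p 1) frac_derivative;
      \<And>p. p \<in> polys n \<Longrightarrow> D' (Fract p 1) = Fract (D p) 1\<rbrakk> \<Longrightarrow> weyl_extension n D = D'"
proof -
  let ?P = "\<lambda>D'. D' \<in> weyl_operators n (fracs n) (\<lambda>p. Fract p 1) frac_derivative \<and>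
    (\<forall>p\<in>polys n. D' (Fract p 1) = Fract (D p) 1)"
  have uniq: "D1 = D2" if "?P D1" "?P D2" for D1 D2
    by (rule weyl_operators_fracs_eqI) (use that in auto)
  obtain D0 where D0: "?P D0" using weyl_operator_extends[OF assms] by blast
  have "?P (weyl_extension n D)"
    unfolding weyl_extension_def by (rule theI[of ?P, OF D0]) (rule uniq[OF _ D0])
  then show "weyl_extension n D \<in> weyl_operators n (fracs n) (\<lambda>p. Fract p 1) frac_derivative"
    and "\<lbrakk>D' \<in> weyl_operators n (fracs n) (\<lambda>p. Fract p 1) frac_derivative;
      \<And>p. p \<in> polys n \<Longrightarrow> D' (Fract p 1) = Fract (D p) 1\<rbrakk> \<Longrightarrow> weyl_extension n D = D'"
    using uniq[of "weyl_extension n D" D'] by blast+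
qed

lemma weyl_operator_localization:
  fixes D :: "'k::field mpoly fract \<Rightarrow> 'k mpoly fract"
  assumes "D \<in> weyl_operators n (fracs n) (\<lambda>p. Fract p 1) frac_derivative"
    and f: "f \<in> polys n" "f \<noteq> 0" and v: "v \<in> localization n f"
  shows "D v \<in> localization n f"
proof -
  note fr = localization_fracs[OF f]
  have "\<forall>v\<in>localization n f. D v \<in> localization n f"
    using assms(1)
    by (induction D rule: weyl_operators_fracs_induct)
      (use f in \<open>auto simp: fr intro: localization_add localization_uminus localization_mult_poly localization_frac_derivative\<close>)
  then show ?thesis using v by blast
qed

section \<open>The Euler operator in the Weyl algebra\<close>

lemma weyl_algebra_simps [simp]:
  "carrier (weyl_algebra n) = weyl_operators n (polys n) id pderivative"
  "D \<otimes>\<^bsub>weyl_algebra n\<^esub> D' = (\<lambda>p\<in>polys n. D (D' p))" "\<one>\<^bsub>weyl_algebra n\<^esub> = (\<lambda>p\<in>polys n. p)"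
  "\<zero>\<^bsub>weyl_algebra n\<^esub> = (\<lambda>p\<in>polys n. 0)" "D \<oplus>\<^bsub>weyl_algebra n\<^esub> D' = (\<lambda>p\<in>polys n. D p + D' p)"
  "gcomp (weyl_algebra n) d = {D. weyl_degree n d D}"
  by (simp_all add: weyl_algebra_def)

lemma weyl_degree_homogeneous:
  assumes "weyl_degree n d D" "p \<in> polys n" "homogeneous a p"
  shows "D p \<in> polys n \<and> homogeneous (a + d) (D p)"
  using assms
proof (induction arbitrary: p a)
  case (const c)
  then show ?case using homogeneous_mult[OF homogeneous_Const, of a p c] by simp
next
  case (var i)
  then show ?case using homogeneous_mult[OF homogeneous_Var, of a p i] by (simp add: add.commute)
next
  case (deriv i)
  then show ?case using homogeneous_pderivative[of a p i] by simp
next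
  case (add d D D')
  then show ?case by (auto intro: homogeneous_add)
next
  case (mult d D e D')
  then have "D' p \<in> polys n" "homogeneous (a + e) (D' p)" by blast+
  then have "D (D' p) \<in> polys n \<and> homogeneous (a + e + d) (D (D' p))" by (rule mult.IH(1))
  then show ?case using mult.prems by (simp add: algebra_simps)
qed auto

definition euler_weyl :: "nat \<Rightarrow> 'k::field mpoly \<Rightarrow> 'k mpoly" where
  "euler_weyl n = (\<lambda>p\<in>polys n. euler_poly n p)"

lemma weyl_degree_euler: "weyl_degree n 0 (euler_weyl n)"
proof -
  have "m \<le> n \<Longrightarrow> weyl_degree n 0 (\<lambda>p\<in>polys n. \<Sum>i<m. Var i * pderivative i p)" for m
  proof (induction m)
    case 0
    show ?case unfolding lessThan_0 sum.empty by (rule weyl_degree.zero)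
  next
    case (Suc m)
    have "weyl_degree n (1 + - 1) (\<lambda>p\<in>polys n. (\<lambda>p\<in>polys n. Var m * p) ((\<lambda>p\<in>polys n. pderivative m p) p))"
      by (intro weyl_degree.mult weyl_degree.var weyl_degree.deriv) (use Suc.prems in auto)
    then have "weyl_degree n 0 (\<lambda>p\<in>polys n. (\<lambda>p\<in>polys n. Var m * p) ((\<lambda>p\<in>polys n. pderivative m p) p))"
      by (simp only: add.right_inverse)
    note sum = weyl_degree.add[OF Suc.IH[OF Suc_leD[OF Suc.prems]] this]
    show ?case by (rule back_subst[of "weyl_degree n 0", OF sum]) (auto simp: fun_eq_iff)
  qed
  from this[OF le_refl] show ?thesis by (simp only: euler_weyl_def euler_poly_def)
qed

text \<open>
  An operator \<open>a\<close> of degree \<open>d\<close> maps homogeneous polynomials of degree \<open>e\<close> to degree \<open>e + d\<close>, and the Euler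
  operator multiplies by the degree on both sides; so the commutator is multiplication by
  \<open>(e + d) - e = d\<close> whatever \<open>e\<close> is.
\<close>

lemma weyl_euler_graded_ring:
  assumes "Z_graded_ring (weyl_algebra n :: ('k::field_char_0 mpoly \<Rightarrow> 'k mpoly) graded_ring)"
  shows "euler_graded_ring (weyl_algebra n) (weyl_const n :: 'k \<Rightarrow> _) (euler_weyl n)"
proof -
  interpret Z_graded_ring "weyl_algebra n :: ('k mpoly \<Rightarrow> 'k mpoly) graded_ring" by fact
  interpret SD: direct_sum_decomposition "weyl_algebra n :: ('k mpoly \<Rightarrow> 'k mpoly) graded_ring" "gcomp (weyl_algebra n)"
    by (rule gcomp_decomposition)
  have sub: "carrier (weyl_algebra n) \<subseteq> carrier (lin_End (polys n) (id :: 'k mpoly \<Rightarrow> _))"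
    using weyl_operators_polys_subset by simp
  show ?thesis
  proof
    fix c c' :: 'k and a :: "'k mpoly \<Rightarrow> 'k mpoly" and d
    show "weyl_const n c \<in> gcomp (weyl_algebra n) 0"
      using weyl_degree.const by (simp add: weyl_const_def)
    show "weyl_const n (c + c') = weyl_const n c \<oplus>\<^bsub>weyl_algebra n\<^esub> weyl_const n c'"
      "weyl_const n (c * c') = weyl_const n c \<otimes>\<^bsub>weyl_algebra n\<^esub> weyl_const n c'"
      "weyl_const n (1::'k) = \<one>\<^bsub>weyl_algebra n\<^esub>"
      by (auto simp: weyl_const_def fun_eq_iff Const_add Const_mult Const_1 algebra_simps)
    show "weyl_const n c \<otimes>\<^bsub>weyl_algebra n\<^esub> a = a \<otimes>\<^bsub>weyl_algebra n\<^esub> weyl_const n c"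
      if "a \<in> carrier (weyl_algebra n)"
    proof -
      have "a \<in> carrier (lin_End (polys n) id)" using that sub by blast
      from lin_EndD(2,4)[OF this] show ?thesis by (auto simp: weyl_const_def fun_eq_iff)
    qed
    show "euler_weyl n \<in> gcomp (weyl_algebra n) 0" using weyl_degree_euler by simp
    show "euler_weyl n \<otimes>\<^bsub>weyl_algebra n\<^esub> a =
        a \<otimes>\<^bsub>weyl_algebra n\<^esub> euler_weyl n \<oplus>\<^bsub>weyl_algebra n\<^esub> weyl_const n (of_int d) \<otimes>\<^bsub>weyl_algebra n\<^esub> a"
      if a: "a \<in> gcomp (weyl_algebra n) d"
    proof -
      have "a \<in> carrier (lin_End (polys n) id)" using SD.in_carrier[OF a] sub by blast
      note aD = lin_EndD[OF this]
      have deg: "weyl_degree n d a" using a by simp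
      have ep: "euler_poly n p \<in> polys n" if "p \<in> polys n" for p :: "'k mpoly"
        using that unfolding euler_poly_def by (intro polys_sum polys_mult polys_Var polys_pderivative) auto
      have "euler_poly n (a p) = a (euler_poly n p) + of_int d * a p" if "p \<in> polys n" for p
        using that
      proof (induction p rule: homogeneous_poly_induct)
        case (homogeneous e q)
        have "euler_poly n (a q) = of_int (e + d) * a q"
          using weyl_degree_homogeneous[OF deg homogeneous] by (intro euler_poly_homogeneous) auto
        moreover have "a (euler_poly n q) = of_int e * a q"
          using euler_poly_homogeneous[OF homogeneous] aD(4)[OF homogeneous(1), of "of_int e"]
          by (simp add: Const_of_int)
        ultimately show ?case by (simp add: distrib_right)
      next
        case (add q r)
        then show ?case using aD(3) ep by (simp add: euler_poly_add distrib_left)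
      qed
      then show ?thesis
        using aD(2) ep by (auto simp: fun_eq_iff euler_weyl_def weyl_const_def Const_of_int)
    qed
  qed
qed

lemma weyl_extension_euler:
  fixes k :: int
  assumes "Z_graded_ring (weyl_algebra n :: ('k::field_char_0 mpoly \<Rightarrow> 'k mpoly) graded_ring)"
    and v: "(v :: 'k mpoly fract) \<in> fracs n"
  shows "weyl_extension n (euler_graded_ring.euler_shift (weyl_algebra n) (weyl_const n) (euler_weyl n) k) v =
    euler_frac n v - of_int k * v"
proof -
  interpret euler_graded_ring "weyl_algebra n" "weyl_const n :: 'k \<Rightarrow> _" "euler_weyl n"
    by (rule weyl_euler_graded_ring) fact
  note W = weyl_operators_fracs_closed[where n = n and 'k = 'k]
  let ?W = "weyl_operators n (fracs n) (\<lambda>p::'k mpoly. Fract p 1) frac_derivative"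
  have "m \<le> n \<Longrightarrow> (\<lambda>v\<in>fracs n. \<Sum>i<m. Fract (Var i) 1 * frac_derivative i v) \<in> ?W" for m
  proof (induction m)
    case 0
    show ?case unfolding lessThan_0 sum.empty by (rule W(2))
  next
    case (Suc m)
    have m: "m < n" using Suc.prems by simp
    note sum = W(7)[OF Suc.IH[OF Suc_leD[OF Suc.prems]] W(8)[OF W(4)[OF m] W(5)[OF m]]]
    show ?case by (rule back_subst[of "\<lambda>D. D \<in> ?W", OF sum]) (auto simp: fun_eq_iff)
  qed
  from this[OF le_refl] have "(\<lambda>v\<in>fracs n. euler_frac n v) \<in> ?W" by (simp only: euler_frac_def)
  note sum = W(7)[OF this W(3)[of "of_int (- k)"]]
  have mem: "(\<lambda>v\<in>fracs n. euler_frac n v + Fract (Const (of_int (- k))) 1 * v) \<in> ?W"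
    by (rule back_subst[of "\<lambda>D. D \<in> ?W", OF sum]) (auto simp: fun_eq_iff)
  have "weyl_extension n (euler_shift k) = (\<lambda>v\<in>fracs n. euler_frac n v + Fract (Const (of_int (- k))) 1 * v)"
  proof (rule weyl_extension(2)[OF _ mem])
    show "euler_shift k \<in> weyl_operators n (polys n) id pderivative" using euler_shift_closed by simp
    show "(\<lambda>v\<in>fracs n. euler_frac n v + Fract (Const (of_int (- k))) 1 * v) (Fract p 1) = Fract (euler_shift k p) 1"
      if "p \<in> polys n" for p
      using that unfolding euler_shift_def by (simp add: euler_weyl_def weyl_const_def euler_frac_to_frac)
  qed
  moreover have "Fract (Const (of_int (- k))) 1 = (- of_int k :: 'k mpoly fract)"
    unfolding Const_of_int to_frac_of_int by simp
  ultimately show ?thesis using v by simp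
qed

section \<open>Local cohomology modules are Eulerian\<close>

context euler_graded_ring begin

text \<open>
  For Cech cocycles \<open>Z\<close> modulo coboundaries \<open>B\<close>.  As \<open>B\<close> is closed under the operations, these can be computed on
  representatives of cosets, and closure, span and annihilation by \<open>\<eta> - k\<close> pass to the quotient.
\<close>

lemma eulerian_quotient:
  fixes Z :: "('s, 'm) graded_module"
  assumes assoc: "\<And>x y z. (x \<oplus>\<^bsub>Z\<^esub> y) \<oplus>\<^bsub>Z\<^esub> z = x \<oplus>\<^bsub>Z\<^esub> (y \<oplus>\<^bsub>Z\<^esub> z)" and comm: "\<And>x y. x \<oplus>\<^bsub>Z\<^esub> y = y \<oplus>\<^bsub>Z\<^esub> x"
    and l_zero: "\<And>x. \<zero>\<^bsub>Z\<^esub> \<oplus>\<^bsub>Z\<^esub> x = x"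
    and B: "\<zero>\<^bsub>Z\<^esub> \<in> B" "\<And>b b'. \<lbrakk>b \<in> B; b' \<in> B\<rbrakk> \<Longrightarrow> b \<oplus>\<^bsub>Z\<^esub> b' \<in> B"
      "\<And>a b. \<lbrakk>a \<in> carrier S; b \<in> B\<rbrakk> \<Longrightarrow> a \<odot>\<^bsub>Z\<^esub> b \<in> B"
    and smult: "\<And>a. a \<in> carrier S \<Longrightarrow> a \<odot>\<^bsub>Z\<^esub> \<zero>\<^bsub>Z\<^esub> = \<zero>\<^bsub>Z\<^esub>"
      "\<And>a b x. \<lbrakk>a \<in> carrier S; b \<in> B; x \<in> carrier Z\<rbrakk> \<Longrightarrow> a \<odot>\<^bsub>Z\<^esub> (b \<oplus>\<^bsub>Z\<^esub> x) = a \<odot>\<^bsub>Z\<^esub> b \<oplus>\<^bsub>Z\<^esub> a \<odot>\<^bsub>Z\<^esub> x"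
    and Z: "\<zero>\<^bsub>Z\<^esub> \<in> carrier Z" "\<And>x y. \<lbrakk>x \<in> carrier Z; y \<in> carrier Z\<rbrakk> \<Longrightarrow> x \<oplus>\<^bsub>Z\<^esub> y \<in> carrier Z"
      "\<And>a x. \<lbrakk>a \<in> carrier S; x \<in> carrier Z\<rbrakk> \<Longrightarrow> a \<odot>\<^bsub>Z\<^esub> x \<in> carrier Z"
      "\<And>k. hcomp Z k \<subseteq> carrier Z" "carrier Z \<subseteq> homogeneous_span Z"
      "\<And>k x. x \<in> hcomp Z k \<Longrightarrow> euler_shift k \<odot>\<^bsub>Z\<^esub> x = \<zero>\<^bsub>Z\<^esub>"
  shows "eulerian (quotient_module Z B)"
proof -
  let ?Q = "quotient_module Z B"
  have coset: "B +>\<^bsub>Z\<^esub> x = (\<lambda>b. b \<oplus>\<^bsub>Z\<^esub> x) ` B" for x by (auto simp: a_r_coset_def')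
  have carrier: "carrier ?Q = (\<lambda>x. B +>\<^bsub>Z\<^esub> x) ` carrier Z"
    by (auto simp: quotient_module_def A_RCOSETS_def')
  have zero: "B +>\<^bsub>Z\<^esub> \<zero>\<^bsub>Z\<^esub> = \<zero>\<^bsub>?Q\<^esub>"
    by (simp add: quotient_module_def coset comm[of _ "\<zero>\<^bsub>Z\<^esub>"] l_zero)
  have add: "(B +>\<^bsub>Z\<^esub> x) \<oplus>\<^bsub>?Q\<^esub> (B +>\<^bsub>Z\<^esub> y) = B +>\<^bsub>Z\<^esub> (x \<oplus>\<^bsub>Z\<^esub> y)" for x y
  proof -
    have swap: "(b \<oplus>\<^bsub>Z\<^esub> x) \<oplus>\<^bsub>Z\<^esub> (b' \<oplus>\<^bsub>Z\<^esub> y) = (b \<oplus>\<^bsub>Z\<^esub> b') \<oplus>\<^bsub>Z\<^esub> (x \<oplus>\<^bsub>Z\<^esub> y)" for b b'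
    proof -
      have "x \<oplus>\<^bsub>Z\<^esub> (b' \<oplus>\<^bsub>Z\<^esub> y) = b' \<oplus>\<^bsub>Z\<^esub> (x \<oplus>\<^bsub>Z\<^esub> y)"
        using assoc[of x b' y] assoc[of b' x y] comm[of x b'] by simp
      then show ?thesis by (simp only: assoc)
    qed
    have "(B +>\<^bsub>Z\<^esub> x) \<oplus>\<^bsub>?Q\<^esub> (B +>\<^bsub>Z\<^esub> y) = (\<Union>b\<in>B. \<Union>b'\<in>B. {(b \<oplus>\<^bsub>Z\<^esub> x) \<oplus>\<^bsub>Z\<^esub> (b' \<oplus>\<^bsub>Z\<^esub> y)})"
      by (simp add: quotient_module_def coset set_add_def')
    also have "\<dots> = (\<Union>b\<in>B. \<Union>b'\<in>B. {(b \<oplus>\<^bsub>Z\<^esub> b') \<oplus>\<^bsub>Z\<^esub> (x \<oplus>\<^bsub>Z\<^esub> y)})"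
      unfolding swap ..
    also have "\<dots> = B +>\<^bsub>Z\<^esub> (x \<oplus>\<^bsub>Z\<^esub> y)"
    proof (intro equalityI subsetI)
      fix z assume "z \<in> B +>\<^bsub>Z\<^esub> (x \<oplus>\<^bsub>Z\<^esub> y)"
      then obtain b where b: "b \<in> B" "z = b \<oplus>\<^bsub>Z\<^esub> (x \<oplus>\<^bsub>Z\<^esub> y)" unfolding coset by blast
      have "z = (b \<oplus>\<^bsub>Z\<^esub> \<zero>\<^bsub>Z\<^esub>) \<oplus>\<^bsub>Z\<^esub> (x \<oplus>\<^bsub>Z\<^esub> y)"
        using b(2) comm[of b "\<zero>\<^bsub>Z\<^esub>"] l_zero by simp
      then show "z \<in> (\<Union>b\<in>B. \<Union>b'\<in>B. {(b \<oplus>\<^bsub>Z\<^esub> b') \<oplus>\<^bsub>Z\<^esub> (x \<oplus>\<^bsub>Z\<^esub> y)})"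
        using b(1) B(1) by blast
    qed (use B(2) coset in auto)
    finally show ?thesis .
  qed
  have smult_coset: "a \<odot>\<^bsub>?Q\<^esub> (B +>\<^bsub>Z\<^esub> x) = B +>\<^bsub>Z\<^esub> (a \<odot>\<^bsub>Z\<^esub> x)" if a: "a \<in> carrier S" and x: "x \<in> carrier Z" for a x
  proof -
    have "a \<odot>\<^bsub>?Q\<^esub> (B +>\<^bsub>Z\<^esub> x) = (\<Union>b\<in>B. \<Union>b'\<in>B. {b' \<oplus>\<^bsub>Z\<^esub> a \<odot>\<^bsub>Z\<^esub> (b \<oplus>\<^bsub>Z\<^esub> x)})"
      by (auto simp: quotient_module_def coset)
    also have "\<dots> = (\<Union>b\<in>B. \<Union>b'\<in>B. {(b' \<oplus>\<^bsub>Z\<^esub> a \<odot>\<^bsub>Z\<^esub> b) \<oplus>\<^bsub>Z\<^esub> a \<odot>\<^bsub>Z\<^esub> x})"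
      using smult(2)[OF a _ x] assoc by simp
    also have "\<dots> = B +>\<^bsub>Z\<^esub> (a \<odot>\<^bsub>Z\<^esub> x)"
    proof (intro equalityI subsetI)
      fix z assume "z \<in> B +>\<^bsub>Z\<^esub> (a \<odot>\<^bsub>Z\<^esub> x)"
      then obtain b where b: "b \<in> B" "z = b \<oplus>\<^bsub>Z\<^esub> a \<odot>\<^bsub>Z\<^esub> x" unfolding coset by blast
      have "z = (b \<oplus>\<^bsub>Z\<^esub> a \<odot>\<^bsub>Z\<^esub> \<zero>\<^bsub>Z\<^esub>) \<oplus>\<^bsub>Z\<^esub> a \<odot>\<^bsub>Z\<^esub> x"
        using b(2) comm[of b "\<zero>\<^bsub>Z\<^esub>"] l_zero smult(1)[OF a] by simp
      then show "z \<in> (\<Union>b\<in>B. \<Union>b'\<in>B. {(b' \<oplus>\<^bsub>Z\<^esub> a \<odot>\<^bsub>Z\<^esub> b) \<oplus>\<^bsub>Z\<^esub> a \<odot>\<^bsub>Z\<^esub> x})"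
        using b(1) B(1) by blast
    qed (use B(2,3) a coset in auto)
    finally show ?thesis .
  qed
  have hc: "hcomp ?Q k = (\<lambda>x. B +>\<^bsub>Z\<^esub> x) ` hcomp Z k" for k by (simp add: quotient_module_def)
  have span: "B +>\<^bsub>Z\<^esub> x \<in> homogeneous_span ?Q" if "x \<in> homogeneous_span Z" for x
    using that
  proof induction
    case zero
    show ?case using \<open>B +>\<^bsub>Z\<^esub> \<zero>\<^bsub>Z\<^esub> = \<zero>\<^bsub>?Q\<^esub>\<close> homogeneous_span.zero by metis
  next
    case (homogeneous x k)
    then show ?case using hc by (intro homogeneous_span.homogeneous[of _ ?Q k]) auto
  next
    case (add x y)
    then show ?case
      using \<open>\<And>x y. (B +>\<^bsub>Z\<^esub> x) \<oplus>\<^bsub>?Q\<^esub> (B +>\<^bsub>Z\<^esub> y) = B +>\<^bsub>Z\<^esub> (x \<oplus>\<^bsub>Z\<^esub> y)\<close> homogeneous_span.add by metis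
  qed
  show ?thesis
    unfolding eulerian_def
  proof (intro conjI ballI allI)
    show "\<zero>\<^bsub>?Q\<^esub> \<in> carrier ?Q" using zero Z(1) carrier by blast
    show "\<zero>\<^bsub>?Q\<^esub> \<oplus>\<^bsub>?Q\<^esub> \<zero>\<^bsub>?Q\<^esub> = \<zero>\<^bsub>?Q\<^esub>"
      using add[of "\<zero>\<^bsub>Z\<^esub>" "\<zero>\<^bsub>Z\<^esub>"] by (simp only: zero l_zero)
    show "U \<oplus>\<^bsub>?Q\<^esub> V \<in> carrier ?Q" if "U \<in> carrier ?Q" "V \<in> carrier ?Q" for U V
      using that add Z(2) unfolding carrier by auto
    show "a \<odot>\<^bsub>?Q\<^esub> U \<in> carrier ?Q" if "a \<in> carrier S" "U \<in> carrier ?Q" for a U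
      using that smult_coset Z(3) unfolding carrier by auto
    show "hcomp ?Q k \<subseteq> carrier ?Q" for k unfolding carrier hc using Z(4) by blast
    show "carrier ?Q \<subseteq> homogeneous_span ?Q" unfolding carrier using span Z(5) by blast
    show "euler_shift k \<odot>\<^bsub>?Q\<^esub> U = \<zero>\<^bsub>?Q\<^esub>" if U: "U \<in> hcomp ?Q k" for k U
    proof -
      obtain x where x: "x \<in> hcomp Z k" "U = B +>\<^bsub>Z\<^esub> x" using U hc by auto
      then show ?thesis
        using smult_coset[OF euler_shift_closed, of x k] Z(4)[of k] Z(6)[OF x(1)] zero by auto
    qed
  qed
qed

end

text \<open>
  That the components of the Weyl algebra form a grading is part of the meaning of a graded module over
  it; it is inherited from the modules of an injective resolution.
\<close>

locale weyl_cech =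
  fixes n :: nat and fs :: "'k::field_char_0 mpoly list"
  assumes weyl_graded: "Z_graded_ring (weyl_algebra n :: ('k mpoly \<Rightarrow> 'k mpoly) graded_ring)"
    and generators: "\<And>f. f \<in> set fs \<Longrightarrow> f \<in> polys n \<and> f \<noteq> 0 \<and> (\<exists>d. homogeneous d f)"
begin

sublocale euler_graded_ring "weyl_algebra n" "weyl_const n :: 'k \<Rightarrow> _" "euler_weyl n"
  by (rule weyl_euler_graded_ring[OF weyl_graded])

abbreviation simplices :: "nat \<Rightarrow> nat set set" where
  "simplices k \<equiv> {T. T \<subseteq> {..<length fs} \<and> card T = k}"

abbreviation denominator :: "nat set \<Rightarrow> 'k mpoly" where
  "denominator T \<equiv> (\<Prod>t\<in>T. fs ! t)"

lemma denominator:
  assumes "T \<in> simplices k"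
  shows "denominator T \<in> polys n" "denominator T \<noteq> 0" "\<exists>d. homogeneous d (denominator T)"
proof -
  have T: "fs ! t \<in> set fs" if "t \<in> T" for t using assms that by auto
  have "finite T" using assms finite_subset by auto
  then show "denominator T \<noteq> 0" using T generators by auto
  show "denominator T \<in> polys n" using T generators by auto
  show "\<exists>d. homogeneous d (denominator T)" using T generators by (intro homogeneous_prod) auto
qed

abbreviation \<C> :: "nat \<Rightarrow> ('k mpoly \<Rightarrow> 'k mpoly, nat set \<Rightarrow> 'k mpoly fract) graded_module" where
  "\<C> \<equiv> cech_module n fs"

abbreviation ext :: "('k mpoly \<Rightarrow> 'k mpoly) \<Rightarrow> 'k mpoly fract \<Rightarrow> 'k mpoly fract" where
  "ext \<equiv> weyl_extension n"

lemma cech_module_simps: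
  "x \<in> carrier (\<C> k) \<longleftrightarrow> (\<forall>T. if T \<in> simplices k then x T \<in> localization n (denominator T) else x T = 0)"
  "x \<in> hcomp (\<C> k) l \<longleftrightarrow> (\<forall>T. if T \<in> simplices k then x T \<in> localization_comp n (denominator T) l else x T = 0)"
  "x \<oplus>\<^bsub>\<C> k\<^esub> y = (\<lambda>T. x T + y T)" "\<zero>\<^bsub>\<C> k\<^esub> = (\<lambda>T. 0)"
  "D \<odot>\<^bsub>\<C> k\<^esub> x = (\<lambda>T. if T \<in> simplices k then ext D (x T) else 0)"
  by (simp_all add: cech_module_def)

lemma cech_carrierI:
  assumes "\<And>T. T \<in> simplices k \<Longrightarrow> x T \<in> localization n (denominator T)"
    and "\<And>T. T \<notin> simplices k \<Longrightarrow> x T = 0"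
  shows "x \<in> carrier (\<C> k)"
  unfolding cech_module_simps(1) if_bool_eq_conj by (intro allI conjI impI assms)

lemma cech_carrierD:
  assumes "x \<in> carrier (\<C> k)"
  shows "T \<in> simplices k \<Longrightarrow> x T \<in> localization n (denominator T)" "T \<notin> simplices k \<Longrightarrow> x T = 0"
proof -
  have "if T \<in> simplices k then x T \<in> localization n (denominator T) else x T = 0"
    using assms unfolding cech_module_simps(1) by (rule spec)
  then show "T \<in> simplices k \<Longrightarrow> x T \<in> localization n (denominator T)" "T \<notin> simplices k \<Longrightarrow> x T = 0"
    by (simp_all only: if_True if_False)
qed

lemma cech_hcompD:
  assumes "x \<in> hcomp (\<C> k) l"
  shows "T \<in> simplices k \<Longrightarrow> x T \<in> localization_comp n (denominator T) l" "T \<notin> simplices k \<Longrightarrow> x T = 0"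
proof -
  have "if T \<in> simplices k then x T \<in> localization_comp n (denominator T) l else x T = 0"
    using assms unfolding cech_module_simps(2) by (rule spec)
  then show "T \<in> simplices k \<Longrightarrow> x T \<in> localization_comp n (denominator T) l" "T \<notin> simplices k \<Longrightarrow> x T = 0"
    by (simp_all only: if_True if_False)
qed

lemma cech_hcomp_subset: "hcomp (\<C> k) l \<subseteq> carrier (\<C> k)"
proof
  fix x assume x: "x \<in> hcomp (\<C> k) l"
  show "x \<in> carrier (\<C> k)"
    by (intro cech_carrierI subsetD[OF localization_comp_subset[of _ _ l]] cech_hcompD[OF x])
qed

lemma cech_fracs:
  assumes "x \<in> carrier (\<C> k)" shows "x T \<in> fracs n"
proof (cases "T \<in> simplices k")
  case True
  show ?thesis
    by (rule localization_fracs[OF denominator(1,2)[OF True] cech_carrierD(1)[OF assms True]])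
next
  case False
  then show ?thesis using cech_carrierD(2)[OF assms] by simp
qed

lemma cech_closed:
  "(\<lambda>T. 0) \<in> carrier (\<C> k)"
  "\<lbrakk>x \<in> carrier (\<C> k); y \<in> carrier (\<C> k)\<rbrakk> \<Longrightarrow> (\<lambda>T. x T + y T) \<in> carrier (\<C> k)"
proof -
  show "(\<lambda>T. 0) \<in> carrier (\<C> k)" by (rule cech_carrierI) (rule localization_0 refl)+
  assume x: "x \<in> carrier (\<C> k)" and y: "y \<in> carrier (\<C> k)"
  show "(\<lambda>T. x T + y T) \<in> carrier (\<C> k)"
  proof (rule cech_carrierI)
    fix T assume T: "T \<in> simplices k"
    show "x T + y T \<in> localization n (denominator T)"
      by (rule localization_add[OF denominator(1,2)[OF T] cech_carrierD(1)[OF x T] cech_carrierD(1)[OF y T]])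
  qed (simp add: cech_carrierD(2)[OF x] cech_carrierD(2)[OF y])
qed

lemma weyl_action:
  assumes "D \<in> carrier (weyl_algebra n)"
  shows "ext D 0 = 0" "\<lbrakk>v \<in> fracs n; w \<in> fracs n\<rbrakk> \<Longrightarrow> ext D (v + w) = ext D v + ext D w"
    "v \<in> fracs n \<Longrightarrow> ext D ((- 1) ^ m * v) = (- 1) ^ m * ext D v"
    "(\<And>t. t \<in> A \<Longrightarrow> g t \<in> fracs n) \<Longrightarrow> ext D (\<Sum>t\<in>A. g t) = (\<Sum>t\<in>A. ext D (g t))"
    "\<lbrakk>f \<in> polys n; f \<noteq> 0; v \<in> localization n f\<rbrakk> \<Longrightarrow> ext D v \<in> localization n f"
proof -
  have W: "ext D \<in> weyl_operators n (fracs n) (\<lambda>p. Fract p 1) frac_derivative"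
    using weyl_extension(1) assms by simp
  then have "ext D \<in> carrier (lin_End (fracs n) (\<lambda>p. Fract p 1))"
    using weyl_operators_fracs_subset by blast
  note D = lin_EndD[OF this]
  show add: "ext D (v + w) = ext D v + ext D w" if "v \<in> fracs n" "w \<in> fracs n" for v w
    using D(3) that .
  have "ext D 0 + ext D 0 = ext D 0 + 0" using add[of 0 0] by simp
  then show zero: "ext D 0 = 0" by (rule add_left_imp_eq)
  have uminus: "ext D (- v) = - ext D v" if "v \<in> fracs n" for v
    using add[of v "- v"] zero that by (simp add: eq_neg_iff_add_eq_0 add.commute)
  show "ext D ((- 1) ^ m * v) = (- 1) ^ m * ext D v" if "v \<in> fracs n"
    using uminus[OF that] by (cases "even m") auto
  show "ext D (\<Sum>t\<in>A. g t) = (\<Sum>t\<in>A. ext D (g t))" if "\<And>t. t \<in> A \<Longrightarrow> g t \<in> fracs n"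
    using that by (induction A rule: infinite_finite_induct) (auto simp: zero add)
  show "ext D v \<in> localization n f" if "f \<in> polys n" "f \<noteq> 0" "v \<in> localization n f"
    using weyl_operator_localization[OF W that] .
qed

lemma cech_smult_closed:
  assumes "D \<in> carrier (weyl_algebra n)" "x \<in> carrier (\<C> k)" shows "D \<odot>\<^bsub>\<C> k\<^esub> x \<in> carrier (\<C> k)"
proof (rule cech_carrierI)
  fix T assume T: "T \<in> simplices k"
  show "(D \<odot>\<^bsub>\<C> k\<^esub> x) T \<in> localization n (denominator T)"
    unfolding cech_module_simps(5) if_P[OF T]
    by (rule weyl_action(5)[OF assms(1) denominator(1,2)[OF T] cech_carrierD(1)[OF assms(2) T]])
qed (simp only: cech_module_simps(5) if_False)

lemma cech_diff_add: "cech_diff fs k (\<lambda>T. x T + y T) = (\<lambda>T. cech_diff fs k x T + cech_diff fs k y T)"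
  by (auto simp: cech_diff_def fun_eq_iff distrib_left sum.distrib)

lemma cech_diff_zero: "cech_diff fs k (\<lambda>T. 0) = (\<lambda>T. 0)"
  by (auto simp: cech_diff_def fun_eq_iff)

lemma fracs_sign: "v \<in> fracs n \<Longrightarrow> (- 1) ^ m * v \<in> fracs n"
  by (cases "even m") auto

lemma cech_diff_fracs:
  assumes "x \<in> carrier (\<C> k)" shows "cech_diff fs k x T \<in> fracs n"
proof -
  have "(\<Sum>t\<in>T. (- 1) ^ card {u \<in> T. u < t} * x (T - {t})) \<in> fracs n"
    by (rule fracs_sum) (rule fracs_sign[OF cech_fracs[OF assms]])
  then show ?thesis by (simp add: cech_diff_def)
qed

lemma face: "T \<in> simplices (Suc k) \<Longrightarrow> t \<in> T \<Longrightarrow> T - {t} \<in> simplices k"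
  using finite_subset[of T "{..<length fs}"] by auto

text \<open>
  Operators act on each coordinate by the same extended operator, which is additive on fractions.
\<close>

lemma cech_diff_smult:
  assumes D: "D \<in> carrier (weyl_algebra n)" and x: "x \<in> carrier (\<C> k)"
  shows "cech_diff fs k (D \<odot>\<^bsub>\<C> k\<^esub> x) = D \<odot>\<^bsub>\<C> (Suc k)\<^esub> cech_diff fs k x"
proof
  fix T
  show "cech_diff fs k (D \<odot>\<^bsub>\<C> k\<^esub> x) T = (D \<odot>\<^bsub>\<C> (Suc k)\<^esub> cech_diff fs k x) T"
  proof (cases "T \<in> simplices (Suc k)")
    case True
    have "cech_diff fs k (D \<odot>\<^bsub>\<C> k\<^esub> x) T = (\<Sum>t\<in>T. (- 1) ^ card {u \<in> T. u < t} * ext D (x (T - {t})))"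
      using True face[OF True] by (auto simp: cech_diff_def cech_module_simps intro!: sum.cong)
    also have "\<dots> = (\<Sum>t\<in>T. ext D ((- 1) ^ card {u \<in> T. u < t} * x (T - {t})))"
      using weyl_action(3)[OF D cech_fracs[OF x]] by simp
    also have "\<dots> = ext D (\<Sum>t\<in>T. (- 1) ^ card {u \<in> T. u < t} * x (T - {t}))"
      by (rule weyl_action(4)[OF D, symmetric]) (rule fracs_sign[OF cech_fracs[OF x]])
    finally show ?thesis using True by (simp add: cech_diff_def cech_module_simps)
  qed (auto simp: cech_diff_def cech_module_simps)
qed

lemma cech_euler:
  assumes "x \<in> hcomp (\<C> k) l" shows "euler_shift l \<odot>\<^bsub>\<C> k\<^esub> x = (\<lambda>T. 0)"
proof
  fix T
  have "ext (euler_shift l) (x T) = 0" if T: "T \<in> simplices k"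
  proof -
    note d = denominator(1,2)[OF T]
    have c: "x T \<in> localization_comp n (denominator T) l" using assms T by (auto simp: cech_module_simps)
    then have "x T \<in> fracs n" using localization_fracs[OF d] localization_comp_subset by blast
    then show ?thesis
      using weyl_extension_euler[OF weyl_graded] euler_frac_localization_comp[OF d c] by simp
  qed
  then show "(euler_shift l \<odot>\<^bsub>\<C> k\<^esub> x) T = 0" by (simp add: cech_module_simps)
qed

abbreviation \<Z> :: "nat \<Rightarrow> ('k mpoly \<Rightarrow> 'k mpoly, nat set \<Rightarrow> 'k mpoly fract) graded_module" where
  "\<Z> \<equiv> cocycles \<C> (cech_diff fs)"

lemma cocycles_simps:
  "x \<in> carrier (\<Z> k) \<longleftrightarrow> x \<in> carrier (\<C> k) \<and> cech_diff fs k x = (\<lambda>T. 0)"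
  "x \<in> hcomp (\<Z> k) l \<longleftrightarrow> x \<in> hcomp (\<C> k) l \<and> cech_diff fs k x = (\<lambda>T. 0)"
  "x \<oplus>\<^bsub>\<Z> k\<^esub> y = (\<lambda>T. x T + y T)" "\<zero>\<^bsub>\<Z> k\<^esub> = (\<lambda>T. 0)" "D \<odot>\<^bsub>\<Z> k\<^esub> x = D \<odot>\<^bsub>\<C> k\<^esub> x"
  by (auto simp: cocycles_def cech_module_simps)

text \<open>
  The Cech differential only takes signed sums of coordinates, and these are eigenvectors for the same
  eigenvalue \<open>l\<close>.
\<close>

lemma euler_frac_cech_diff:
  assumes "x \<in> hcomp (\<C> k) l"
  shows "euler_frac n (cech_diff fs k x T) = of_int l * cech_diff fs k x T"
proof -
  have eigen: "euler_frac n (x T) = of_int l * x T" for T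
  proof (cases "T \<in> simplices k")
    case True
    show ?thesis
      by (rule euler_frac_localization_comp[OF denominator(1,2)[OF True] cech_hcompD(1)[OF assms True]])
  next
    case False
    then show ?thesis using cech_hcompD(2)[OF assms] by simp
  qed
  have "euler_frac n (- v) = - euler_frac n v" for v :: "'k mpoly fract"
    using euler_frac_of_int_mult[of n "- 1" v] by simp
  then have sign: "euler_frac n ((- 1) ^ m * v) = (- 1) ^ m * euler_frac n v" for m and v :: "'k mpoly fract"
    by (cases "even m") auto
  have sum: "euler_frac n (\<Sum>t\<in>A. g t) = (\<Sum>t\<in>A. euler_frac n (g t))" for A :: "nat set" and g :: "nat \<Rightarrow> 'k mpoly fract"
    by (induction A rule: infinite_finite_induct) (auto simp: euler_frac_add)
  show ?thesis by (simp add: cech_diff_def sum sign eigen sum_distrib_left mult.left_commute)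
qed

text \<open>
  Split each coordinate of \<open>x\<close> into homogeneous parts and collect the parts of degree \<open>l\<close> in a cochain \<open>y l\<close>.
  The differentials of the \<open>y l\<close> are Euler eigenvectors with distinct eigenvalues and sum to \<open>d x = 0\<close>, so
  each \<open>y l\<close> is a cocycle.
\<close>

lemma cocycle_span:
  assumes x: "x \<in> carrier (\<Z> k)" shows "x \<in> homogeneous_span (\<Z> k)"
proof -
  have xC: "x \<in> carrier (\<C> k)" and dx: "cech_diff fs k x = (\<lambda>T. 0)" using x by (auto simp: cocycles_simps)
  have "\<forall>T\<in>simplices k. \<exists>p. finite (fst p) \<and> (\<forall>l. snd p l \<in> localization_comp n (denominator T) l) \<and>
      (\<forall>l. l \<notin> fst p \<longrightarrow> snd p l = 0) \<and> x T = (\<Sum>l\<in>fst p. snd p l)"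
  proof
    fix T assume T: "T \<in> simplices k"
    obtain d where "homogeneous d (denominator T)" using denominator(3)[OF T] by blast
    from localization_decompose[OF this cech_carrierD(1)[OF xC T]]
    show "\<exists>p. finite (fst p) \<and> (\<forall>l. snd p l \<in> localization_comp n (denominator T) l) \<and>
      (\<forall>l. l \<notin> fst p \<longrightarrow> snd p l = 0) \<and> x T = (\<Sum>l\<in>fst p. snd p l)" by simp
  qed
  from bchoice[OF this] obtain p where p: "\<forall>T\<in>simplices k. finite (fst (p T)) \<and>
      (\<forall>l. snd (p T) l \<in> localization_comp n (denominator T) l) \<and>
      (\<forall>l. l \<notin> fst (p T) \<longrightarrow> snd (p T) l = 0) \<and> x T = (\<Sum>l\<in>fst (p T). snd (p T) l)" by (rule exE)
  define L w where "L T = fst (p T)" and "w T = snd (p T)" for T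
  have L: "finite (L T)" and w: "w T l \<in> localization_comp n (denominator T) l"
    and w0: "l \<notin> L T \<Longrightarrow> w T l = 0" and sum: "x T = (\<Sum>l\<in>L T. w T l)"
    if "T \<in> simplices k" for T l
    using bspec[OF p that] by (simp_all add: L_def w_def)
  define y where "y l T = (if T \<in> simplices k then w T l else 0)" for l T
  let ?L = "\<Union>T\<in>simplices k. L T"
  have fin: "finite ?L"
    using L finite_subset[of "simplices k" "Pow {..<length fs}"] by auto
  have x_eq: "x T = (\<Sum>l\<in>?L. y l T)" for T
  proof (cases "T \<in> simplices k")
    case True
    then have "(\<Sum>l\<in>L T. w T l) = (\<Sum>l\<in>?L. w T l)"
      using w0 by (intro sum.mono_neutral_left fin) auto
    then show ?thesis using sum[OF True] True by (simp add: y_def)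
  next
    case False
    then have "x T = 0" by (rule cech_carrierD(2)[OF xC])
    moreover have "y l T = 0" for l using False by (simp only: y_def if_False)
    ultimately show ?thesis by simp
  qed
  have yC: "y l \<in> hcomp (\<C> k) l" for l
    unfolding cech_module_simps(2) using w by (simp add: y_def)
  have d_sum: "finite A \<Longrightarrow> cech_diff fs k (\<lambda>T. \<Sum>l\<in>A. y l T) T = (\<Sum>l\<in>A. cech_diff fs k (y l) T)" for A T
    by (induction A rule: finite_induct) (simp_all add: cech_diff_zero cech_diff_add)
  have "cech_diff fs k (y l) T = 0" if "l \<in> ?L" for l T
  proof (rule euler_eigenvectors_independent[OF fin _ _ that])
    show "euler_frac n (cech_diff fs k (y l) T) = of_int l * cech_diff fs k (y l) T" for l
      by (rule euler_frac_cech_diff[OF yC])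
    have "x = (\<lambda>T. \<Sum>l\<in>?L. y l T)" using x_eq by (rule ext)
    then show "(\<Sum>l\<in>?L. cech_diff fs k (y l) T) = 0" using d_sum[OF fin, of T] dx by simp
  qed
  then have yZ: "y l \<in> hcomp (\<Z> k) l" if "l \<in> ?L" for l
    using that yC by (auto simp: cocycles_simps)
  have "finite A \<Longrightarrow> A \<subseteq> ?L \<Longrightarrow> (\<lambda>T. \<Sum>l\<in>A. y l T) \<in> homogeneous_span (\<Z> k)" for A
  proof (induction A rule: finite_induct)
    case empty
    show ?case using homogeneous_span.zero[of "\<Z> k"] by (simp add: cocycles_simps)
  next
    case (insert l A)
    then have "y l \<oplus>\<^bsub>\<Z> k\<^esub> (\<lambda>T. \<Sum>l\<in>A. y l T) \<in> homogeneous_span (\<Z> k)"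
      by (intro homogeneous_span.add homogeneous_span.homogeneous[OF yZ]) auto
    then show ?case using insert.hyps by (simp add: cocycles_simps)
  qed
  from this[OF fin subset_refl] show ?thesis unfolding x_eq[abs_def, symmetric] x_eq[symmetric] .
qed

lemma cech_smult_zero:
  assumes "D \<in> carrier (weyl_algebra n)" shows "D \<odot>\<^bsub>\<C> k\<^esub> (\<lambda>T. 0) = (\<lambda>T. 0)"
  unfolding cech_module_simps(5) weyl_action(1)[OF assms] by simp

lemma cech_smult_add:
  assumes "D \<in> carrier (weyl_algebra n)" "\<And>T. x T \<in> fracs n" "\<And>T. y T \<in> fracs n"
  shows "D \<odot>\<^bsub>\<C> k\<^esub> (\<lambda>T. x T + y T) = (\<lambda>T. (D \<odot>\<^bsub>\<C> k\<^esub> x) T + (D \<odot>\<^bsub>\<C> k\<^esub> y) T)"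
  unfolding cech_module_simps(5) weyl_action(2)[OF assms] by (simp add: fun_eq_iff)

theorem eulerian_local_cohomology: "eulerian (local_cohomology n fs i)"
  unfolding local_cohomology_def cohomology_def
proof (rule eulerian_quotient)
  let ?B = "coboundaries \<C> (cech_diff fs) i"
  have B: "?B = {\<lambda>T. 0} \<or> (\<exists>j. i = Suc j \<and> ?B = cech_diff fs j ` carrier (\<C> j))"
    by (cases i) (auto simp: coboundaries_def cech_module_simps)
  have Bfracs: "b T \<in> fracs n" if b: "b \<in> ?B" for b T
    using B
  proof
    assume "?B = {\<lambda>T. 0}"
    then have "b = (\<lambda>T. 0)" using b by blast
    then show ?thesis by simp
  next
    assume "\<exists>j. i = Suc j \<and> ?B = cech_diff fs j ` carrier (\<C> j)"
    then obtain j where j: "?B = cech_diff fs j ` carrier (\<C> j)" by blast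
    obtain c where c: "c \<in> carrier (\<C> j)" "b = cech_diff fs j c" using b unfolding j by blast
    show ?thesis unfolding c(2) by (rule cech_diff_fracs[OF c(1)])
  qed
  show "\<zero>\<^bsub>\<Z> i\<^esub> \<in> ?B"
    using B
  proof
    assume "\<exists>j. i = Suc j \<and> ?B = cech_diff fs j ` carrier (\<C> j)"
    then obtain j where j: "?B = cech_diff fs j ` carrier (\<C> j)" by blast
    show ?thesis unfolding j cocycles_simps using imageI[OF cech_closed(1)[of j], of "cech_diff fs j"] unfolding cech_diff_zero .
  qed (simp add: cocycles_simps)
  show "b \<oplus>\<^bsub>\<Z> i\<^esub> b' \<in> ?B" if b: "b \<in> ?B" "b' \<in> ?B" for b b'
    using B
  proof
    assume "\<exists>j. i = Suc j \<and> ?B = cech_diff fs j ` carrier (\<C> j)"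
    then obtain j where j: "?B = cech_diff fs j ` carrier (\<C> j)" by blast
    obtain c c' where c: "c \<in> carrier (\<C> j)" "b = cech_diff fs j c"
      "c' \<in> carrier (\<C> j)" "b' = cech_diff fs j c'" using b unfolding j by blast
    have "b \<oplus>\<^bsub>\<Z> i\<^esub> b' = cech_diff fs j (\<lambda>T. c T + c' T)"
      unfolding c(2,4) cech_diff_add cocycles_simps ..
    then show ?thesis unfolding j using cech_closed(2)[OF c(1,3)] by blast
  next
    assume B0: "?B = {\<lambda>T. 0}"
    then have "b = (\<lambda>T. 0)" "b' = (\<lambda>T. 0)" using b by blast+
    then show ?thesis unfolding B0 cocycles_simps by simp
  qed
  show "D \<odot>\<^bsub>\<Z> i\<^esub> b \<in> ?B" if D: "D \<in> carrier (weyl_algebra n)" and b: "b \<in> ?B" for D b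
    using B
  proof
    assume "\<exists>j. i = Suc j \<and> ?B = cech_diff fs j ` carrier (\<C> j)"
    then obtain j where j: "i = Suc j" "?B = cech_diff fs j ` carrier (\<C> j)" by blast
    obtain c where c: "c \<in> carrier (\<C> j)" "b = cech_diff fs j c" using b unfolding j(2) by blast
    have "D \<odot>\<^bsub>\<Z> i\<^esub> b = cech_diff fs j (D \<odot>\<^bsub>\<C> j\<^esub> c)"
      unfolding c(2) cech_diff_smult[OF D c(1)] cocycles_simps j(1) ..
    then show ?thesis unfolding j(2) using cech_smult_closed[OF D c(1)] by blast
  next
    assume B0: "?B = {\<lambda>T. 0}"
    then have "b = (\<lambda>T. 0)" using b by blast
    then show ?thesis unfolding B0 using cech_smult_zero[OF D] by (simp only: cocycles_simps singleton_iff)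
  qed
  show "D \<odot>\<^bsub>\<Z> i\<^esub> \<zero>\<^bsub>\<Z> i\<^esub> = \<zero>\<^bsub>\<Z> i\<^esub>" if "D \<in> carrier (weyl_algebra n)" for D
    unfolding cocycles_simps by (rule cech_smult_zero[OF that])
  show "D \<odot>\<^bsub>\<Z> i\<^esub> (b \<oplus>\<^bsub>\<Z> i\<^esub> x) = D \<odot>\<^bsub>\<Z> i\<^esub> b \<oplus>\<^bsub>\<Z> i\<^esub> D \<odot>\<^bsub>\<Z> i\<^esub> x"
    if D: "D \<in> carrier (weyl_algebra n)" and b: "b \<in> ?B" and x: "x \<in> carrier (\<Z> i)" for D b x
  proof -
    have "x \<in> carrier (\<C> i)" using x unfolding cocycles_simps by blast
    then show ?thesis
      unfolding cocycles_simps by (intro cech_smult_add D Bfracs[OF b] cech_fracs)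
  qed
  show "\<zero>\<^bsub>\<Z> i\<^esub> \<in> carrier (\<Z> i)" 
    unfolding cocycles_simps using cech_closed(1) cech_diff_zero by blast
  show "x \<oplus>\<^bsub>\<Z> i\<^esub> y \<in> carrier (\<Z> i)" if "x \<in> carrier (\<Z> i)" "y \<in> carrier (\<Z> i)" for x y
    using that cech_closed(2) unfolding cocycles_simps by (simp add: cech_diff_add)
  show "D \<odot>\<^bsub>\<Z> i\<^esub> x \<in> carrier (\<Z> i)" if D: "D \<in> carrier (weyl_algebra n)" and x: "x \<in> carrier (\<Z> i)" for D x
  proof -
    have xC: "x \<in> carrier (\<C> i)" and dx: "cech_diff fs i x = (\<lambda>T. 0)" 
      using x unfolding cocycles_simps by blast+
    have "cech_diff fs i (D \<odot>\<^bsub>\<C> i\<^esub> x) = (\<lambda>T. 0)"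
      unfolding cech_diff_smult[OF D xC] dx by (rule cech_smult_zero[OF D])
    then show ?thesis unfolding cocycles_simps using cech_smult_closed[OF D xC] by blast
  qed
  show "hcomp (\<Z> i) k \<subseteq> carrier (\<Z> i)" for k
  proof
    fix x assume "x \<in> hcomp (\<Z> i) k"
    then show "x \<in> carrier (\<Z> i)" unfolding cocycles_simps using cech_hcomp_subset by blast
  qed
  show "carrier (\<Z> i) \<subseteq> homogeneous_span (\<Z> i)" using cocycle_span by blast
  show "euler_shift k \<odot>\<^bsub>\<Z> i\<^esub> x = \<zero>\<^bsub>\<Z> i\<^esub>" if "x \<in> hcomp (\<Z> i) k" for k x
    using that unfolding cocycles_simps by (blast intro: cech_euler)
  show "x \<oplus>\<^bsub>\<Z> i\<^esub> y \<oplus>\<^bsub>\<Z> i\<^esub> z = x \<oplus>\<^bsub>\<Z> i\<^esub> (y \<oplus>\<^bsub>\<Z> i\<^esub> z)" for x y z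
    unfolding cocycles_simps by (simp only: add.assoc)
  show "x \<oplus>\<^bsub>\<Z> i\<^esub> y = y \<oplus>\<^bsub>\<Z> i\<^esub> x" for x y
    unfolding cocycles_simps by (rule ext) (rule add.commute)
  show "\<zero>\<^bsub>\<Z> i\<^esub> \<oplus>\<^bsub>\<Z> i\<^esub> x = x" for x
    unfolding cocycles_simps by (simp only: add_0_left)
qed

end

theorem theorem1p3:
  fixes n i j \<nu> :: nat and l :: int
    and I J :: "'k::field_char_0 mpoly set"
    and fs gs :: "'k mpoly list"
    and M N :: "('k mpoly \<Rightarrow> 'k mpoly, (nat set \<Rightarrow> 'k mpoly fract) set) graded_module"
    and E :: "nat \<Rightarrow> ('k mpoly \<Rightarrow> 'k mpoly, 'e) graded_module"
  assumes "homogeneous_ideal n I" and "homogeneous_ideal n J"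
    and "homogeneous_generators n I fs" and "M = local_cohomology n fs i"
    and "homogeneous_generators n J gs" and "N = local_cohomology n gs j"
    and "graded_injective_resolution (weyl_algebra n) N E \<epsilon> \<delta>"
    and "l \<noteq> 0"
  shows "hcomp (star_Ext (weyl_algebra n) (weyl_const n) M E \<delta> \<nu>) l =
    {\<zero>\<^bsub>star_Ext (weyl_algebra n) (weyl_const n) M E \<delta> \<nu>\<^esub>}"
proof -
  \<comment> \<open>Part of the hypothesis that the modules of the resolution are graded.\<close>
  have graded: "Z_graded_ring (weyl_algebra n :: ('k mpoly \<Rightarrow> 'k mpoly) graded_ring)"
  proof -
    have "graded_injective (weyl_algebra n) (E 0)"
      using assms(7) unfolding graded_injective_resolution_def by (rule conjunct1[THEN spec])
    then have "graded_left_module (weyl_algebra n) (E 0)"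
      unfolding graded_injective_def by (rule conjunct1)
    then show ?thesis by (rule graded_left_module.axioms(1))
  qed
  interpret F: weyl_cech n fs
  proof (rule weyl_cech.intro[OF graded])
    show "f \<in> polys n \<and> f \<noteq> 0 \<and> (\<exists>d. homogeneous d f)" if "f \<in> set fs" for f
      using assms(3)[unfolded homogeneous_generators_def, THEN conjunct1] that by (rule bspec)
  qed
  interpret G: weyl_cech n gs
  proof (rule weyl_cech.intro[OF graded])
    show "f \<in> polys n \<and> f \<noteq> 0 \<and> (\<exists>d. homogeneous d f)" if "f \<in> set gs" for f
      using assms(5)[unfolded homogeneous_generators_def, THEN conjunct1] that by (rule bspec)
  qed
  show ?thesis
    unfolding assms(4)
    by (rule F.star_Ext_concentrated[OF F.eulerian_local_cohomology
          G.eulerian_local_cohomology[of j, folded assms(6)] assms(7,8)])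
qed

end
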